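(* Let $r\ge1$ and let $f_1,\ldots,f_r:\mathbb{Z}\to\mathbb{C}^*$ be group homomorphisms such that the partial products $g_i := \prod_{1\le j\le i} f_j$ satisfy $|g_i(1)|\le1$ for all $1\le i\le r$. Let $i_1<\cdots<i_m$ be the indices with $g_{i_j}(1)=1$ (and set $i_{m+1}:=r+1$ for notational convenience only if needed). If $i_1=1$, then $L_r(f_1,\ldots,f_r;\ s_1,\ldots,s_r)$ has a polar singularity along the hyperplane $s_1=1$, and its residue there is the restriction of $L_{r-1}(f_2,\ldots,f_r;\ s_2,\ldots,s_r)$ to this hyperplane. In general, for $1\le j\le m$ and $n\in\mathbb{Z}_{\le j}$, the residue of $L_r(f_1,\ldots,f_r;\ s_1,\ldots,s_r)$ along the hyperplane $s_1+\cdots+s_{i_j}=n$ is the restriction to this hyperplane of the product of $L_{r-i_j}(f_{i_j+1},\ldots,f_r;\ s_{i_j+1},\ldots,s_r)$ with the $(0,j-n)$-th entry of the matrix $$\mathbf{C}_j := \left(\prod_{i=1}^{i_1-1} g_i(1)\,\mathbf{B_2}(g_i;\ s_1+\cdots+s_i)\right)\times\prod_{k=1}^{j-1}\left(\mathbf{B_1}(s_1+\cdots+s_{i_k}-k)\prod_{i=i_k+1}^{i_{k+1}-1} g_i(1)\,\mathbf{B_2}(g_i;\ s_1+\cdots+s_i-k)\right),$$ where all products are taken in increasing order of the index from left to right.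
   Context: $L_r(f_1,\ldots,f_r;\ s) := \sum_{n_1>\cdots>n_r>0} f_1(n_1)\cdots f_r(n_r)\, n_1^{-s_1}\cdots n_r^{-s_r}$ on $\{\Re(s_1+\cdots+s_i)>i\ \forall i\}$, continued meromorphically to $\mathbb{C}^r$; $L_0:=1$. The residue of a meromorphic function $F$ on $\mathbb{C}^r$ with at most a simple pole along a hyperplane $\ell(s)=n$ ($\ell$ linear) is the restriction to that hyperplane of $(\ell(s)-n)F(s)$. $\mathbb{Z}_{\le j}$ is the set of integers $\le j$. Matrices are upper triangular of type $\mathbb{N}\times\mathbb{N}$ (indices $0,1,2,\ldots$), so products have finite entries. Bernoulli numbers: $x/(e^x-1)=\sum_{n\ge0}B_n x^n/n!$ (so $B_1=-1/2$). Eulerian polynomials: $\sum_{n\ge0}A_n(t)y^n/n! = \frac{1-t}{e^{(t-1)y}-t}$. For an indeterminate $t$, $\mathbf{B_1}(t)$ has entries $(\mathbf{B_1}(t))_{a,a}=\frac{1}{t+a}$, $(\mathbf{B_1}(t))_{a,a+k}=\frac{B_k}{k!}\prod_{l=1}^{k-1}(t+a+l)$ for $k\ge1$, and $0$ below the diagonal. For a group homomorphism $f:\mathbb{Z}\to\mathbb{C}^*$ with $f(1)\neq1$, $\mathbf{B_2}(f;t)$ has entries $(\mathbf{B_2}(f;t))_{a,a+k}=\frac{1}{1-f(1)}\cdot\frac{A_k(f(1))}{(f(1)-1)^k}\cdot\frac{(t+a)(t+a+1)\cdots(t+a+k-1)}{k!}$ for $k\ge0$ (empty product $=1$), and $0$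 below the diagonal. *)

theory Defs
  imports "HOL-Analysis.Analysis" "HOL-Computational_Algebra.Formal_Power_Series"
begin

text \<open>
  The dimension \<open>r\<close> varies inside the statement, so \<open>\<complex>\<^sup>r\<close> is the product space of the
  extensional functions on \<open>{1..r}\<close>; coordinates are numbered from 1.
\<close>

definition Cpow :: "nat \<Rightarrow> (nat \<Rightarrow> complex) topology" where
  "Cpow r = product_topology (\<lambda>_. euclidean) {1..r}"

text \<open>Holomorphic functions of several variables: continuous and holomorphic in each variable.\<close>

definition holo_on :: "nat \<Rightarrow> ((nat \<Rightarrow> complex) \<Rightarrow> complex) \<Rightarrow> (nat \<Rightarrow> complex) set \<Rightarrow> bool" where
  "holo_on r F U \<longleftrightarrow>
     openin (Cpow r) U \<and>
     continuous_map (subtopology (Cpow r) U) euclidean F \<and>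
     (\<forall>s\<in>U. \<forall>i\<in>{1..r}. (\<lambda>z. F (s(i := z))) field_differentiable at (s i))"

definition dense_open_in :: "'a topology \<Rightarrow> 'a set \<Rightarrow> bool" where
  "dense_open_in X U \<longleftrightarrow> openin X U \<and> X closure_of U = topspace X"

text \<open>
  A meromorphic function on \<open>\<complex>\<^sup>r\<close> is locally a quotient of holomorphic functions. It is represented
  by a total function whose values matter only up to changes off a dense open set (in
  particular, its values at the poles are irrelevant); all notions below respect this.
\<close>

definition mero :: "nat \<Rightarrow> ((nat \<Rightarrow> complex) \<Rightarrow> complex) \<Rightarrow> bool" where
  "mero r F \<longleftrightarrow>
     (\<forall>p\<in>topspace (Cpow r). \<exists>V g h U.
        p \<in> V \<and> holo_on r g V \<and> holo_on r h V \<and>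
        dense_open_in (subtopology (Cpow r) V) U \<and>
        (\<forall>s\<in>U. h s \<noteq> 0 \<and> F s = g s / h s))"

text \<open>\<open>F\<close> is regular at \<open>p\<close>, and \<open>v\<close> is the value there of its holomorphic extension.\<close>

definition regular_value ::
  "nat \<Rightarrow> ((nat \<Rightarrow> complex) \<Rightarrow> complex) \<Rightarrow> (nat \<Rightarrow> complex) \<Rightarrow> complex \<Rightarrow> bool" where
  "regular_value r F p v \<longleftrightarrow>
     (\<exists>V g U. p \<in> V \<and> holo_on r g V \<and> dense_open_in (subtopology (Cpow r) V) U \<and>
              (\<forall>s\<in>U. F s = g s) \<and> v = g p)"

definition hyperplane :: "nat \<Rightarrow> ((nat \<Rightarrow> complex) \<Rightarrow> complex) \<Rightarrow> complex \<Rightarrow> (nat \<Rightarrow> complex) set" where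
  "hyperplane r l c = {s \<in> topspace (Cpow r). l s = c}"

text \<open>
  \<open>R\<close> represents the restriction to \<open>H\<close> of the meromorphic function \<open>F\<close>, which is in particular
  required not to have \<open>H\<close> in its polar locus. As \<open>H\<close> itself is nowhere dense, the
  values of \<open>R\<close> come from the holomorphic extension of \<open>F\<close>, not from the representative \<open>F\<close>.
\<close>

definition restricts_to ::
  "nat \<Rightarrow> (nat \<Rightarrow> complex) set \<Rightarrow> ((nat \<Rightarrow> complex) \<Rightarrow> complex) \<Rightarrow> ((nat \<Rightarrow> complex) \<Rightarrow> complex) \<Rightarrow> bool" where
  "restricts_to r H F R \<longleftrightarrow>
     (\<exists>U. dense_open_in (subtopology (Cpow r) H) U \<and> (\<forall>p\<in>U. regular_value r F p (R p)))"

definition has_residue_along ::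
  "nat \<Rightarrow> ((nat \<Rightarrow> complex) \<Rightarrow> complex) \<Rightarrow> ((nat \<Rightarrow> complex) \<Rightarrow> complex) \<Rightarrow> complex \<Rightarrow>
   ((nat \<Rightarrow> complex) \<Rightarrow> complex) \<Rightarrow> bool" where
  "has_residue_along r F l c R \<longleftrightarrow>
     mero r F \<and> restricts_to r (hyperplane r l c) (\<lambda>s. (l s - c) * F s) R"

definition polar_along :: "nat \<Rightarrow> ((nat \<Rightarrow> complex) \<Rightarrow> complex) \<Rightarrow> (nat \<Rightarrow> complex) set \<Rightarrow> bool" where
  "polar_along r F H \<longleftrightarrow> mero r F \<and> (\<forall>p\<in>H. \<not> (\<exists>v. regular_value r F p v))"

definition psum :: "(nat \<Rightarrow> complex) \<Rightarrow> nat \<Rightarrow> complex" where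
  "psum s i = (\<Sum>l=1..i. s l)"

definition conv_domain :: "nat \<Rightarrow> (nat \<Rightarrow> complex) set" where
  "conv_domain r = {s \<in> topspace (Cpow r). \<forall>i\<in>{1..r}. Re (psum s i) > real i}"

definition decr_tuples :: "nat \<Rightarrow> (nat \<Rightarrow> nat) set" where
  "decr_tuples r = {n \<in> {1..r} \<rightarrow>\<^sub>E {0<..}. \<forall>i\<in>{1..r}. \<forall>j\<in>{1..r}. i < j \<longrightarrow> n j < n i}"

definition L_series :: "nat \<Rightarrow> (nat \<Rightarrow> int \<Rightarrow> complex) \<Rightarrow> (nat \<Rightarrow> complex) \<Rightarrow> complex" where
  "L_series r f s =
     (\<Sum>\<^sub>\<infinity>n\<in>decr_tuples r. (\<Prod>i=1..r. f i (int (n i))) * (\<Prod>i=1..r. of_nat (n i) powr (- s i)))"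

text \<open>
  The meromorphic continuation; by the identity theorem any two candidates agree on a dense
  open subset of \<open>\<complex>\<^sup>r\<close>, that is, they represent the same meromorphic function.
\<close>

definition L :: "nat \<Rightarrow> (nat \<Rightarrow> int \<Rightarrow> complex) \<Rightarrow> (nat \<Rightarrow> complex) \<Rightarrow> complex" where
  "L r f = (if r = 0 then (\<lambda>_. 1)
            else (SOME F. mero r F \<and> (\<forall>s\<in>conv_domain r. F s = L_series r f s)))"

text \<open>\<open>L_tail r f i s\<close> is \<open>L\<^bsub>r-i\<^esub>(f\<^bsub>i+1\<^esub>, \<dots>, f\<^bsub>r\<^esub>; s\<^bsub>i+1\<^esub>, \<dots>, s\<^bsub>r\<^esub>)\<close>, as a function of \<open>s \<in> \<complex>\<^sup>r\<close>.\<close>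

definition L_tail :: "nat \<Rightarrow> (nat \<Rightarrow> int \<Rightarrow> complex) \<Rightarrow> nat \<Rightarrow> (nat \<Rightarrow> complex) \<Rightarrow> complex" where
  "L_tail r f i s = L (r - i) (\<lambda>k. f (i + k)) (\<lambda>k\<in>{1..r - i}. s (i + k))"

definition bernoulli_num :: "nat \<Rightarrow> complex" where
  "bernoulli_num n = fact n * fps_nth (fps_X / (fps_exp 1 - 1)) n"

text \<open>
  The value \<open>A\<^sub>n(t)\<close> of the Eulerian polynomial at a complex number \<open>t \<noteq> 1\<close>, read off from the
  generating function at \<open>t\<close>; at \<open>t = 1\<close> the generating function degenerates to \<open>0 / 0\<close>.
\<close>

definition eulerian :: "nat \<Rightarrow> complex \<Rightarrow> complex" where
  "eulerian n t = fact n * fps_nth (fps_const (1 - t) / (fps_exp (t - 1) - fps_const t)) n"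

type_synonym cmat = "nat \<Rightarrow> nat \<Rightarrow> complex"

definition B1_mat :: "complex \<Rightarrow> cmat" where
  "B1_mat t a b =
     (if b < a then 0
      else if b = a then 1 / (t + of_nat a)
      else bernoulli_num (b - a) / fact (b - a) * (\<Prod>l=1..<b - a. t + of_nat a + of_nat l))"

definition B2_mat :: "(int \<Rightarrow> complex) \<Rightarrow> complex \<Rightarrow> cmat" where
  "B2_mat f t a b =
     (if b < a then 0
      else 1 / (1 - f 1) * (eulerian (b - a) (f 1) / (f 1 - 1) ^ (b - a)) *
           ((\<Prod>l<b - a. t + of_nat a + of_nat l) / fact (b - a)))"

text \<open>The product of upper triangular matrices: summands with \<open>k\<close> outside \<open>{a..b}\<close> vanish.\<close>

definition ut_mult :: "cmat \<Rightarrow> cmat \<Rightarrow> cmat" where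
  "ut_mult A B a b = (\<Sum>k=a..b. A a k * B k b)"

definition ut_id :: cmat where
  "ut_id a b = (if a = b then 1 else 0)"

definition mat_scale :: "complex \<Rightarrow> cmat \<Rightarrow> cmat" where
  "mat_scale c A a b = c * A a b"

text \<open>\<open>ut_prod M u v = M u \<cdot> M (u + 1) \<cdots> M (v - 1)\<close>.\<close>

definition ut_prod :: "(nat \<Rightarrow> cmat) \<Rightarrow> nat \<Rightarrow> nat \<Rightarrow> cmat" where
  "ut_prod M u v = foldr ut_mult (map M [u..<v]) ut_id"

definition partial_prod :: "(nat \<Rightarrow> int \<Rightarrow> complex) \<Rightarrow> nat \<Rightarrow> int \<Rightarrow> complex" where
  "partial_prod f i x = (\<Prod>j=1..i. f j x)"

definition C_mat :: "(nat \<Rightarrow> int \<Rightarrow> complex) \<Rightarrow> (nat \<Rightarrow> nat) \<Rightarrow> nat \<Rightarrow> (nat \<Rightarrow> complex) \<Rightarrow> cmat" where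
  "C_mat f idx j s =
     (let g = partial_prod f in
      ut_mult
        (ut_prod (\<lambda>i. mat_scale (g i 1) (B2_mat (g i) (psum s i))) 1 (idx 1))
        (ut_prod
           (\<lambda>k. ut_mult
              (B1_mat (psum s (idx k) - of_nat k))
              (ut_prod (\<lambda>i. mat_scale (g i 1) (B2_mat (g i) (psum s i - of_nat k)))
                 (idx k + 1) (idx (k + 1))))
           1 j))"

end

theory Submission
  imports Defs "HOL-Complex_Analysis.Complex_Analysis"
begin

text \<open>
  Write \<open>z\<^sub>i = f\<^sub>i(1)\<close>. Applying the Euler--Maclaurin formula (twisted by \<open>z\<^sub>1\<close>) to the sum over \<open>n\<^sub>1\<close>
  expresses \<open>L\<^sub>r(s)\<close>, for every \<open>N\<close>, as a sum over \<open>k < N\<close> of the values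
  \<open>L\<^bsub>r-1\<^esub>(f\<^sub>1 f\<^sub>2, f\<^sub>3, \<dots>; s\<^sub>1 + s\<^sub>2 + k - 1, s\<^sub>3, \<dots>)\<close> (without the \<open>- 1\<close> if \<open>z\<^sub>1 \<noteq> 1\<close>), weighted by the
  first row of \<open>B\<^sub>1(s\<^sub>1 - 1)\<close> or \<open>z\<^sub>1 B\<^sub>2(f\<^sub>1; s\<^sub>1)\<close>, plus a remainder that is holomorphic (after
  multiplication by \<open>s\<^sub>1 - 1\<close> if \<open>z\<^sub>1 = 1\<close>) where
  \<open>Re (s\<^sub>1 + \<dots> + s\<^sub>i) > i - N\<close> for all \<open>i\<close>. By induction on \<open>r\<close> this continues \<open>L\<^sub>r\<close> meromorphically with poles on
  hyperplanes \<open>s\<^sub>1 + \<dots> + s\<^sub>i = n\<close> only, and by induction on \<open>i\<close> it gives the residues: the sum over \<open>k\<close> is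
  the multiplication by one more matrix. The identity theorem on \<open>\<complex>\<^sup>r\<close> identifies this continuation
  with \<open>L\<close>.
\<close>

section \<open>Holomorphic functions on the space of complex tuples\<close>

text \<open>A meromorphic function is only an arbitrary representative and a hyperplane is nowhere
  dense, so no residue can be read off from values of \<open>L\<close>. Everything is computed with
  one explicit continuation \<open>Z\<close>, whose exceptional set is controlled by a single
  criterion: all \<open>psum s k\<close> have nonzero imaginary part. The substitutions of the
  recursion shift partial sums by integers, so they preserve the criterion and their exceptional
  sets never have to be pulled back. A residue along \<open>psum s i = n\<close> is computed where
  the other partial sums are nonreal; such points are dense in the hyperplane. The weights are
  forced: with generating function y^e x/(e^y - x), e = 1 or 0 as x = 1 or not, the Taylor
  expansions of the telescoping differences in n_1 match the main term up to the chosen order. The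
  k-th summand at level n is governed by the inner residue at level n + k - e; thus k is the column
  reached in one matrix and the row where the next one starts. Polarity along s_1 = 1 needs in
  addition that the residue is nonzero on every open set.\<close>

lemma topspace_Cpow: "topspace (Cpow r) = {1..r} \<rightarrow>\<^sub>E UNIV"
  by (simp add: Cpow_def)

text \<open>All radii are equal, so one real number measures a neighbourhood. For r = 0 the
  condition is vacuous and every polydisc is the whole one-point space.\<close>

definition pdisc :: "nat \<Rightarrow> (nat \<Rightarrow> complex) \<Rightarrow> real \<Rightarrow> (nat \<Rightarrow> complex) set" where
  "pdisc r p e = {s \<in> topspace (Cpow r). \<forall>i\<in>{1..r}. cmod (s i - p i) < e}"

lemma pdisc_subset: "pdisc r p e \<subseteq> topspace (Cpow r)"
  by (auto simp: pdisc_def)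

lemma centre_in_pdisc: "p \<in> topspace (Cpow r) \<Longrightarrow> e > 0 \<Longrightarrow> p \<in> pdisc r p e"
  by (auto simp: pdisc_def)

lemma pdisc_mono: "d \<le> e \<Longrightarrow> pdisc r p d \<subseteq> pdisc r p e"
  by (force simp: pdisc_def)

lemma openin_pdisc: "openin (Cpow r) (pdisc r p e)"
proof -
  have "pdisc r p e = (\<Pi>\<^sub>E i\<in>{1..r}. ball (p i) e)"
    by (auto simp: pdisc_def topspace_Cpow PiE_iff extensional_def dist_norm norm_minus_commute)
  then show ?thesis
    by (simp add: Cpow_def openin_PiE)
qed

lemma pdisc_in_pdisc:
  assumes "q \<in> pdisc r p e"
  obtains d where "d > 0" "pdisc r q d \<subseteq> pdisc r p e"
\<comment> \<open>Without coordinates the minimum that defines the radius below would range over an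
  empty set.\<close>
proof (cases "r = 0")
  case True
  then have "pdisc r q 1 \<subseteq> pdisc r p e" by (auto simp: pdisc_def)
  then show ?thesis using that[of 1] by simp
next
  case False
  define d where "d = Min ((\<lambda>i. e - cmod (q i - p i)) ` {1..r})"
  have d: "d > 0"
    unfolding d_def using False assms by (subst Min_gr_iff) (auto simp: pdisc_def)
  have "d \<le> e - cmod (q i - p i)" if "i \<in> {1..r}" for i
    unfolding d_def using that by (intro Min_le) auto
  then have "cmod (s i - p i) < e" if "i \<in> {1..r}" "cmod (s i - q i) < d" for s i
    using that norm_triangle_ineq[of "s i - q i" "q i - p i"] by fastforce
  then have "pdisc r q d \<subseteq> pdisc r p e"
    by (auto simp: pdisc_def)
  with d that show ?thesis by blast
qed

lemma openin_Cpow: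
  "openin (Cpow r) U \<longleftrightarrow> U \<subseteq> topspace (Cpow r) \<and> (\<forall>p\<in>U. \<exists>e>0. pdisc r p e \<subseteq> U)"
proof (intro iffI conjI ballI)
  assume U: "openin (Cpow r) U"
  then show "U \<subseteq> topspace (Cpow r)" by (rule openin_subset)
  fix p assume p: "p \<in> U"
  have "\<exists>V. finite {i \<in> {1..r}. V i \<noteq> topspace euclidean} \<and> (\<forall>i\<in>{1..r}. openin euclidean (V i)) \<and>
      p \<in> Pi\<^sub>E {1..r} V \<and> Pi\<^sub>E {1..r} V \<subseteq> U"
    using U p unfolding Cpow_def openin_product_topology_alt by blast
  then obtain V where V: "\<And>i. i \<in> {1..r} \<Longrightarrow> open (V i)" "p \<in> Pi\<^sub>E {1..r} V" "Pi\<^sub>E {1..r} V \<subseteq> U"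
    unfolding open_openin[symmetric] by blast
  have "\<exists>e>0. ball (p i) e \<subseteq> V i" if "i \<in> {1..r}" for i
    using V(1)[OF that] PiE_mem[OF V(2) that] open_contains_ball by blast
  then obtain e where e: "\<And>i. i \<in> {1..r} \<Longrightarrow> e i > 0 \<and> ball (p i) (e i) \<subseteq> V i"
    by metis
  define d where "d = Min (insert 1 (e ` {1..r}))"
  have d: "d > 0" unfolding d_def by (subst Min_gr_iff) (use e in auto)
  have "d \<le> e i" if "i \<in> {1..r}" for i
    unfolding d_def using that by (intro Min_le) auto
  then have "s i \<in> V i" if "s \<in> pdisc r p d" "i \<in> {1..r}" for s i
    using that e[of i] by (force simp: pdisc_def dist_norm norm_minus_commute)
  then have "pdisc r p d \<subseteq> Pi\<^sub>E {1..r} V"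
    by (auto simp: pdisc_def topspace_Cpow PiE_def)
  then show "\<exists>e>0. pdisc r p e \<subseteq> U"
    using d V by blast
next
  assume *: "U \<subseteq> topspace (Cpow r) \<and> (\<forall>p\<in>U. \<exists>e>0. pdisc r p e \<subseteq> U)"
  show "openin (Cpow r) U"
    unfolding openin_subopen[of _ U]
  proof
    fix p assume "p \<in> U"
    then obtain e where "e > 0" "pdisc r p e \<subseteq> U" "p \<in> topspace (Cpow r)" using * by blast
    then show "\<exists>T. openin (Cpow r) T \<and> p \<in> T \<and> T \<subseteq> U"
      by (intro exI[of _ "pdisc r p e"] conjI openin_pdisc centre_in_pdisc)
  qed
qed

text \<open>Traces of polydiscs form a neighbourhood basis in S. In this form, density arguments
  reduce to finding points in polydiscs, without closures or subspace topologies.\<close>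

lemma dense_open_in_Cpow:
  assumes "S \<subseteq> topspace (Cpow r)"
  shows "dense_open_in (subtopology (Cpow r) S) U \<longleftrightarrow>
    U \<subseteq> S \<and> (\<forall>p\<in>U. \<exists>e>0. pdisc r p e \<inter> S \<subseteq> U) \<and> (\<forall>p\<in>S. \<forall>e>0. pdisc r p e \<inter> U \<noteq> {})"
    (is "?L \<longleftrightarrow> ?R")
proof
  assume L: ?L
  then obtain T where T: "openin (Cpow r) T" "U = T \<inter> S"
    by (auto simp: dense_open_in_def openin_subtopology)
  have cl: "S \<subseteq> subtopology (Cpow r) S closure_of U"
    using L assms by (auto simp: dense_open_in_def topspace_subtopology)
  have "pdisc r p e \<inter> U \<noteq> {}" if "p \<in> S" "e > 0" for p e
  proof -
    have "openin (subtopology (Cpow r) S) (pdisc r p e \<inter> S)"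
      using openin_pdisc by (auto simp: openin_subtopology)
    moreover have "p \<in> pdisc r p e \<inter> S" using that assms centre_in_pdisc by blast
    moreover have "p \<in> subtopology (Cpow r) S closure_of U" using cl that by blast
    ultimately show ?thesis unfolding in_closure_of by blast
  qed
  moreover have "\<forall>p\<in>U. \<exists>e>0. pdisc r p e \<inter> S \<subseteq> U"
    using T unfolding openin_Cpow by blast
  ultimately show ?R using T by blast
next
  assume R: ?R
  have "openin (subtopology (Cpow r) S) U"
  proof -
    define T where "T = \<Union>{pdisc r p e |p e. pdisc r p e \<inter> S \<subseteq> U}"
    have "openin (Cpow r) T" unfolding T_def by (rule openin_Union) (use openin_pdisc in auto)
    moreover have "U = T \<inter> S"
    proof
      show "U \<subseteq> T \<inter> S"
        using R assms centre_in_pdisc unfolding T_def by blast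
    qed (auto simp: T_def)
    ultimately show ?thesis by (auto simp: openin_subtopology)
  qed
  moreover have "p \<in> subtopology (Cpow r) S closure_of U" if p: "p \<in> S" for p
  proof -
    have "\<exists>y\<in>U. y \<in> T" if T: "openin (subtopology (Cpow r) S) T" "p \<in> T" for T
    proof -
      obtain T' where "openin (Cpow r) T'" "T = T' \<inter> S" using T by (auto simp: openin_subtopology)
      moreover from this obtain e where "e > 0" "pdisc r p e \<subseteq> T'"
        using T unfolding openin_Cpow by blast
      ultimately show ?thesis using R p by blast
    qed
    then show ?thesis unfolding in_closure_of using p assms by (auto simp: topspace_subtopology)
  qed
  ultimately show ?L
    using assms by (auto simp: dense_open_in_def topspace_subtopology closure_of_subset_topspace
        intro!: antisym[of "subtopology _ _ closure_of _"] dest: subsetD[OF closure_of_subset_topspace])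
qed

lemma dense_open_in_Cpow_topspace:
  "dense_open_in (Cpow r) U \<longleftrightarrow>
    openin (Cpow r) U \<and> (\<forall>p\<in>topspace (Cpow r). \<forall>e>0. pdisc r p e \<inter> U \<noteq> {})"
proof -
  have "pdisc r p e \<inter> topspace (Cpow r) = pdisc r p e" for p e
    using pdisc_subset by blast
  then show ?thesis
    using dense_open_in_Cpow[of "topspace (Cpow r)" r U] by (simp add: openin_Cpow)
qed

lemma holo_onD:
  assumes "holo_on r F U"
  shows "openin (Cpow r) U" "U \<subseteq> topspace (Cpow r)"
    and "\<And>s i. s \<in> U \<Longrightarrow> i \<in> {1..r} \<Longrightarrow> (\<lambda>z. F (s(i := z))) field_differentiable at (s i)"
proof -
  show *: "openin (Cpow r) U" using assms unfolding holo_on_def by (elim conjE)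
  show "U \<subseteq> topspace (Cpow r)" using * by (rule openin_subset)
  show "(\<lambda>z. F (s(i := z))) field_differentiable at (s i)" if "s \<in> U" "i \<in> {1..r}" for s i
    using assms that unfolding holo_on_def by (elim conjE) (drule bspec, assumption, drule bspec)
qed

text \<open>Small punctured neighbourhoods of a already lie in an open S. Continuity on an open set
  thus becomes a pointwise condition in the ambient space, and shrinking the domain costs
  nothing.\<close>

lemma atin_subtopology_open:
  assumes "openin X S" "a \<in> S"
  shows "atin (subtopology X S) a = atin X a"
proof -
  have S: "S \<subseteq> topspace X" using assms openin_subset by blast
  have "eventually P (atin (subtopology X S) a) \<longleftrightarrow> eventually P (atin X a)" for P
  proof
    assume "eventually P (atin X a)"
    then obtain T where "openin X T" "a \<in> T" "\<forall>x\<in>T - {a}. P x"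
      using S assms by (auto simp: eventually_atin)
    then have "openin (subtopology X S) (T \<inter> S) \<and> a \<in> T \<inter> S \<and> (\<forall>x\<in>T \<inter> S - {a}. P x)"
      using assms by (auto simp: openin_subtopology)
    then show "eventually P (atin (subtopology X S) a)"
      unfolding eventually_atin by blast
  next
    assume "eventually P (atin (subtopology X S) a)"
    then obtain T where "openin (subtopology X S) T" "a \<in> T" "\<forall>x\<in>T - {a}. P x"
      using S assms by (auto simp: eventually_atin topspace_subtopology)
    then show "eventually P (atin X a)"
      unfolding eventually_atin using openin_trans_full[OF _ assms(1)] by blast
  qed
  then show ?thesis by (simp add: filter_eq_iff)
qed

lemma holo_on_iff_tendsto:
  "holo_on r F U \<longleftrightarrow> openin (Cpow r) U \<and>
     (\<forall>s\<in>U. (F \<longlongrightarrow> F s) (atin (Cpow r) s)) \<and>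
     (\<forall>s\<in>U. \<forall>i\<in>{1..r}. (\<lambda>z. F (s(i := z))) field_differentiable at (s i))"
proof (cases "openin (Cpow r) U")
  case True
  then have "U \<subseteq> topspace (Cpow r)" by (rule openin_subset)
  then show ?thesis
    using True by (auto simp: holo_on_def continuous_map_atin topspace_subtopology atin_subtopology_open)
qed (auto simp: holo_on_def)

lemma fun_upd_in_topspace:
  assumes "s \<in> topspace (Cpow r)" "i \<in> {1..r}"
  shows "s(i := z) \<in> topspace (Cpow r)"
  using assms by (auto simp: topspace_Cpow PiE_def extensional_def)

lemma fun_upd_in_open:
  assumes "openin (Cpow r) U" "s \<in> U" "i \<in> {1..r}"
  obtains e where "e > 0" "\<And>z. z \<in> ball (s i) e \<Longrightarrow> s(i := z) \<in> U"
proof -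
  obtain e where e: "e > 0" "pdisc r s e \<subseteq> U" "s \<in> topspace (Cpow r)"
    using assms(1,2) unfolding openin_Cpow by blast
  have "s(i := z) \<in> pdisc r s e" if "z \<in> ball (s i) e" for z
    using that e assms fun_upd_in_topspace[OF e(3) assms(3)]
    by (auto simp: pdisc_def dist_norm norm_minus_commute)
  then show ?thesis using that e by blast
qed

lemma holo_on_subset:
  assumes "holo_on r F U" "openin (Cpow r) V" "V \<subseteq> U"
  shows "holo_on r F V"
  using assms unfolding holo_on_iff_tendsto by blast

lemma holo_on_cong:
  assumes "holo_on r F U" "\<And>s. s \<in> U \<Longrightarrow> F s = G s"
  shows "holo_on r G U"
proof -
  have "(\<lambda>z. G (s(i := z))) field_differentiable at (s i)" if s: "s \<in> U" "i \<in> {1..r}" for s i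
  proof -
    obtain e where e: "e > 0" "\<And>z. z \<in> ball (s i) e \<Longrightarrow> s(i := z) \<in> U"
      using fun_upd_in_open[OF holo_onD(1)[OF assms(1)] s] by blast
    have ev: "eventually (\<lambda>z. F (s(i := z)) = G (s(i := z))) (nhds (s i))"
      using e assms(2) by (auto simp: eventually_nhds intro!: exI[of _ "ball (s i) e"])
    obtain D where "((\<lambda>z. F (s(i := z))) has_field_derivative D) (at (s i))"
      using holo_onD(3)[OF assms(1) s] by (auto simp: field_differentiable_def)
    then have "((\<lambda>z. G (s(i := z))) has_field_derivative D) (at (s i))"
      by (rule DERIV_cong_ev[OF refl ev refl, THEN iffD1])
    then show ?thesis by (auto simp: field_differentiable_def)
  qed
  moreover have "continuous_map (subtopology (Cpow r) U) euclidean G"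
  proof (rule continuous_map_eq[where f = F])
    show "continuous_map (subtopology (Cpow r) U) euclidean F"
      using assms(1) unfolding holo_on_def by (elim conjE)
    show "F s = G s" if "s \<in> topspace (subtopology (Cpow r) U)" for s
      using that assms(2) unfolding topspace_subtopology by blast
  qed
  moreover have "openin (Cpow r) U" using assms(1) by (rule holo_onD)
  ultimately show ?thesis
    unfolding holo_on_def by blast
qed

lemma holo_on_const: "openin (Cpow r) U \<Longrightarrow> holo_on r (\<lambda>_. c) U"
  by (auto simp: holo_on_iff_tendsto)

lemma holo_on_coord:
  assumes "openin (Cpow r) U" "i \<in> {1..r}"
  shows "holo_on r (\<lambda>s. s i) U"
proof -
  have "continuous_map (Cpow r) euclidean (\<lambda>s. s i)"
    unfolding Cpow_def using assms(2) by (rule continuous_map_product_projection)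
  then have "continuous_map (subtopology (Cpow r) U) euclidean (\<lambda>s. s i)"
    by (rule continuous_map_from_subtopology)
  moreover have "(\<lambda>z. (s(j := z)) i) field_differentiable at (s j)" for s j
    by (cases "i = j") auto
  ultimately show ?thesis using assms unfolding holo_on_def by blast
qed

lemma holo_on_add: "holo_on r F U \<Longrightarrow> holo_on r G U \<Longrightarrow> holo_on r (\<lambda>s. F s + G s) U"
  by (auto simp: holo_on_iff_tendsto intro!: tendsto_add field_differentiable_add)

lemma holo_on_mult: "holo_on r F U \<Longrightarrow> holo_on r G U \<Longrightarrow> holo_on r (\<lambda>s. F s * G s) U"
  by (auto simp: holo_on_iff_tendsto intro!: tendsto_mult field_differentiable_mult)

lemma holo_on_diff: "holo_on r F U \<Longrightarrow> holo_on r G U \<Longrightarrow> holo_on r (\<lambda>s. F s - G s) U"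
  by (auto simp: holo_on_iff_tendsto intro!: tendsto_diff field_differentiable_diff)

lemma holo_on_divide:
  assumes "holo_on r F U" "holo_on r G U" "\<And>s. s \<in> U \<Longrightarrow> G s \<noteq> 0"
  shows "holo_on r (\<lambda>s. F s / G s) U"
  using assms by (auto simp: holo_on_iff_tendsto intro!: tendsto_divide field_differentiable_divide)

lemma holo_on_sum:
  assumes "openin (Cpow r) U" "\<And>a. a \<in> A \<Longrightarrow> holo_on r (F a) U"
  shows "holo_on r (\<lambda>s. \<Sum>a\<in>A. F a s) U"
  using assms(2)
  by (induction A rule: infinite_finite_induct)
    (simp_all add: holo_on_const[OF assms(1)] holo_on_add)

lemma holo_on_prod:
  assumes "openin (Cpow r) U" "\<And>a. a \<in> A \<Longrightarrow> holo_on r (F a) U"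
  shows "holo_on r (\<lambda>s. \<Prod>a\<in>A. F a s) U"
  using assms(2)
  by (induction A rule: infinite_finite_induct)
    (simp_all add: holo_on_const[OF assms(1)] holo_on_mult)

lemma holo_on_compose_entire:
  assumes "holo_on r F U" "\<And>z. h field_differentiable at z"
  shows "holo_on r (\<lambda>s. h (F s)) U"
proof -
  have "((\<lambda>s. h (F s)) \<longlongrightarrow> h (F s)) (atin (Cpow r) s)" if "s \<in> U" for s
    using assms that
    by (auto simp: holo_on_iff_tendsto intro!: isCont_tendsto_compose[of _ h]
        field_differentiable_imp_continuous_at)
  moreover have "(\<lambda>z. h (F (s(i := z)))) field_differentiable at (s i)" if "s \<in> U" "i \<in> {1..r}" for s i
    using field_differentiable_compose[of "\<lambda>z. F (s(i := z))" "s i" h] assms that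
    by (auto simp: holo_on_iff_tendsto o_def)
  ultimately show ?thesis using assms(1) by (auto simp: holo_on_iff_tendsto)
qed

lemma holo_on_psum:
  assumes "openin (Cpow r) U" "i \<le> r"
  shows "holo_on r (\<lambda>s. psum s i) U"
  unfolding psum_def using assms by (intro holo_on_sum holo_on_coord) auto

lemma holo_on_locally:
  assumes "openin (Cpow r) U" "\<And>p. p \<in> U \<Longrightarrow> \<exists>e>0. holo_on r F (pdisc r p e)"
  shows "holo_on r F U"
proof -
  have U: "U \<subseteq> topspace (Cpow r)" using assms openin_subset by blast
  have "(F \<longlongrightarrow> F s) (atin (Cpow r) s)" if "s \<in> U" for s
  proof -
    obtain e where "e > 0" "holo_on r F (pdisc r s e)" using assms(2) \<open>s \<in> U\<close> by blast
    moreover from this have "s \<in> pdisc r s e" using U that centre_in_pdisc by blast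
    ultimately show ?thesis by (auto simp: holo_on_iff_tendsto)
  qed
  moreover have "(\<lambda>z. F (s(i := z))) field_differentiable at (s i)" if "s \<in> U" "i \<in> {1..r}" for s i
  proof -
    obtain e where "e > 0" "holo_on r F (pdisc r s e)" using assms(2) \<open>s \<in> U\<close> by blast
    then show ?thesis using holo_onD(3)[of r F "pdisc r s e" s i] centre_in_pdisc U that by blast
  qed
  ultimately show ?thesis using assms(1) by (auto simp: holo_on_iff_tendsto)
qed

lemma pdisc_min: "pdisc r p (min a b) = pdisc r p a \<inter> pdisc r p b"
  by (auto simp: pdisc_def)

lemma tendsto_atin_Cpow:
  fixes F :: "(nat \<Rightarrow> complex) \<Rightarrow> complex"
  assumes "p \<in> topspace (Cpow r)"
  shows "(F \<longlongrightarrow> F p) (atin (Cpow r) p) \<longleftrightarrow>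
    (\<forall>\<epsilon>>0. \<exists>d>0. \<forall>s\<in>pdisc r p d. cmod (F s - F p) < \<epsilon>)" (is "?L \<longleftrightarrow> ?R")
proof
  assume L: ?L
  show ?R
  proof (intro allI impI)
    fix \<epsilon> :: real assume \<epsilon>: "\<epsilon> > 0"
    then have "eventually (\<lambda>s. dist (F s) (F p) < \<epsilon>) (atin (Cpow r) p)"
      using L tendstoD by blast
    then obtain T where T: "openin (Cpow r) T" "p \<in> T" "\<forall>s\<in>T - {p}. dist (F s) (F p) < \<epsilon>"
      using assms unfolding eventually_atin by blast
    then obtain d where d: "d > 0" "pdisc r p d \<subseteq> T" unfolding openin_Cpow by blast
    have "cmod (F s - F p) < \<epsilon>" if "s \<in> pdisc r p d" for s
      using that T d \<epsilon> by (cases "s = p") (auto simp: dist_norm)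
    then show "\<exists>d>0. \<forall>s\<in>pdisc r p d. cmod (F s - F p) < \<epsilon>" using d by blast
  qed
next
  assume R: ?R
  show ?L
  proof (rule tendstoI)
    fix \<epsilon> :: real assume "\<epsilon> > 0"
    then obtain d where d: "d > 0" "\<forall>s\<in>pdisc r p d. cmod (F s - F p) < \<epsilon>" using R by blast
    then show "eventually (\<lambda>s. dist (F s) (F p) < \<epsilon>) (atin (Cpow r) p)"
      unfolding eventually_atin dist_norm using openin_pdisc[of r p d] centre_in_pdisc[OF assms d(1)]
      by blast
  qed
qed

lemma holo_on_continuousD:
  assumes "holo_on r F U" "p \<in> U" "\<epsilon> > 0"
  shows "\<exists>d>0. pdisc r p d \<subseteq> U \<and> (\<forall>s\<in>pdisc r p d. cmod (F s - F p) < \<epsilon>)"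
proof -
  have p: "p \<in> topspace (Cpow r)" using holo_onD(2)[OF assms(1)] assms(2) by blast
  have "(F \<longlongrightarrow> F p) (atin (Cpow r) p)"
    using assms(1,2) unfolding holo_on_iff_tendsto by blast
  then obtain d where d: "d > 0" "\<forall>s\<in>pdisc r p d. cmod (F s - F p) < \<epsilon>"
    using assms(3) unfolding tendsto_atin_Cpow[OF p] by blast
  obtain d' where d': "d' > 0" "pdisc r p d' \<subseteq> U"
    using holo_onD(1)[OF assms(1)] assms(2) unfolding openin_Cpow by blast
  show ?thesis
    by (rule exI[of _ "min d d'"]) (use d d' in \<open>auto simp: pdisc_min\<close>)
qed

text \<open>Each input coordinate i is added to the single output coordinate \<open>a i\<close>, or
  dropped if \<open>a i\<close> lies outside \<open>{1..r'}\<close>. This covers both substitutions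
  of the proof: merging the first two coordinates with a shift, and forgetting an initial
  segment.\<close>

definition aff :: "nat \<Rightarrow> nat \<Rightarrow> (nat \<Rightarrow> nat) \<Rightarrow> (nat \<Rightarrow> complex) \<Rightarrow> (nat \<Rightarrow> complex) \<Rightarrow> nat \<Rightarrow> complex" where
  "aff r r' a c s = (\<lambda>j\<in>{1..r'}. c j + (\<Sum>i\<in>{i\<in>{1..r}. a i = j}. s i))"

lemma aff_topspace: "aff r r' a c s \<in> topspace (Cpow r')"
  by (auto simp: aff_def topspace_Cpow)

text \<open>An input coordinate moves at most one output coordinate, and that one by a translation.
  Hence separate holomorphy survives composition with \<open>aff\<close> by the one-variable chain
  rule alone.\<close>

lemma aff_fun_upd:
  assumes "i \<in> {1..r}"
  shows "aff r r' a c (s(i := z)) =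
    (if a i \<in> {1..r'} then (aff r r' a c s)(a i := aff r r' a c s (a i) + (z - s i)) else aff r r' a c s)"
proof -
  have "(\<Sum>l\<in>{l\<in>{1..r}. a l = j}. (s(i := z)) l) =
     (\<Sum>l\<in>{l\<in>{1..r}. a l = j}. s l) + (if j = a i then z - s i else 0)" for j
  proof -
    have "(\<Sum>l\<in>{l\<in>{1..r}. a l = j}. (s(i := z)) l) =
       (\<Sum>l\<in>{l\<in>{1..r}. a l = j}. s l + (if l = i then z - s i else 0))"
      by (intro sum.cong) auto
    also have "\<dots> = (\<Sum>l\<in>{l\<in>{1..r}. a l = j}. s l) + (if j = a i then z - s i else 0)"
      using assms by (auto simp: sum.distrib sum.delta)
    finally show ?thesis .
  qed
  then show ?thesis unfolding aff_def by (auto simp: fun_eq_iff)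
qed

text \<open>An output coordinate sums at most r inputs; dividing by 1 + r instead of r keeps the
  estimate strict and covers r = 0.\<close>

lemma aff_pdisc:
  assumes "s \<in> pdisc r p (e / (1 + real r))" "e > 0"
  shows "aff r r' a c s \<in> pdisc r' (aff r r' a c p) e"
proof -
  have "cmod (aff r r' a c s j - aff r r' a c p j) < e" if "j \<in> {1..r'}" for j
  proof -
    have "cmod (aff r r' a c s j - aff r r' a c p j) = cmod (\<Sum>i\<in>{i\<in>{1..r}. a i = j}. s i - p i)"
      using that by (simp add: aff_def sum_subtractf)
    also have "\<dots> \<le> (\<Sum>i\<in>{i\<in>{1..r}. a i = j}. cmod (s i - p i))" by (rule norm_sum)
    also have "\<dots> \<le> (\<Sum>i\<in>{1..r}. cmod (s i - p i))" by (rule sum_mono2) auto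
    also have "\<dots> \<le> (\<Sum>i\<in>{1..r}. e / (1 + real r))"
      using assms by (intro sum_mono) (auto simp: pdisc_def less_imp_le)
    also have "\<dots> < e" using assms by (simp add: field_simps)
    finally show ?thesis .
  qed
  then show ?thesis by (simp add: pdisc_def aff_topspace)
qed

lemma holo_on_aff:
  assumes F: "holo_on r' F V" and U: "openin (Cpow r) U" and UV: "\<And>s. s \<in> U \<Longrightarrow> aff r r' a c s \<in> V"
  shows "holo_on r (\<lambda>s. F (aff r r' a c s)) U"
proof -
  have "((\<lambda>s. F (aff r r' a c s)) \<longlongrightarrow> F (aff r r' a c p)) (atin (Cpow r) p)" if p: "p \<in> U" for p
  proof -
    have pt: "p \<in> topspace (Cpow r)" using U p openin_subset by blast
    show ?thesis
    proof (subst tendsto_atin_Cpow[OF pt, where F = "\<lambda>s. F (aff r r' a c s)"], intro allI impI)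
      fix \<epsilon> :: real assume "\<epsilon> > 0"
      then obtain d where d: "d > 0" "\<And>s. s \<in> pdisc r' (aff r r' a c p) d \<Longrightarrow> cmod (F s - F (aff r r' a c p)) < \<epsilon>"
        using holo_on_continuousD[OF F UV[OF p] \<open>\<epsilon> > 0\<close>] by blast
      then show "\<exists>d>0. \<forall>s\<in>pdisc r p d. cmod (F (aff r r' a c s) - F (aff r r' a c p)) < \<epsilon>"
        by (intro exI[of _ "d / (1 + real r)"]) (auto simp: aff_pdisc)
    qed
  qed
  moreover have "(\<lambda>z. F (aff r r' a c (s(i := z)))) field_differentiable at (s i)"
    if s: "s \<in> U" "i \<in> {1..r}" for s i
  proof (cases "a i \<in> {1..r'}")
    case True
    have "(\<lambda>w. F ((aff r r' a c s)(a i := w))) field_differentiable at (aff r r' a c s (a i))"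
      using holo_onD(3)[OF F UV[OF s(1)] True] .
    then have "((\<lambda>w. F ((aff r r' a c s)(a i := w))) \<circ> (\<lambda>z. aff r r' a c s (a i) + (z - s i)))
        field_differentiable at (s i)"
      by (intro field_differentiable_compose) (auto intro!: derivative_intros)
    then show ?thesis using True by (simp add: aff_fun_upd[OF s(2)] o_def)
  qed (simp only: aff_fun_upd[OF s(2)] if_False field_differentiable_const)
  ultimately show ?thesis using U unfolding holo_on_iff_tendsto by blast
qed

lemma holomorphic_on_slice:
  assumes "holo_on r F (pdisc r p e)" "s \<in> pdisc r p e" "i \<in> {1..r}"
  shows "(\<lambda>z. F (s(i := z))) holomorphic_on ball (p i) e"
proof -
  have "(\<lambda>w. F (s(i := w))) field_differentiable at z" if z: "z \<in> ball (p i) e" for z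
  proof -
    have "s(i := z) \<in> pdisc r p e"
      using z assms fun_upd_in_topspace[of s r i z] by (auto simp: pdisc_def dist_norm norm_minus_commute)
    from holo_onD(3)[OF assms(1) this assms(3)] show ?thesis by simp
  qed
  then show ?thesis by (simp add: holomorphic_on_def field_differentiable_at_within)
qed

text \<open>A local summable majorant gives uniform convergence of the finite partial sums.
  Continuity is then an epsilon/3 argument, and holomorphy in a single variable follows from
  Weierstrass' theorem on a disc in that coordinate.\<close>

lemma holo_on_infsum:
  assumes U: "openin (Cpow r) U" and f: "\<And>a. a \<in> A \<Longrightarrow> holo_on r (f a) U"
    and M: "\<And>p. p \<in> U \<Longrightarrow> \<exists>e>0. \<exists>M. M summable_on A \<and> (\<forall>a\<in>A. \<forall>s\<in>pdisc r p e. cmod (f a s) \<le> M a)"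
  shows "holo_on r (\<lambda>s. \<Sum>\<^sub>\<infinity>a\<in>A. f a s) U"
proof (rule holo_on_locally[OF U])
  fix p assume p: "p \<in> U"
  obtain e1 where e1: "e1 > 0" "pdisc r p e1 \<subseteq> U" using U p unfolding openin_Cpow by blast
  obtain e2 M where e2: "e2 > 0" "M summable_on A" "\<And>a s. a \<in> A \<Longrightarrow> s \<in> pdisc r p e2 \<Longrightarrow> cmod (f a s) \<le> M a"
    using M[OF p] by blast
  define e where "e = min e1 e2"
  have e: "e > 0" "pdisc r p e \<subseteq> U" "pdisc r p e \<subseteq> pdisc r p e2"
    using e1 e2 by (auto simp: e_def pdisc_min)
  have fe: "holo_on r (f a) (pdisc r p e)" if "a \<in> A" for a
    using holo_on_subset[OF f[OF that] openin_pdisc e(2)] .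
  have partial: "holo_on r (\<lambda>s. \<Sum>a\<in>X. f a s) (pdisc r p e)" if "X \<subseteq> A" for X
    using fe that by (intro holo_on_sum openin_pdisc) auto
  have "uniform_limit (pdisc r p e) (\<lambda>X s. \<Sum>a\<in>X. f a s) (\<lambda>s. \<Sum>\<^sub>\<infinity>a\<in>A. f a s) (finite_subsets_at_top A)"
    by (rule Weierstrass_m_test_general[OF _ e2(2)]) (use e2(3) e(3) in auto)
  note ul = this
  have "((\<lambda>s. \<Sum>\<^sub>\<infinity>a\<in>A. f a s) \<longlongrightarrow> (\<Sum>\<^sub>\<infinity>a\<in>A. f a q)) (atin (Cpow r) q)" if q: "q \<in> pdisc r p e" for q
  proof -
    have qt: "q \<in> topspace (Cpow r)" using q pdisc_subset by blast
    show ?thesis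
    proof (subst tendsto_atin_Cpow[OF qt, where F = "\<lambda>s. \<Sum>\<^sub>\<infinity>a\<in>A. f a s"], intro allI impI)
      fix \<epsilon> :: real assume \<epsilon>: "\<epsilon> > 0"
      then have "eventually (\<lambda>X. (\<forall>s\<in>pdisc r p e. dist (\<Sum>a\<in>X. f a s) (\<Sum>\<^sub>\<infinity>a\<in>A. f a s) < \<epsilon> / 3) \<and> X \<subseteq> A)
          (finite_subsets_at_top A)"
        using uniform_limitD[OF ul, of "\<epsilon> / 3"]
        by (intro eventually_conj[OF _ eventually_finite_subsets_at_top_weakI]) (simp_all add: \<epsilon>)
      from eventually_happens'[OF finite_subsets_at_top_neq_bot this]
      obtain X where X: "X \<subseteq> A" "\<And>s. s\<in>pdisc r p e \<Longrightarrow> dist (\<Sum>a\<in>X. f a s) (\<Sum>\<^sub>\<infinity>a\<in>A. f a s) < \<epsilon> / 3"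
        by blast
      obtain d where d: "d > 0" "pdisc r q d \<subseteq> pdisc r p e"
          "\<And>s. s \<in> pdisc r q d \<Longrightarrow> cmod ((\<Sum>a\<in>X. f a s) - (\<Sum>a\<in>X. f a q)) < \<epsilon> / 3"
        using holo_on_continuousD[OF partial[OF X(1)] q, of "\<epsilon> / 3"] \<epsilon> by (metis zero_less_divide_iff zero_less_numeral)
      have close: "cmod ((\<Sum>\<^sub>\<infinity>a\<in>A. f a s) - (\<Sum>\<^sub>\<infinity>a\<in>A. f a q)) < \<epsilon>" if s: "s \<in> pdisc r q d" for s
      proof -
        have "s \<in> pdisc r p e" using s d(2) by (rule subsetD[rotated])
        then have "dist (\<Sum>\<^sub>\<infinity>a\<in>A. f a s) (\<Sum>a\<in>X. f a s) < \<epsilon> / 3"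
          by (subst dist_commute) (rule X(2))
        moreover have "dist (\<Sum>a\<in>X. f a s) (\<Sum>a\<in>X. f a q) < \<epsilon> / 3"
          unfolding dist_norm by (rule d(3)[OF s])
        ultimately have "dist (\<Sum>\<^sub>\<infinity>a\<in>A. f a s) (\<Sum>\<^sub>\<infinity>a\<in>A. f a q) < \<epsilon>"
          by (rule dist_triangle_third[OF _ _ X(2)[OF q]])
        then show ?thesis unfolding dist_norm .
      qed
      show "\<exists>d>0. \<forall>s\<in>pdisc r q d. cmod ((\<Sum>\<^sub>\<infinity>a\<in>A. f a s) - (\<Sum>\<^sub>\<infinity>a\<in>A. f a q)) < \<epsilon>"
        by (intro exI[of _ d] conjI ballI d(1) close)
    qed
  qed
  moreover have "(\<lambda>z. \<Sum>\<^sub>\<infinity>a\<in>A. f a (q(i := z))) field_differentiable at (q i)"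
    if q: "q \<in> pdisc r p e" "i \<in> {1..r}" for q i
  proof -
    define G where "G = (\<lambda>X z. \<Sum>a\<in>X. f a (q(i := z)))"
    have "q i \<in> ball (p i) e" using q by (auto simp: pdisc_def dist_norm norm_minus_commute)
    then obtain d where d: "d > 0" "cball (q i) d \<subseteq> ball (p i) e"
      using open_contains_cball by (metis open_ball)
    have sl: "q(i := z) \<in> pdisc r p e" if "z \<in> ball (p i) e" for z
      using that q fun_upd_in_topspace[of q r i z] by (auto simp: pdisc_def dist_norm norm_minus_commute)
    have hol: "G X holomorphic_on ball (p i) e" if "X \<subseteq> A" for X
      using holomorphic_on_slice[OF partial[OF that] q] by (simp add: G_def)
    have ev: "eventually (\<lambda>X. continuous_on (cball (q i) d) (G X) \<and> G X holomorphic_on ball (q i) d)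
        (finite_subsets_at_top A)"
    proof (rule eventually_finite_subsets_at_top_weakI)
      fix X assume "X \<subseteq> A"
      then have "G X holomorphic_on cball (q i) d" using hol d(2) holomorphic_on_subset by blast
      then show "continuous_on (cball (q i) d) (G X) \<and> G X holomorphic_on ball (q i) d"
        using holomorphic_on_imp_continuous_on holomorphic_on_subset ball_subset_cball by blast
    qed
    have "uniform_limit (cball (q i) d) G (\<lambda>z. \<Sum>\<^sub>\<infinity>a\<in>A. f a (q(i := z))) (finite_subsets_at_top A)"
      unfolding G_def
    proof (rule Weierstrass_m_test_general[OF _ e2(2)])
      fix a z assume "a \<in> A" "z \<in> cball (q i) d"
      then have "q(i := z) \<in> pdisc r p e2" using sl d(2) e(3) by blast
      then show "cmod (f a (q(i := z))) \<le> M a" using e2(3) \<open>a \<in> A\<close> by blast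
    qed
    then have "(\<lambda>z. \<Sum>\<^sub>\<infinity>a\<in>A. f a (q(i := z))) holomorphic_on ball (q i) d"
      by (rule holomorphic_uniform_limit[OF ev _ finite_subsets_at_top_neq_bot])
    then show ?thesis
      using d(1) by (intro holomorphic_on_imp_differentiable_at[of _ "ball (q i) d"]) simp_all
  qed
  ultimately have "holo_on r (\<lambda>s. \<Sum>\<^sub>\<infinity>a\<in>A. f a s) (pdisc r p e)"
    by (intro holo_on_iff_tendsto[THEN iffD2] conjI ballI openin_pdisc)
  then show "\<exists>e>0. holo_on r (\<lambda>s. \<Sum>\<^sub>\<infinity>a\<in>A. f a s) (pdisc r p e)"
    by (intro exI[of _ e] conjI e(1))
qed

section \<open>The identity theorem\<close>

lemma holo_on_zero_by_density:
  assumes F: "holo_on r F V" and U: "\<And>p e. p \<in> V \<Longrightarrow> e > 0 \<Longrightarrow> \<exists>s\<in>pdisc r p e. F s = 0" and p: "p \<in> V"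
  shows "F p = 0"
proof (rule ccontr)
  assume "F p \<noteq> 0"
  then have "cmod (F p) > 0" by simp
  from holo_on_continuousD[OF F p this]
  obtain d where d: "d > 0" "\<forall>s\<in>pdisc r p d. cmod (F s - F p) < cmod (F p)"
    by blast
  obtain s where "s \<in> pdisc r p d" "F s = 0" using U[OF p d(1)] by blast
  then show False using d(2) by force
qed

text \<open>The coordinates are released one at a time: with coordinates k+1, ..., r still close to
  q, the one-variable identity theorem extends the vanishing in coordinate k from a small disc to
  the full disc.\<close>

lemma holo_on_pdisc_identity:
  assumes F: "holo_on r F (pdisc r p e)" and q: "q \<in> pdisc r p e" and d: "d > 0"
    and z: "\<And>s. s \<in> pdisc r p e \<Longrightarrow> s \<in> pdisc r q d \<Longrightarrow> F s = 0" and s: "s \<in> pdisc r p e"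
  shows "F s = 0"
proof -
  have "k \<le> r \<Longrightarrow> s \<in> pdisc r p e \<Longrightarrow> (\<And>i. i \<in> {k+1..r} \<Longrightarrow> cmod (s i - q i) < d) \<Longrightarrow> F s = 0" for k s
  proof (induction k arbitrary: s)
    case 0
    then show ?case using z[of s] by (auto simp: pdisc_def)
  next
    case (Suc k)
    let ?i = "Suc k" and ?g = "\<lambda>w. F (s(Suc k := w))"
    have i: "?i \<in> {1..r}" using Suc by simp
    have hol: "?g holomorphic_on ball (p ?i) e" using holomorphic_on_slice[OF F Suc.prems(2) i] .
    have "?g w = 0" if w: "w \<in> ball (p ?i) e \<inter> ball (q ?i) d" for w
    proof (rule Suc.IH)
      show "s(?i := w) \<in> pdisc r p e"
        using w Suc.prems i fun_upd_in_topspace[of s r ?i w] by (auto simp: pdisc_def dist_norm norm_minus_commute)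
      show "cmod ((s(?i := w)) j - q j) < d" if "j \<in> {k+1..r}" for j
        using w that Suc.prems(3)[of j] by (auto simp: dist_norm norm_minus_commute)
    qed (use Suc in auto)
    moreover have "q ?i \<in> ball (p ?i) e \<inter> ball (q ?i) d"
      using q i d by (auto simp: pdisc_def dist_norm norm_minus_commute)
    moreover have "s ?i \<in> ball (p ?i) e"
      using Suc.prems i by (auto simp: pdisc_def dist_norm norm_minus_commute)
    ultimately have "?g (s ?i) = 0"
      by (intro analytic_continuation_open[of "ball (p ?i) e \<inter> ball (q ?i) d" "ball (p ?i) e" ?g "\<lambda>_. 0" "s ?i"] hol)
        auto
    then show ?case by simp
  qed
  from this[of r s] s show ?thesis by auto
qed

text \<open>The first dense set is open, so a small polydisc around one of its points stays inside
  it, and there W is met.\<close>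

lemma pdisc_dense_Int:
  assumes "V \<subseteq> topspace (Cpow r)" "dense_open_in (subtopology (Cpow r) V) U" "openin (Cpow r) V"
    and "p \<in> V" "e > 0" "openin (Cpow r) W" "\<And>q d. q \<in> pdisc r p e \<Longrightarrow> d > 0 \<Longrightarrow> pdisc r q d \<inter> W \<noteq> {}"
  shows "pdisc r p e \<inter> U \<inter> W \<noteq> {}"
proof -
  note U = assms(2)[unfolded dense_open_in_Cpow[OF assms(1)]]
  obtain s where s: "s \<in> pdisc r p e" "s \<in> U" using U assms by blast
  have "openin (Cpow r) U"
    using assms(2,3) openin_trans_full unfolding dense_open_in_def by blast
  then have "openin (Cpow r) (U \<inter> pdisc r p e)" using openin_pdisc by blast
  then obtain d where d: "d > 0" "pdisc r s d \<subseteq> U \<inter> pdisc r p e"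
    using s unfolding openin_Cpow by blast
  then show ?thesis using assms(7)[OF s(1) d(1)] by blast
qed

lemma dense_open_in_Int_open:
  assumes "dense_open_in (Cpow r) U" "openin (Cpow r) V"
  shows "dense_open_in (subtopology (Cpow r) V) (U \<inter> V)"
proof -
  have V: "V \<subseteq> topspace (Cpow r)" using assms openin_subset by blast
  note U = assms(1)[unfolded dense_open_in_Cpow_topspace]
  have "openin (Cpow r) (U \<inter> V)" using U assms by blast
  moreover have "pdisc r p e \<inter> (U \<inter> V) \<noteq> {}" if "p \<in> V" "e > 0" for p e
  proof -
    have "openin (Cpow r) (V \<inter> pdisc r p e)" using openin_pdisc assms by blast
    moreover have "p \<in> V \<inter> pdisc r p e" using that V centre_in_pdisc by blast
    ultimately obtain d where d: "d > 0" "pdisc r p d \<subseteq> V \<inter> pdisc r p e" unfolding openin_Cpow by blast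
    then show ?thesis using U that V by blast
  qed
  ultimately show ?thesis
    unfolding dense_open_in_Cpow[OF V] openin_Cpow by blast
qed

text \<open>Identity theorem for meromorphic functions. The points near which F and G agree on a
  dense set form an open and closed subset of a connected space.\<close>

lemma mero_eq_on_dense:
  assumes F: "mero r F" and G: "mero r G" and W: "openin (Cpow r) W" "W \<noteq> {}" "\<And>s. s \<in> W \<Longrightarrow> F s = G s"
  obtains U where "dense_open_in (Cpow r) U" "\<And>s. s \<in> U \<Longrightarrow> F s = G s"
proof -
  \<comment> \<open>The largest open set on which the two representatives agree.\<close>
  define E where "E = \<Union>{T. openin (Cpow r) T \<and> (\<forall>s\<in>T. F s = G s)}"
  have E: "openin (Cpow r) E" "\<And>s. s \<in> E \<Longrightarrow> F s = G s" unfolding E_def by auto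
  \<comment> \<open>The interior of the closure of E. Density of E near a point, not membership in
    E, is what propagates, because E omits points where the representatives have arbitrary
    values.\<close>
  define A where "A = {p \<in> topspace (Cpow r). \<exists>e>0. \<forall>q\<in>pdisc r p e. \<forall>d>0. pdisc r q d \<inter> E \<noteq> {}}"
  have A_open: "openin (Cpow r) A"
    unfolding openin_Cpow
  proof (intro conjI ballI)
    show "A \<subseteq> topspace (Cpow r)" by (auto simp: A_def)
    fix p assume "p \<in> A"
    then obtain e where e: "e > 0" "\<forall>q\<in>pdisc r p e. \<forall>d>0. pdisc r q d \<inter> E \<noteq> {}" by (auto simp: A_def)
    have "q \<in> A" if q: "q \<in> pdisc r p e" for q
    proof -
      obtain d where "d > 0" "pdisc r q d \<subseteq> pdisc r p e" using q pdisc_in_pdisc by blast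
      then show ?thesis using e(2) q pdisc_subset unfolding A_def by blast
    qed
    then show "\<exists>e>0. pdisc r p e \<subseteq> A" using e by blast
  qed
  \<comment> \<open>A polydisc on which both functions are quotients lies in A as soon as it meets
    A; this makes the complement of A open.\<close>
  have key: "pdisc r p e \<subseteq> A"
    if p: "p \<in> topspace (Cpow r)" and e: "e > 0" and meet: "pdisc r p e \<inter> A \<noteq> {}"
      and g: "pdisc r p e \<subseteq> V" "holo_on r g V" "holo_on r h V" "dense_open_in (subtopology (Cpow r) V) U"
         "\<forall>s\<in>U. h s \<noteq> 0 \<and> F s = g s / h s"
      and g': "pdisc r p e \<subseteq> V'" "holo_on r g' V'" "holo_on r h' V'" "dense_open_in (subtopology (Cpow r) V') U'"
         "\<forall>s\<in>U'. h' s \<noteq> 0 \<and> G s = g' s / h' s"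
    for p e V g h U V' g' h' U'
  proof -
    note UU = dense_open_in_Cpow[OF holo_onD(2)[OF g(2)]] dense_open_in_Cpow[OF holo_onD(2)[OF g'(2)]]
    have oU: "openin (Cpow r) U" "openin (Cpow r) U'"
      using g(4) g'(4) openin_trans_full holo_onD(1)[OF g(2)] holo_onD(1)[OF g'(2)]
      unfolding dense_open_in_def by blast+
    \<comment> \<open>Cross-multiplication turns equality of the quotients into the vanishing of one
      holomorphic function, to which the identity theorem on a polydisc applies.\<close>
    define k where "k = (\<lambda>s. g s * h' s - g' s * h s)"
    have k: "holo_on r k (pdisc r p e)"
      unfolding k_def using g g' by (intro holo_on_diff holo_on_mult) (blast intro: holo_on_subset openin_pdisc)+
    have UU': "pdisc r q d \<inter> U \<inter> U' \<noteq> {}" if q: "q \<in> pdisc r p e" and d: "d > 0" for q d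
    proof -
      obtain d' where d': "d' > 0" "pdisc r q d' \<subseteq> pdisc r p e" using q pdisc_in_pdisc by blast
      define d'' where "d'' = min d d'"
      have d'': "d'' > 0" "pdisc r q d'' \<subseteq> pdisc r p e" "pdisc r q d'' \<subseteq> pdisc r q d"
        using d d' by (auto simp: d''_def pdisc_min)
      have qV: "q \<in> V" using q g(1) by blast
      have "pdisc r a c \<inter> U' \<noteq> {}" if "a \<in> pdisc r q d''" "c > 0" for a c
      proof -
        have "a \<in> V'" using that(1) d''(2) g'(1) by blast
        then show ?thesis using g'(4) that(2) unfolding UU(2) by blast
      qed
      then have "pdisc r q d'' \<inter> U \<inter> U' \<noteq> {}"
        by (intro pdisc_dense_Int[OF holo_onD(2)[OF g(2)] g(4) holo_onD(1)[OF g(2)] qV d''(1) oU(2)])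
      then show ?thesis using d'' by blast
    qed
    obtain q where q: "q \<in> pdisc r p e" "q \<in> E"
    proof -
      obtain a where a: "a \<in> pdisc r p e" "a \<in> A" using meet by blast
      then obtain e1 where e1: "e1 > 0" "pdisc r a e1 \<subseteq> pdisc r p e" using pdisc_in_pdisc by blast
      obtain e2 where "e2 > 0" "\<forall>q\<in>pdisc r a e2. \<forall>d>0. pdisc r q d \<inter> E \<noteq> {}" using a(2) by (auto simp: A_def)
      then have "pdisc r a e1 \<inter> E \<noteq> {}" using e1(1) centre_in_pdisc a pdisc_subset by blast
      then show ?thesis using that e1 by blast
    qed
    obtain d where d: "d > 0" "pdisc r q d \<subseteq> E \<inter> pdisc r p e"
    proof -
      have "openin (Cpow r) (E \<inter> pdisc r p e)" using E openin_pdisc by blast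
      then show ?thesis using q that unfolding openin_Cpow by blast
    qed
    have kU: "k s = 0 \<longleftrightarrow> F s = G s" if "s \<in> U" "s \<in> U'" for s
      using that g(5) g'(5) unfolding k_def by (auto simp: field_simps)
    have "k s = 0" if "s \<in> pdisc r q d" for s
    proof (rule holo_on_zero_by_density[where V = "pdisc r q d" and F = k and p = s and r = r])
      show "holo_on r k (pdisc r q d)" using k openin_pdisc d by (blast intro: holo_on_subset)
      fix a c assume a: "a \<in> pdisc r q d" "(c::real) > 0"
      obtain c1 where c1: "c1 > 0" "pdisc r a c1 \<subseteq> pdisc r q d" using a pdisc_in_pdisc by blast
      have "pdisc r a (min c c1) \<inter> U \<inter> U' \<noteq> {}"
      proof (rule UU')
        show "a \<in> pdisc r p e" using a(1) d(2) by blast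
      qed (use a c1 in simp)
      then obtain b where b: "b \<in> pdisc r a (min c c1)" "b \<in> U" "b \<in> U'" by blast
      have "b \<in> pdisc r a c" "b \<in> pdisc r a c1"
        using b(1) by (auto simp: pdisc_min)
      then show "\<exists>s\<in>pdisc r a c. k s = 0" using kU[OF b(2,3)] E(2) d(2) c1(2) by blast
    qed (use that in auto)
    then have k0: "k s = 0" if "s \<in> pdisc r p e" for s
      using holo_on_pdisc_identity[OF k q(1) d(1)] that by blast
    have UE: "U \<inter> U' \<inter> pdisc r p e \<subseteq> E"
    proof -
      have "openin (Cpow r) (U \<inter> U' \<inter> pdisc r p e)" using oU openin_pdisc by blast
      moreover have "\<forall>s\<in>U \<inter> U' \<inter> pdisc r p e. F s = G s" using kU k0 by blast
      ultimately show ?thesis unfolding E_def by blast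
    qed
    have dense: "pdisc r a c \<inter> E \<noteq> {}" if a: "a \<in> pdisc r p e" "c > 0" for a c
    proof -
      obtain c1 where c1: "c1 > 0" "pdisc r a c1 \<subseteq> pdisc r p e" using a pdisc_in_pdisc by blast
      have "pdisc r a (min c c1) \<inter> U \<inter> U' \<noteq> {}" using UU' a c1 by simp
      then obtain b where b: "b \<in> pdisc r a (min c c1)" "b \<in> U" "b \<in> U'" by blast
      have "b \<in> pdisc r a c" "b \<in> pdisc r a c1"
        using b(1) by (auto simp: pdisc_min)
      then show ?thesis using UE b c1 by blast
    qed
    show "pdisc r p e \<subseteq> A"
    proof
      fix a assume a: "a \<in> pdisc r p e"
      obtain c where c: "c > 0" "pdisc r a c \<subseteq> pdisc r p e" using a pdisc_in_pdisc by blast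
      have "\<forall>q\<in>pdisc r a c. \<forall>d>0. pdisc r q d \<inter> E \<noteq> {}" using dense c(2) by blast
      then show "a \<in> A" using a c(1) pdisc_subset unfolding A_def by blast
    qed
  qed
  have step: "\<exists>e>0. pdisc r p e \<inter> A = {} \<or> pdisc r p e \<subseteq> A" if p: "p \<in> topspace (Cpow r)" for p
  proof -
    obtain V g h U where 1: "p \<in> V" "holo_on r g V" "holo_on r h V" "dense_open_in (subtopology (Cpow r) V) U"
        "\<forall>s\<in>U. h s \<noteq> 0 \<and> F s = g s / h s"
      using F p unfolding mero_def by meson
    obtain V' g' h' U' where 2: "p \<in> V'" "holo_on r g' V'" "holo_on r h' V'" "dense_open_in (subtopology (Cpow r) V') U'"
        "\<forall>s\<in>U'. h' s \<noteq> 0 \<and> G s = g' s / h' s"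
      using G p unfolding mero_def by meson
    have "openin (Cpow r) (V \<inter> V')" using holo_onD(1)[OF 1(2)] holo_onD(1)[OF 2(2)] by blast
    then obtain e where e: "e > 0" "pdisc r p e \<subseteq> V \<inter> V'" using 1 2 unfolding openin_Cpow by blast
    have "pdisc r p e \<inter> A = {} \<or> pdisc r p e \<subseteq> A"
      using key[OF p e(1) _ _ 1(2-5) _ 2(2-5)] e(2) by blast
    then show ?thesis using e(1) by blast
  qed
  have "openin (Cpow r) (topspace (Cpow r) - A)"
    unfolding openin_Cpow
  proof (intro conjI ballI)
    fix p assume p: "p \<in> topspace (Cpow r) - A"
    then obtain e where e: "e > 0" "pdisc r p e \<inter> A = {} \<or> pdisc r p e \<subseteq> A" using step by blast
    then have "pdisc r p e \<inter> A = {}" using p centre_in_pdisc by blast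
    then have "pdisc r p e \<subseteq> topspace (Cpow r) - A" using pdisc_subset by blast
    then show "\<exists>e>0. pdisc r p e \<subseteq> topspace (Cpow r) - A" using e(1) by blast
  qed blast
  moreover have "connected_space (Cpow r)"
    using connectedin_topspace[of "euclidean :: complex topology"] connected_UNIV[where 'a = complex]
    by (simp add: Cpow_def connected_space_product_topology)
  moreover have "W \<subseteq> A"
  proof
    fix p assume p: "p \<in> W"
    then obtain e where e: "e > 0" "pdisc r p e \<subseteq> W" using W(1) unfolding openin_Cpow by blast
    have WE: "W \<subseteq> E" unfolding E_def using W by blast
    have "pdisc r q d \<inter> E \<noteq> {}" if "q \<in> pdisc r p e" "d > 0" for q d
      using centre_in_pdisc[of q r d] that e WE pdisc_subset by blast
    then show "p \<in> A" using e p openin_subset[OF W(1)] unfolding A_def by blast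
  qed
  ultimately have "topspace (Cpow r) - A = {}"
    unfolding connected_space_def using A_open W(2) by blast
  then have "A = topspace (Cpow r)" using openin_subset[OF A_open] by blast
  then have "pdisc r p e \<inter> E \<noteq> {}" if p: "p \<in> topspace (Cpow r)" "e > 0" for p e
    using that centre_in_pdisc unfolding A_def by blast
  then have "dense_open_in (Cpow r) E" using E(1) unfolding dense_open_in_Cpow_topspace by blast
  then show ?thesis using that E(2) by blast
qed

section \<open>Generic points\<close>

lemma openin_psum_in:
  assumes "\<And>k. k \<in> K \<Longrightarrow> k \<le> r" "\<And>k. k \<in> K \<Longrightarrow> open (T k)"
  shows "openin (Cpow r) {s \<in> topspace (Cpow r). \<forall>k\<in>K. psum s k \<in> T k}"
proof -
  have "K \<subseteq> {..r}" using assms(1) by blast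
  then have fin: "finite K" by (rule finite_subset) simp
  have single: "openin (Cpow r) {s \<in> topspace (Cpow r). psum s k \<in> T k}" if k: "k \<in> K" for k
  proof -
    have "holo_on r (\<lambda>s. psum s k) (topspace (Cpow r))"
      using assms(1)[OF k] by (intro holo_on_psum) simp_all
    then have "continuous_map (Cpow r) euclidean (\<lambda>s. psum s k)"
      unfolding holo_on_def by simp
    then show ?thesis
      using openin_continuous_map_preimage[of "Cpow r" euclidean "\<lambda>s. psum s k" "T k"] assms(2)[OF k]
      by simp
  qed
  show ?thesis
  proof (cases "K = {}")
    case False
    have "{s \<in> topspace (Cpow r). \<forall>k\<in>K. psum s k \<in> T k} =
        (\<Inter>k\<in>K. {s \<in> topspace (Cpow r). psum s k \<in> T k})"
      using False by auto
    then show ?thesis using openin_INT2[OF fin False single] by simp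
  qed simp
qed

text \<open>The i-th partial sum is left free so that the set can meet the hyperplane
  \<open>psum s i = n\<close>; i = 0 frees none. Being nonreal is an open condition that is stable
  under integer shifts and excludes all possible poles at once.\<close>

definition HGen :: "nat \<Rightarrow> nat \<Rightarrow> (nat \<Rightarrow> complex) set" where
  "HGen r i = {s \<in> topspace (Cpow r). \<forall>k\<in>{1..r} - {i}. Im (psum s k) \<noteq> 0}"

text \<open>Every hyperplane on which the continued series can be singular is defined by
  \<open>psum s k = n\<close> with an integer \<open>n\<close>, hence avoids \<open>gen r\<close>.\<close>

abbreviation gen :: "nat \<Rightarrow> (nat \<Rightarrow> complex) set" where
  "gen r \<equiv> HGen r 0"

lemma HGen_subset: "HGen r i \<subseteq> topspace (Cpow r)"
  by (auto simp: HGen_def)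

lemma gen_iff: "s \<in> gen r \<longleftrightarrow> s \<in> topspace (Cpow r) \<and> (\<forall>k\<in>{1..r}. Im (psum s k) \<noteq> 0)"
  by (auto simp: HGen_def)

lemma gen_subset_HGen: "gen r \<subseteq> HGen r i"
  by (auto simp: HGen_def)

lemma openin_HGen: "openin (Cpow r) (HGen r i)"
proof -
  have "open {z. Im z \<noteq> 0}"
    using open_Collect_neq[OF continuous_on_Im[OF continuous_on_id], of "\<lambda>_. 0"] by simp
  then show ?thesis
    unfolding HGen_def using openin_psum_in[of "{1..r} - {i}" r "\<lambda>_. {z. Im z \<noteq> 0}"] by simp
qed

lemma HGen_dense:
  assumes p: "p \<in> topspace (Cpow r)" and e: "e > 0" and i: "i \<le> r"
  obtains s where "s \<in> pdisc r p e" "s \<in> HGen r i" "psum s i = psum p i"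
proof -
  have "infinite ({0<..<e / 2} :: real set)" using e by (simp add: infinite_Ioo)
  then have "infinite ({0<..<e / 2} - (\<lambda>k. - Im (psum p k)) ` {1..r})"
    using Diff_infinite_finite by blast
  then obtain \<eta> where \<eta>: "\<eta> \<in> {0<..<e / 2} - (\<lambda>k. - Im (psum p k)) ` {1..r}"
    using infinite_imp_nonempty by blast
  \<comment> \<open>\<open>c k\<close> is the intended change of the k-th partial sum, and the
    coordinates change by its differences, so each by at most 2 eta. The choice of eta makes every
    partial sum except the i-th nonreal and leaves the i-th fixed.\<close>
  define c where "c k = (if k = 0 \<or> k = i then 0 else \<i> * complex_of_real \<eta>)" for k
  define s where "s = (\<lambda>k\<in>{1..r}. p k + (c k - c (k - 1)))"
  have ps: "psum s k = psum p k + c k" if "k \<le> r" for k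
    using that
  proof (induction k)
    case (Suc k)
    then show ?case by (simp add: psum_def s_def)
  qed (simp add: psum_def c_def)
  have "Im (psum s k) \<noteq> 0" if "k \<in> {1..r} - {i}" for k
  proof -
    have "\<eta> \<noteq> - Im (psum p k)" using \<eta> that by blast
    then show ?thesis using ps[of k] that by (simp add: c_def)
  qed
  moreover have "s \<in> topspace (Cpow r)" by (auto simp: s_def topspace_Cpow)
  moreover have "cmod (s k - p k) < e" if "k \<in> {1..r}" for k
  proof -
    have "cmod (s k - p k) \<le> cmod (c k) + cmod (c (k - 1))"
      using that norm_triangle_ineq4 by (simp add: s_def)
    also have "\<dots> \<le> \<eta> + \<eta>" using \<eta> by (intro add_mono) (auto simp: c_def norm_mult)
    also have "\<dots> < e" using \<eta> by auto
    finally show ?thesis .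
  qed
  moreover have "psum s i = psum p i" using ps[OF i] by (simp add: c_def)
  ultimately show ?thesis
    by (intro that[of s]) (auto simp: HGen_def pdisc_def)
qed

lemma dense_gen: "dense_open_in (Cpow r) (gen r)"
  unfolding dense_open_in_Cpow_topspace
proof (intro conjI ballI allI impI openin_HGen)
  fix p e assume "p \<in> topspace (Cpow r)" "(e::real) > 0"
  then obtain s where "s \<in> pdisc r p e" "s \<in> gen r" by (rule HGen_dense[of p r e 0]) simp_all
  then show "pdisc r p e \<inter> gen r \<noteq> {}" by blast
qed

lemma dense_open_in_Int:
  assumes "dense_open_in (Cpow r) U" "dense_open_in (Cpow r) W"
  shows "dense_open_in (Cpow r) (U \<inter> W)"
  unfolding dense_open_in_Cpow_topspace
proof (intro conjI ballI allI impI)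
  note U = assms[unfolded dense_open_in_Cpow_topspace]
  show "openin (Cpow r) (U \<inter> W)" using U by blast
  fix p e assume pe: "p \<in> topspace (Cpow r)" "(e::real) > 0"
  then obtain q where q: "q \<in> pdisc r p e" "q \<in> U" using U by blast
  have "openin (Cpow r) (U \<inter> pdisc r p e)" using U openin_pdisc by blast
  then obtain d where d: "d > 0" "pdisc r q d \<subseteq> U \<inter> pdisc r p e"
    using q unfolding openin_Cpow by blast
  have "pdisc r q d \<inter> W \<noteq> {}" using U d(1) q(1) pdisc_subset by blast
  then show "pdisc r p e \<inter> (U \<inter> W) \<noteq> {}" using d(2) by blast
qed

text \<open>Regularity and meromorphy relative to the fixed dense open set of generic points; unlike
  the notions of the statement, these keep the exceptional sets under control in algebraic
  operations and under substitutions.\<close>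

definition regular_gen :: "nat \<Rightarrow> ((nat \<Rightarrow> complex) \<Rightarrow> complex) \<Rightarrow> (nat \<Rightarrow> complex) \<Rightarrow> complex \<Rightarrow> bool" where
  "regular_gen r F p v \<longleftrightarrow> (\<exists>e>0. \<exists>g. holo_on r g (pdisc r p e) \<and>
     (\<forall>s\<in>pdisc r p e \<inter> gen r. F s = g s) \<and> v = g p)"

definition mero_gen :: "nat \<Rightarrow> ((nat \<Rightarrow> complex) \<Rightarrow> complex) \<Rightarrow> (nat \<Rightarrow> complex) \<Rightarrow> bool" where
  "mero_gen r F p \<longleftrightarrow> (\<exists>e>0. \<exists>g h. holo_on r g (pdisc r p e) \<and> holo_on r h (pdisc r p e) \<and>
     (\<forall>s\<in>pdisc r p e \<inter> gen r. h s \<noteq> 0 \<and> F s = g s / h s))"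

lemma regular_genI:
  assumes "e > 0" "holo_on r g (pdisc r p e)" "\<And>s. s \<in> pdisc r p e \<Longrightarrow> s \<in> gen r \<Longrightarrow> F s = g s" "v = g p"
  shows "regular_gen r F p v"
  unfolding regular_gen_def using assms by (intro exI[of _ e] conjI exI[of _ g] ballI) auto

lemma regular_genE:
  assumes "regular_gen r F p v"
  obtains e g where "e > 0" "holo_on r g (pdisc r p e)" "\<And>s. s \<in> pdisc r p e \<Longrightarrow> s \<in> gen r \<Longrightarrow> F s = g s" "v = g p"
  using assms unfolding regular_gen_def by (elim exE conjE) simp

lemma mero_genI:
  assumes "e > 0" "holo_on r g (pdisc r p e)" "holo_on r h (pdisc r p e)"
    "\<And>s. s \<in> pdisc r p e \<Longrightarrow> s \<in> gen r \<Longrightarrow> h s \<noteq> 0 \<and> F s = g s / h s"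
  shows "mero_gen r F p"
  unfolding mero_gen_def using assms by (intro exI[of _ e] conjI exI[of _ g] exI[of _ h] ballI) auto

lemma mero_genE:
  assumes "mero_gen r F p"
  obtains e g h where "e > 0" "holo_on r g (pdisc r p e)" "holo_on r h (pdisc r p e)"
    "\<And>s. s \<in> pdisc r p e \<Longrightarrow> s \<in> gen r \<Longrightarrow> h s \<noteq> 0 \<and> F s = g s / h s"
  using assms unfolding mero_gen_def by (elim exE conjE) simp

lemma holo_on_shrink:
  assumes "holo_on r g (pdisc r p e)" "d \<le> e"
  shows "holo_on r g (pdisc r p d)"
  by (rule holo_on_subset[OF assms(1) openin_pdisc pdisc_mono[OF assms(2)]])

lemma regular_gen_holo:
  assumes F: "holo_on r F U" and p: "p \<in> U"
  shows "regular_gen r F p (F p)"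
proof -
  obtain e where e: "e > 0" "pdisc r p e \<subseteq> U"
    using holo_onD(1)[OF F] p unfolding openin_Cpow by blast
  show ?thesis
    by (rule regular_genI[OF e(1) holo_on_subset[OF F openin_pdisc e(2)]]) simp_all
qed

lemma regular_gen_cong:
  assumes "regular_gen r F p v" "e > 0" "\<And>s. s \<in> pdisc r p e \<Longrightarrow> s \<in> gen r \<Longrightarrow> G s = F s"
  shows "regular_gen r G p v"
proof -
  from assms(1) obtain d g where g: "d > 0" "holo_on r g (pdisc r p d)"
    "\<And>s. s \<in> pdisc r p d \<Longrightarrow> s \<in> gen r \<Longrightarrow> F s = g s" "v = g p" by (rule regular_genE) iprover
  show ?thesis
    by (rule regular_genI[of "min d e" r g])
      (use g assms holo_on_shrink[OF g(2), of "min d e"] in \<open>auto simp: pdisc_min\<close>)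
qed

lemma regular_gen_const: "p \<in> topspace (Cpow r) \<Longrightarrow> regular_gen r (\<lambda>_. c) p c"
  using regular_gen_holo[OF holo_on_const[of r "topspace (Cpow r)" c]] by simp

lemma regular_gen_mult:
  assumes "regular_gen r F p v" "regular_gen r G p w"
  shows "regular_gen r (\<lambda>s. F s * G s) p (v * w)"
proof -
  from assms(1) obtain d g where g: "d > 0" "holo_on r g (pdisc r p d)"
    "\<And>s. s \<in> pdisc r p d \<Longrightarrow> s \<in> gen r \<Longrightarrow> F s = g s" "v = g p" by (rule regular_genE) iprover
  from assms(2) obtain e h where h: "e > 0" "holo_on r h (pdisc r p e)"
    "\<And>s. s \<in> pdisc r p e \<Longrightarrow> s \<in> gen r \<Longrightarrow> G s = h s" "w = h p" by (rule regular_genE) iprover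
  have "holo_on r (\<lambda>s. g s * h s) (pdisc r p (min d e))"
    by (intro holo_on_mult holo_on_shrink[OF g(2)] holo_on_shrink[OF h(2)]) simp_all
  then show ?thesis
    by (rule regular_genI[rotated]) (use g h in \<open>auto simp: pdisc_min\<close>)
qed

lemma regular_gen_add:
  assumes "regular_gen r F p v" "regular_gen r G p w"
  shows "regular_gen r (\<lambda>s. F s + G s) p (v + w)"
proof -
  from assms(1) obtain d g where g: "d > 0" "holo_on r g (pdisc r p d)"
    "\<And>s. s \<in> pdisc r p d \<Longrightarrow> s \<in> gen r \<Longrightarrow> F s = g s" "v = g p" by (rule regular_genE) iprover
  from assms(2) obtain e h where h: "e > 0" "holo_on r h (pdisc r p e)"
    "\<And>s. s \<in> pdisc r p e \<Longrightarrow> s \<in> gen r \<Longrightarrow> G s = h s" "w = h p" by (rule regular_genE) iprover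
  have "holo_on r (\<lambda>s. g s + h s) (pdisc r p (min d e))"
    by (intro holo_on_add holo_on_shrink[OF g(2)] holo_on_shrink[OF h(2)]) simp_all
  then show ?thesis
    by (rule regular_genI[rotated]) (use g h in \<open>auto simp: pdisc_min\<close>)
qed

lemma regular_gen_sum:
  assumes "p \<in> topspace (Cpow r)" "\<And>a. a \<in> A \<Longrightarrow> regular_gen r (F a) p (v a)"
  shows "regular_gen r (\<lambda>s. \<Sum>a\<in>A. F a s) p (\<Sum>a\<in>A. v a)"
  using assms(2)
  by (induction A rule: infinite_finite_induct)
    (simp_all add: regular_gen_const[OF assms(1)] regular_gen_add)

lemma gen_aff_pdisc:
  assumes "s \<in> pdisc r p (e / (1 + real r))" "e > 0" "s \<in> gen r" "\<And>s. s \<in> gen r \<Longrightarrow> aff r r' a c s \<in> gen r'"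
  shows "aff r r' a c s \<in> pdisc r' (aff r r' a c p) e" "aff r r' a c s \<in> gen r'"
  using assms aff_pdisc by simp_all

text \<open>The second hypothesis lets agreement at generic points be transported back: generic
  points go to generic points.\<close>

lemma regular_gen_aff:
  assumes "regular_gen r' F (aff r r' a c p) v" "\<And>s. s \<in> gen r \<Longrightarrow> aff r r' a c s \<in> gen r'"
  shows "regular_gen r (\<lambda>s. F (aff r r' a c s)) p v"
proof -
  from assms(1) obtain e g where g: "e > 0" "holo_on r' g (pdisc r' (aff r r' a c p) e)"
    "\<And>s. s \<in> pdisc r' (aff r r' a c p) e \<Longrightarrow> s \<in> gen r' \<Longrightarrow> F s = g s" "v = g (aff r r' a c p)"
    by (rule regular_genE) iprover
  show ?thesis
  proof (rule regular_genI[of "e / (1 + real r)"])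
    show "holo_on r (\<lambda>s. g (aff r r' a c s)) (pdisc r p (e / (1 + real r)))"
      by (rule holo_on_aff[OF g(2) openin_pdisc]) (rule aff_pdisc[OF _ g(1)])
    show "F (aff r r' a c s) = g (aff r r' a c s)" if "s \<in> pdisc r p (e / (1 + real r))" "s \<in> gen r" for s
      by (rule g(3)[OF gen_aff_pdisc[OF that(1) g(1) that(2) assms(2)]])
  qed (use g in simp_all)
qed

lemma mero_gen_regular:
  assumes "regular_gen r F p v"
  shows "mero_gen r F p"
proof -
  from assms obtain d g where g: "d > 0" "holo_on r g (pdisc r p d)"
    "\<And>s. s \<in> pdisc r p d \<Longrightarrow> s \<in> gen r \<Longrightarrow> F s = g s" "v = g p" by (rule regular_genE) iprover
  show ?thesis
    by (rule mero_genI[OF g(1,2) holo_on_const[OF openin_pdisc, where c = 1]]) (use g in simp)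
qed

lemma mero_gen_cong:
  assumes "mero_gen r F p" "e > 0" "\<And>s. s \<in> pdisc r p e \<Longrightarrow> s \<in> gen r \<Longrightarrow> G s = F s"
  shows "mero_gen r G p"
proof -
  from assms(1) obtain d g h where g: "d > 0" "holo_on r g (pdisc r p d)" "holo_on r h (pdisc r p d)"
    "\<And>s. s \<in> pdisc r p d \<Longrightarrow> s \<in> gen r \<Longrightarrow> h s \<noteq> 0 \<and> F s = g s / h s" by (rule mero_genE) iprover
  show ?thesis
    by (rule mero_genI[of "min d e" r g p h])
      (use g assms holo_on_shrink[OF g(2), of "min d e"] holo_on_shrink[OF g(3), of "min d e"]
        in \<open>auto simp: pdisc_min\<close>)
qed

lemma mero_gen_mult:
  assumes "mero_gen r F p" "mero_gen r F' p"
  shows "mero_gen r (\<lambda>s. F s * F' s) p"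
proof -
  from assms(1) obtain d g h where g: "d > 0" "holo_on r g (pdisc r p d)" "holo_on r h (pdisc r p d)"
    "\<And>s. s \<in> pdisc r p d \<Longrightarrow> s \<in> gen r \<Longrightarrow> h s \<noteq> 0 \<and> F s = g s / h s" by (rule mero_genE) iprover
  from assms(2) obtain d' g' h' where g': "d' > 0" "holo_on r g' (pdisc r p d')" "holo_on r h' (pdisc r p d')"
    "\<And>s. s \<in> pdisc r p d' \<Longrightarrow> s \<in> gen r \<Longrightarrow> h' s \<noteq> 0 \<and> F' s = g' s / h' s" by (rule mero_genE) iprover
  show ?thesis
  proof (rule mero_genI[of "min d d'" r "\<lambda>s. g s * g' s" p "\<lambda>s. h s * h' s"])
    show "holo_on r (\<lambda>s. g s * g' s) (pdisc r p (min d d'))"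
      by (intro holo_on_mult holo_on_shrink[OF g(2)] holo_on_shrink[OF g'(2)]) simp_all
    show "holo_on r (\<lambda>s. h s * h' s) (pdisc r p (min d d'))"
      by (intro holo_on_mult holo_on_shrink[OF g(3)] holo_on_shrink[OF g'(3)]) simp_all
    fix s assume "s \<in> pdisc r p (min d d')" "s \<in> gen r"
    then show "h s * h' s \<noteq> 0 \<and> F s * F' s = g s * g' s / (h s * h' s)"
      using g(4)[of s] g'(4)[of s] by (auto simp: pdisc_min)
  qed (use g g' in simp)
qed

lemma mero_gen_add:
  assumes "mero_gen r F p" "mero_gen r F' p"
  shows "mero_gen r (\<lambda>s. F s + F' s) p"
proof -
  from assms(1) obtain d g h where g: "d > 0" "holo_on r g (pdisc r p d)" "holo_on r h (pdisc r p d)"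
    "\<And>s. s \<in> pdisc r p d \<Longrightarrow> s \<in> gen r \<Longrightarrow> h s \<noteq> 0 \<and> F s = g s / h s" by (rule mero_genE) iprover
  from assms(2) obtain d' g' h' where g': "d' > 0" "holo_on r g' (pdisc r p d')" "holo_on r h' (pdisc r p d')"
    "\<And>s. s \<in> pdisc r p d' \<Longrightarrow> s \<in> gen r \<Longrightarrow> h' s \<noteq> 0 \<and> F' s = g' s / h' s" by (rule mero_genE) iprover
  show ?thesis
  proof (rule mero_genI[of "min d d'" r "\<lambda>s. g s * h' s + g' s * h s" p "\<lambda>s. h s * h' s"])
    show "holo_on r (\<lambda>s. g s * h' s + g' s * h s) (pdisc r p (min d d'))"
      by (intro holo_on_add holo_on_mult holo_on_shrink[OF g(2)] holo_on_shrink[OF g'(2)]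
          holo_on_shrink[OF g(3)] holo_on_shrink[OF g'(3)]) simp_all
    show "holo_on r (\<lambda>s. h s * h' s) (pdisc r p (min d d'))"
      by (intro holo_on_mult holo_on_shrink[OF g(3)] holo_on_shrink[OF g'(3)]) simp_all
    fix s assume "s \<in> pdisc r p (min d d')" "s \<in> gen r"
    then show "h s * h' s \<noteq> 0 \<and> F s + F' s = (g s * h' s + g' s * h s) / (h s * h' s)"
      using g(4)[of s] g'(4)[of s] by (auto simp: pdisc_min add_frac_eq)
  qed (use g g' in simp)
qed

lemma mero_gen_sum:
  assumes "p \<in> topspace (Cpow r)" "\<And>a. a \<in> A \<Longrightarrow> mero_gen r (F a) p"
  shows "mero_gen r (\<lambda>s. \<Sum>a\<in>A. F a s) p"
  using assms(2)
  by (induction A rule: infinite_finite_induct)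
    (simp_all add: mero_gen_regular[OF regular_gen_const[OF assms(1)]] mero_gen_add)

lemma mero_gen_inverse_holo:
  assumes F: "holo_on r h (topspace (Cpow r))" and p: "p \<in> topspace (Cpow r)" and h: "\<And>s. s \<in> gen r \<Longrightarrow> h s \<noteq> 0"
  shows "mero_gen r (\<lambda>s. inverse (h s)) p"
  by (rule mero_genI[of 1 r "\<lambda>_. 1" p h])
    (use assms holo_on_subset[OF F openin_pdisc pdisc_subset] in
      \<open>auto simp: holo_on_const openin_pdisc field_simps\<close>)

lemma mero_gen_aff:
  assumes "mero_gen r' F (aff r r' a c p)" "\<And>s. s \<in> gen r \<Longrightarrow> aff r r' a c s \<in> gen r'"
  shows "mero_gen r (\<lambda>s. F (aff r r' a c s)) p"
proof -
  from assms(1) obtain e g h where g: "e > 0" "holo_on r' g (pdisc r' (aff r r' a c p) e)"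
    "holo_on r' h (pdisc r' (aff r r' a c p) e)"
    "\<And>s. s \<in> pdisc r' (aff r r' a c p) e \<Longrightarrow> s \<in> gen r' \<Longrightarrow> h s \<noteq> 0 \<and> F s = g s / h s"
    by (rule mero_genE) iprover
  show ?thesis
  proof (rule mero_genI[of "e / (1 + real r)"])
    show "holo_on r (\<lambda>s. g (aff r r' a c s)) (pdisc r p (e / (1 + real r)))"
      by (rule holo_on_aff[OF g(2) openin_pdisc]) (rule aff_pdisc[OF _ g(1)])
    show "holo_on r (\<lambda>s. h (aff r r' a c s)) (pdisc r p (e / (1 + real r)))"
      by (rule holo_on_aff[OF g(3) openin_pdisc]) (rule aff_pdisc[OF _ g(1)])
    show "h (aff r r' a c s) \<noteq> 0 \<and> F (aff r r' a c s) = g (aff r r' a c s) / h (aff r r' a c s)"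
      if "s \<in> pdisc r p (e / (1 + real r))" "s \<in> gen r" for s
      by (rule g(4)[OF gen_aff_pdisc[OF that(1) g(1) that(2) assms(2)]])
  qed (use g in simp_all)
qed

section \<open>Return to the notions of the statement\<close>

lemma mero_of_mero_gen:
  assumes "\<And>p. p \<in> topspace (Cpow r) \<Longrightarrow> mero_gen r F p"
  shows "mero r F"
  unfolding mero_def
proof
  fix p assume p: "p \<in> topspace (Cpow r)"
  from assms[OF p] obtain d g h where g: "d > 0" "holo_on r g (pdisc r p d)" "holo_on r h (pdisc r p d)"
    "\<And>s. s \<in> pdisc r p d \<Longrightarrow> s \<in> gen r \<Longrightarrow> h s \<noteq> 0 \<and> F s = g s / h s" by (rule mero_genE) iprover
  show "\<exists>V g h U. p \<in> V \<and> holo_on r g V \<and> holo_on r h V \<and>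
        dense_open_in (subtopology (Cpow r) V) U \<and> (\<forall>s\<in>U. h s \<noteq> 0 \<and> F s = g s / h s)"
    using g centre_in_pdisc[OF p g(1)] dense_open_in_Int_open[OF dense_gen openin_pdisc[of r p d]]
    by (intro exI[of _ "pdisc r p d"] exI[of _ g] exI[of _ h] exI[of _ "gen r \<inter> pdisc r p d"]) auto
qed

text \<open>G may be any other representative, in particular \<open>L\<close> or the product with
  \<open>C_mat\<close>; equality with F on a dense open set suffices because the intersection with
  \<open>gen r\<close> is still dense and open.\<close>

lemma regular_value_of_regular_gen:
  assumes "regular_gen r F p v" "p \<in> topspace (Cpow r)"
    and U: "dense_open_in (Cpow r) U" "\<And>s. s \<in> U \<Longrightarrow> s \<in> gen r \<Longrightarrow> G s = F s"
  shows "regular_value r G p v"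
proof -
  from assms(1) obtain d g where g: "d > 0" "holo_on r g (pdisc r p d)"
    "\<And>s. s \<in> pdisc r p d \<Longrightarrow> s \<in> gen r \<Longrightarrow> F s = g s" "v = g p" by (rule regular_genE) iprover
  show ?thesis
    unfolding regular_value_def
    using g centre_in_pdisc[OF assms(2) g(1)] U(2)
      dense_open_in_Int_open[OF dense_open_in_Int[OF U(1) dense_gen] openin_pdisc[of r p d]]
    by (intro exI[of _ "pdisc r p d"] exI[of _ g] exI[of _ "U \<inter> gen r \<inter> pdisc r p d"]) auto
qed

section \<open>The Euler--Maclaurin kernel\<close>

text \<open>The order of vanishing of e^y - x at y = 0. It is also the amount by which summation
  over one variable lowers the exponent: sums of m^(-s) behave like integrals when x = 1 and
  oscillate or decay otherwise.\<close>

definition eps :: "complex \<Rightarrow> nat" where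
  "eps x = (if x = 1 then 1 else 0)"

definition ecoef :: "complex \<Rightarrow> nat \<Rightarrow> complex" where
  "ecoef x k = (if x = 1 then bernoulli_num k / fact k
     else x / (1 - x) * (eulerian k x / (x - 1) ^ k) / fact k)"

text \<open>The generating function of \<open>ecoef x\<close> is \<open>y\<^bsup>eps x\<^esup> x / (e\<^bsup>y\<^esup> - x)\<close>.\<close>

lemma ecoef_recursion:
  assumes "x \<noteq> 0"
  shows "(\<Sum>k\<le>q. ecoef x k / fact (q - k)) - x * ecoef x q = (if q = eps x then x else 0)"
proof (cases "x = 1")
  case True
  \<comment> \<open>The claim compares coefficients in F e^y - x F = x y^(eps x), where F is the
    generating function of \<open>ecoef x\<close>. Here x = 1 and F = y/(e^y - 1).\<close>
  define D :: "complex fps" where "D = fps_exp 1 - 1"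
  have D1: "fps_nth D 1 = 1" by (simp add: D_def)
  then have "D \<noteq> 0" by auto
  moreover have "subdegree D \<le> 1" using D1 by (intro subdegree_leI) simp
  ultimately have "D dvd fps_X" by (subst fps_dvd_iff) simp_all
  then have "fps_X / D * D = fps_X" by (rule dvd_div_mult_self)
  then have "fps_nth (fps_X / D * fps_exp 1 - fps_X / D) q = fps_nth fps_X q"
    by (simp add: D_def algebra_simps)
  moreover have "fps_nth (fps_X / D) k = ecoef x k" for k
    using True by (simp add: ecoef_def bernoulli_num_def D_def)
  ultimately show ?thesis
    using True by (simp add: fps_mult_nth eps_def atLeast0AtMost divide_simps)
next
  case False
  \<comment> \<open>The Eulerian generating function has e^((x-1)y) in the denominator; rescaling y
    by 1/(x - 1) gives the denominator e^y - x and explains the powers of x - 1 in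
    \<open>ecoef\<close>.\<close>
  define D :: "complex fps" where "D = fps_exp (x - 1) - fps_const x"
  define F where "F = fps_const (1 - x) / D"
  have D0: "fps_nth D 0 = 1 - x" by (simp add: D_def)
  then have D: "D \<noteq> 0" "subdegree D = 0" using False by (auto simp: subdegree_eq_0_iff)
  then have "D dvd fps_const (1 - x)"
    using False by (subst fps_dvd_iff) auto
  then have FD: "F * D = fps_const (1 - x)" unfolding F_def by (rule dvd_div_mult_self)
  have ek: "ecoef x k = x / (1 - x) * fps_nth F k / (x - 1) ^ k" for k
    using False by (simp add: ecoef_def eulerian_def F_def D_def)
  have "fps_nth (F * fps_exp (x - 1)) q - x * fps_nth F q = (if q = 0 then 1 - x else 0)"
    using arg_cong[OF FD, of "\<lambda>G. fps_nth G q"]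
    by (simp add: D_def right_diff_distrib mult.commute[of _ "fps_const x"])
  then have *: "(\<Sum>k\<le>q. fps_nth F k * ((x - 1) ^ (q - k) / fact (q - k))) - x * fps_nth F q = (if q = 0 then 1 - x else 0)"
    by (simp add: fps_mult_nth atLeast0AtMost)
  have "(\<Sum>k\<le>q. ecoef x k / fact (q - k)) =
      x / (1 - x) / (x - 1) ^ q * (\<Sum>k\<le>q. fps_nth F k * ((x - 1) ^ (q - k) / fact (q - k)))"
    unfolding sum_distrib_left
  proof (rule sum.cong)
    fix k assume "k \<in> {..q}"
    then have "(x - 1) ^ q = (x - 1) ^ k * (x - 1) ^ (q - k)"
      by (simp flip: power_add)
    then show "ecoef x k / fact (q - k) = x / (1 - x) / (x - 1) ^ q * (fps_nth F k * ((x - 1) ^ (q - k) / fact (q - k)))"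
      using False by (simp add: ek field_simps)
  qed simp
  then have "(\<Sum>k\<le>q. ecoef x k / fact (q - k)) - x * ecoef x q =
      x / (1 - x) / (x - 1) ^ q * ((\<Sum>k\<le>q. fps_nth F k * ((x - 1) ^ (q - k) / fact (q - k))) - x * fps_nth F q)"
    by (simp add: ek right_diff_distrib)
  then show ?thesis using False unfolding * by (simp add: eps_def)
qed

section \<open>Taylor estimates for the kernel\<close>

lemma pochhammer_ge_0: "(0::real) \<le> B \<Longrightarrow> 0 \<le> pochhammer B n"
  by (induction n) (simp_all add: pochhammer_Suc)

lemma norm_pochhammer_le:
  fixes b :: complex
  assumes "cmod b \<le> B"
  shows "cmod (pochhammer b n) \<le> pochhammer B n"
proof (induction n)
  case (Suc n)
  have "cmod (b + of_nat n) \<le> B + real n"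
    using norm_triangle_ineq[of b "of_nat n"] assms by simp
  moreover have "B \<ge> 0" using assms norm_ge_zero order_trans by blast
  ultimately show ?case
    using Suc by (simp add: pochhammer_Suc norm_mult mult_mono pochhammer_ge_0 mult_mono)
qed simp

text \<open>The binomial series is dominated termwise by the one with exponent B at 1/2, whose sum
  is 2^B. Replacing u by 1/2 in the tail costs the factor (2u)^J.\<close>

lemma binomial_tail_bound:
  fixes b :: complex and u B :: real
  assumes u: "0 < u" "u \<le> 1/2" and b: "cmod b \<le> B"
  shows "cmod ((1 - of_real u) powr (- b) - (\<Sum>j<J. pochhammer b j / fact j * of_real u ^ j))
     \<le> u ^ J * 2 powr (real J + B)"
proof -
  have B0: "B \<ge> 0" using b norm_ge_zero order_trans by blast
  have "(\<lambda>n. (- b gchoose n) * (- of_real u) ^ n) sums (1 + - of_real u) powr (- b)"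
    using u by (intro gen_binomial_complex) simp
  then have s1: "(\<lambda>n. pochhammer b n / fact n * of_real u ^ n) sums (1 - of_real u) powr (- b)"
    by (simp add: gbinomial_pochhammer power_minus[of "of_real u"] mult_ac)
  have "(\<lambda>n. (- B gchoose n) * (- (1/2)) ^ n) sums (1 + - (1/2)) powr (- B)"
    by (intro gen_binomial_real) simp
  then have s2: "(\<lambda>n. pochhammer B n / fact n * (1/2) ^ n) sums (1/2) powr (- B)"
    by (simp add: gbinomial_pochhammer power_minus[of "1/2"] mult_ac)
  define c where "c n = pochhammer b n / fact n * complex_of_real u ^ n" for n
  define d where "d n = pochhammer B n / fact n * (1/2) ^ n" for n
  have dn: "d n \<ge> 0" for n
    unfolding d_def using B0 by (simp add: pochhammer_ge_0)
  have sd: "summable d" "suminf d = 2 powr B"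
    using s2 by (auto simp: d_def[abs_def] sums_iff powr_minus powr_divide)
  have bound: "cmod (c (n + J)) \<le> u ^ J * 2 ^ J * d (n + J)" for n
  proof -
    have "cmod (c (n + J)) = cmod (pochhammer b (n + J)) / fact (n + J) * (u ^ n * u ^ J)"
      using u by (simp add: c_def norm_mult norm_divide norm_power power_add)
    also have "\<dots> \<le> pochhammer B (n + J) / fact (n + J) * ((1/2) ^ n * u ^ J)"
      using u norm_pochhammer_le[OF b] pochhammer_ge_0[OF B0]
      by (intro mult_mono divide_right_mono power_mono) auto
    also have "\<dots> = u ^ J * 2 ^ J * d (n + J)"
      by (simp add: d_def power_add power_divide)
    finally show ?thesis .
  qed
  have sdJ: "summable (\<lambda>n. u ^ J * 2 ^ J * d (n + J))"
    using summable_ignore_initial_segment[OF sd(1)] by (intro summable_mult)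
  have sc: "summable c" "suminf c = (1 - of_real u) powr (- b)"
    using s1 by (auto simp: c_def[abs_def] sums_iff)
  have "(1 - of_real u) powr (- b) - (\<Sum>j<J. c j) = (\<Sum>n. c (n + J))"
    using suminf_split_initial_segment[OF sc(1), of J] sc(2) by simp
  also have "cmod \<dots> \<le> (\<Sum>n. u ^ J * 2 ^ J * d (n + J))"
    by (rule norm_suminf_le[OF bound sdJ])
  also have "\<dots> = u ^ J * 2 ^ J * (\<Sum>n. d (n + J))"
    using summable_ignore_initial_segment[OF sd(1)] by (intro suminf_mult)
  also have "(\<Sum>n. d (n + J)) \<le> suminf d"
    using suminf_split_initial_segment[OF sd(1), of J] sum_nonneg[of "{..<J}" d] dn by simp
  finally show ?thesis
    using u by (simp add: c_def sd(2) powr_add powr_realpow mult_left_mono mult.assoc)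
qed

text \<open>Divided by \<open>rho x s\<close>, this is the entry (0,k) of B_1(s - 1) if x = 1, and
  of x B_2 at s otherwise.\<close>

definition ct :: "complex \<Rightarrow> nat \<Rightarrow> complex \<Rightarrow> complex" where
  "ct x k s = ecoef x k * pochhammer (s - of_nat (eps x)) k"

text \<open>For x = 1 the leading Euler-Maclaurin coefficient has a pole at s = 1. Multiplying
  through by this factor keeps all coefficients and kernels entire.\<close>

definition rho :: "complex \<Rightarrow> complex \<Rightarrow> complex" where
  "rho x s = (if x = 1 then s - 1 else 1)"

text \<open>The error in comparing \<open>rho x s * x ^ m * m powr (- s)\<close> with a telescoping difference;
  \<open>0 powr z = 0\<close> is the right convention for the term \<open>m = 1\<close>.\<close>

definition kern :: "complex \<Rightarrow> nat \<Rightarrow> complex \<Rightarrow> nat \<Rightarrow> complex" where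
  "kern x N s m = rho x s * x ^ m * of_nat m powr (- s) -
     (\<Sum>k<N. ct x k s * (x ^ (m - 1) * of_nat (m - 1) powr (of_nat (eps x) - s - of_nat k) -
        x ^ m * of_nat m powr (of_nat (eps x) - s - of_nat k)))"

lemma rho_eq_pochhammer: "rho x s = pochhammer (s - of_nat (eps x)) (eps x)"
  by (simp add: rho_def eps_def)

text \<open>Expanding each power of 1 - u, the coefficient of u^q is \<open>pochhammer a q\<close>
  times the left side of \<open>ecoef_recursion\<close>, because pochhammer symbols multiply. Only q
  = \<open>eps x\<close> survives below order N + \<open>eps x\<close>, and the binomial tails give
  the error.\<close>

lemma kernel_expansion:
  fixes u :: real
  assumes x: "x \<noteq> 0" and u: "0 < u" "u \<le> 1/2" and a: "cmod a \<le> A" and N: "N \<ge> 1"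
  shows "cmod (pochhammer a (eps x) * x * of_real u ^ eps x -
      (\<Sum>k<N. ecoef x k * pochhammer a k * of_real u ^ k * ((1 - of_real u) powr (- (a + of_nat k)) - x)))
    \<le> u ^ (N + eps x) * (\<Sum>k<N. cmod (ecoef x k) * pochhammer A k * 2 powr (real (N + eps x) + A))"
proof -
  let ?M = "N + eps x"
  define T where "T k = (1 - of_real u) powr (- (a + of_nat k)) -
      (\<Sum>j<?M - k. pochhammer (a + of_nat k) j / fact j * complex_of_real u ^ j)" for k
  define E where "E k = ecoef x k * pochhammer a k * complex_of_real u ^ k" for k
  have "(\<Sum>k<N. E k * ((\<Sum>j<?M - k. pochhammer (a + of_nat k) j / fact j * complex_of_real u ^ j) - x)) =
      (\<Sum>k<N. \<Sum>j<?M - k. E k * (pochhammer (a + of_nat k) j / fact j * complex_of_real u ^ j)) -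
      (\<Sum>k<N. x * E k)"
    by (simp add: right_diff_distrib sum_subtractf sum_distrib_left mult.commute)
  also have "(\<Sum>k<N. \<Sum>j<?M - k. E k * (pochhammer (a + of_nat k) j / fact j * complex_of_real u ^ j)) =
      (\<Sum>k<N. \<Sum>q\<in>{k..<?M}. pochhammer a q * complex_of_real u ^ q * (ecoef x k / fact (q - k)))"
  proof (rule sum.cong)
    fix k assume k: "k \<in> {..<N}"
    have "(\<Sum>q\<in>{k..<?M}. pochhammer a q * complex_of_real u ^ q * (ecoef x k / fact (q - k))) =
        (\<Sum>j<?M - k. pochhammer a (j + k) * complex_of_real u ^ (j + k) * (ecoef x k / fact j))"
      by (rule sum.reindex_bij_witness[of _ "\<lambda>j. j + k" "\<lambda>q. q - k"]) auto
    also have "\<dots> = (\<Sum>j<?M - k. E k * (pochhammer (a + of_nat k) j / fact j * complex_of_real u ^ j))"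
      by (rule sum.cong)
        (simp_all add: E_def power_add pochhammer_product'[of a k] add.commute[of _ k])
    finally show "(\<Sum>j<?M - k. E k * (pochhammer (a + of_nat k) j / fact j * complex_of_real u ^ j)) =
      (\<Sum>q\<in>{k..<?M}. pochhammer a q * complex_of_real u ^ q * (ecoef x k / fact (q - k)))" by simp
  qed simp
  also have "\<dots> = (\<Sum>q<?M. \<Sum>k\<in>{k. k < N \<and> k \<le> q}. pochhammer a q * complex_of_real u ^ q * (ecoef x k / fact (q - k)))"
  proof -
    have "(\<Sum>k<N. \<Sum>q\<in>{k..<?M}. pochhammer a q * complex_of_real u ^ q * (ecoef x k / fact (q - k))) =
       (\<Sum>k<N. \<Sum>q | q \<in> {..<?M} \<and> k \<le> q. pochhammer a q * complex_of_real u ^ q * (ecoef x k / fact (q - k)))"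
      by (intro sum.cong) auto
    also have "\<dots> = (\<Sum>q<?M. \<Sum>k | k \<in> {..<N} \<and> k \<le> q. pochhammer a q * complex_of_real u ^ q * (ecoef x k / fact (q - k)))"
      by (rule sum.swap_restrict) simp_all
    finally show ?thesis by simp
  qed
  also have "(\<Sum>k<N. x * E k) = (\<Sum>q<?M. pochhammer a q * complex_of_real u ^ q * (if q < N then x * ecoef x q else 0))"
  proof -
    have "(\<Sum>q<?M. pochhammer a q * complex_of_real u ^ q * (if q < N then x * ecoef x q else 0)) =
        (\<Sum>q<N. pochhammer a q * complex_of_real u ^ q * (x * ecoef x q))"
      by (rule sum.mono_neutral_cong_right) auto
    then show ?thesis by (simp add: E_def mult_ac)
  qed
  also have "(\<Sum>q<?M. \<Sum>k\<in>{k. k < N \<and> k \<le> q}. pochhammer a q * complex_of_real u ^ q * (ecoef x k / fact (q - k))) -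
      (\<Sum>q<?M. pochhammer a q * complex_of_real u ^ q * (if q < N then x * ecoef x q else 0)) =
      (\<Sum>q<?M. pochhammer a q * complex_of_real u ^ q * (if q = eps x then x else 0))"
    unfolding sum_subtractf[symmetric]
  proof (rule sum.cong)
    fix q assume q: "q \<in> {..<?M}"
    have "(\<Sum>k\<in>{k. k < N \<and> k \<le> q}. ecoef x k / fact (q - k)) - (if q < N then x * ecoef x q else 0) =
        (if q = eps x then x else 0)"
    proof (cases "q < N")
      case True
      then have "{k. k < N \<and> k \<le> q} = {..q}" by auto
      then show ?thesis using ecoef_recursion[OF x, of q] True by simp
    next
      \<comment> \<open>Only x = 1 and q = N remain. The contributions of k = N missing from both
        sums, \<open>ecoef x q\<close> and \<open>x * ecoef x q\<close>, are equal, so the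
        cancellation reaches one order further.\<close>
      case False
      then have "x = 1" "q = N" using q by (auto simp: eps_def split: if_splits)
      moreover from this have "{k. k < N \<and> k \<le> q} = {..<q}" by auto
      moreover have "(\<Sum>k\<le>q. ecoef x k / fact (q - k)) = (\<Sum>k<q. ecoef x k / fact (q - k)) + ecoef x q"
        by (simp add: lessThan_Suc_atMost[symmetric])
      ultimately show ?thesis using ecoef_recursion[OF x, of q] by simp
    qed
    then show "(\<Sum>k\<in>{k. k < N \<and> k \<le> q}. pochhammer a q * complex_of_real u ^ q * (ecoef x k / fact (q - k))) -
       pochhammer a q * complex_of_real u ^ q * (if q < N then x * ecoef x q else 0) =
       pochhammer a q * complex_of_real u ^ q * (if q = eps x then x else 0)"
      unfolding sum_distrib_left[symmetric] right_diff_distrib[symmetric] by (rule arg_cong)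
  qed simp
  also have "\<dots> = pochhammer a (eps x) * x * of_real u ^ eps x"
  proof -
    have "(\<Sum>q<?M. pochhammer a q * complex_of_real u ^ q * (if q = eps x then x else 0)) =
       (\<Sum>q<?M. if q = eps x then pochhammer a q * complex_of_real u ^ q * x else 0)"
      by (intro sum.cong) auto
    then show ?thesis using N by (simp add: sum.delta)
  qed
  finally have main: "(\<Sum>k<N. E k * ((\<Sum>j<?M - k. pochhammer (a + of_nat k) j / fact j * complex_of_real u ^ j) - x)) =
      pochhammer a (eps x) * x * of_real u ^ eps x" .
  have "pochhammer a (eps x) * x * of_real u ^ eps x -
      (\<Sum>k<N. E k * ((1 - of_real u) powr (- (a + of_nat k)) - x)) = (\<Sum>k<N. - (E k * T k))"
    unfolding main[symmetric] sum_subtractf[symmetric] T_def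
    by (intro sum.cong) (simp_all add: algebra_simps)
  also have "cmod \<dots> \<le> (\<Sum>k<N. cmod (E k) * cmod (T k))"
    by (rule order_trans[OF norm_sum]) (simp add: norm_mult)
  also have "\<dots> \<le> (\<Sum>k<N. u ^ ?M * (cmod (ecoef x k) * pochhammer A k * 2 powr (real ?M + A)))"
  proof (rule sum_mono)
    fix k assume k: "k \<in> {..<N}"
    have ak: "cmod (a + of_nat k) \<le> A + real k"
      using norm_triangle_ineq[of a "of_nat k"] a by simp
    have "cmod (T k) \<le> u ^ (?M - k) * 2 powr (real (?M - k) + (A + real k))"
      unfolding T_def by (rule binomial_tail_bound[OF u ak])
    also have "real (?M - k) + (A + real k) = real ?M + A" using k by simp
    finally have T: "cmod (T k) \<le> u ^ (?M - k) * 2 powr (real ?M + A)" .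
    have "cmod (E k) \<le> cmod (ecoef x k) * pochhammer A k * u ^ k"
      using u norm_pochhammer_le[OF a, of k] by (simp add: E_def norm_mult norm_power mult_left_mono mult_right_mono)
    then have "cmod (E k) * cmod (T k) \<le> cmod (ecoef x k) * pochhammer A k * u ^ k * (u ^ (?M - k) * 2 powr (real ?M + A))"
      using T u order_trans[OF norm_ge_zero a] by (intro mult_mono) (auto intro!: mult_nonneg_nonneg pochhammer_ge_0)
    also have "\<dots> = (u ^ k * u ^ (?M - k)) * (cmod (ecoef x k) * pochhammer A k * 2 powr (real ?M + A))"
      by (simp add: mult_ac)
    also have "u ^ k * u ^ (?M - k) = u ^ ?M" using k by (simp flip: power_add)
    finally show "cmod (E k) * cmod (T k) \<le> u ^ ?M * (cmod (ecoef x k) * pochhammer A k * 2 powr (real ?M + A))" .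
  qed
  finally show ?thesis unfolding E_def by (simp add: sum_distrib_left)
qed

lemma cmod_nat_powr: "m \<ge> 1 \<Longrightarrow> cmod (of_nat m powr z) = real m powr Re z"
  by (subst norm_powr_real_powr) auto

text \<open>With u = 1/m one has m - 1 = m(1 - u), so a power of m factors out. Excluding m = 1
  keeps 1 - u positive.\<close>

lemma kern_eq:
  fixes s :: complex
  assumes m: "m \<ge> 2" and x: "x \<noteq> 0"
  defines "a \<equiv> s - of_nat (eps x)" and "u \<equiv> 1 / real m"
  shows "kern x N s m = x ^ (m - 1) * of_nat m powr (- a) *
     (pochhammer a (eps x) * x * of_real u ^ eps x -
      (\<Sum>k<N. ecoef x k * pochhammer a k * of_real u ^ k * ((1 - of_real u) powr (- (a + of_nat k)) - x)))"
proof -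
  have m0: "(of_nat m :: complex) \<noteq> 0" using m by simp
  have u: "0 < u" "u < 1" using m by (simp_all add: u_def)
  have uk: "complex_of_real u ^ k = of_nat m powr (- of_nat k)" for k
    using m by (simp add: u_def powr_minus powr_nat power_divide divide_simps)
  have xm: "x ^ m = x ^ (m - 1) * x" using m by (cases m) auto
  have sp: "of_nat m powr (- a - of_nat k) = of_nat m powr (- a) * complex_of_real u ^ k" for k
    unfolding uk by (simp add: powr_add[symmetric])
  have m1: "of_nat (m - 1) powr z = of_nat m powr z * (1 - complex_of_real u) powr z" for z
  proof -
    have "(of_nat (m - 1) :: complex) = of_real (real m * (1 - u))"
      using m by (simp add: u_def field_simps of_nat_diff)
    also have "\<dots> powr z = of_real (real m) powr z * of_real (1 - u) powr z"
      using u m by (subst powr_times_real[symmetric]) simp_all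
    finally show ?thesis by simp
  qed
  have e: "of_nat (eps x) - s - of_nat k = - (a + of_nat k)" for k by (simp add: a_def)
  have "of_nat m powr (- s) = of_nat m powr (- a) * complex_of_real u ^ eps x"
    using sp[of "eps x"] by (simp add: a_def)
  then have 1: "rho x s * x ^ m * of_nat m powr (- s) =
     x ^ (m - 1) * of_nat m powr (- a) * (pochhammer a (eps x) * x * of_real u ^ eps x)"
    by (simp add: rho_eq_pochhammer a_def xm)
  have 2: "ct x k s * (x ^ (m - 1) * of_nat (m - 1) powr (of_nat (eps x) - s - of_nat k) -
        x ^ m * of_nat m powr (of_nat (eps x) - s - of_nat k)) =
     x ^ (m - 1) * of_nat m powr (- a) * (ecoef x k * pochhammer a k * of_real u ^ k * ((1 - of_real u) powr (- (a + of_nat k)) - x))" for k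
  proof -
    have "of_nat m powr (- (a + of_nat k)) = of_nat m powr (- a) * complex_of_real u ^ k"
      using sp[of k] by (simp add: algebra_simps)
    then show ?thesis
      unfolding e m1 ct_def a_def[symmetric] xm by (simp add: algebra_simps)
  qed
  show ?thesis
    unfolding kern_def 1 2 by (simp add: right_diff_distrib sum_distrib_left)
qed

lemma kern_bound:
  assumes x: "x \<noteq> 0" and R: "R \<ge> 0"
  obtains C where "C \<ge> 0"
    "\<And>s m. cmod s \<le> R \<Longrightarrow> m \<ge> 1 \<Longrightarrow> cmod (kern x N s m) \<le> C * cmod x ^ m * real m powr (- Re s - real N)"
proof
  define A where "A = R + 1"
  define S where "S = (\<Sum>k<N. cmod (ecoef x k) * pochhammer A k * 2 powr (real (N + eps x) + A))"
  \<comment> \<open>A bounds \<open>rho\<close> and settles N = 0, A + S settles m = 1, and S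
    divided by the modulus of x settles m >= 2, where \<open>kern_eq\<close> leaves x^(m-1) in place
    of x^m.\<close>
  define C where "C = A + S + S / cmod x"
  have A: "A \<ge> 1" using R by (simp add: A_def)
  have S: "S \<ge> 0" unfolding S_def using A by (intro sum_nonneg mult_nonneg_nonneg pochhammer_ge_0) auto
  then have SC: "S / cmod x \<le> C" "A + S \<le> C" using A by (auto simp: C_def)
  show "C \<ge> 0" using SC S A by simp
  fix s m assume s: "cmod s \<le> R" and m: "(m::nat) \<ge> 1"
  have a: "cmod (s - of_nat (eps x)) \<le> A"
    using s norm_triangle_ineq4[of s "of_nat (eps x)"] by (auto simp: A_def eps_def)
  have rho: "cmod (rho x s) \<le> A"
    using a A by (auto simp: rho_def eps_def)
  consider "N = 0" | "m = 1" | "N \<ge> 1" "m \<ge> 2" using m by linarith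
  then show "cmod (kern x N s m) \<le> C * cmod x ^ m * real m powr (- Re s - real N)"
  proof cases
    case 1
    have "cmod (kern x N s m) = cmod (rho x s) * (cmod x ^ m * real m powr (- Re s))"
      using 1 m by (simp add: kern_def norm_mult norm_power cmod_nat_powr)
    also have "\<dots> \<le> C * (cmod x ^ m * real m powr (- Re s))"
      using rho SC S by (intro mult_right_mono) auto
    finally show ?thesis using 1 by simp
  next
    case 2
    \<comment> \<open>All powers of m - 1 = 0 vanish by convention and all powers of m are
      1.\<close>
    have "kern x N s m = x * (rho x s + (\<Sum>k<N. ct x k s))"
      using 2 by (simp add: kern_def sum_distrib_left sum_negf algebra_simps)
    then have "cmod (kern x N s m) \<le> cmod x * (cmod (rho x s) + (\<Sum>k<N. cmod (ct x k s)))"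
      by (simp add: norm_mult mult_left_mono norm_sum order_trans[OF norm_triangle_ineq add_left_mono])
    also have "(\<Sum>k<N. cmod (ct x k s)) \<le> S"
      unfolding S_def
    proof (rule sum_mono)
      fix k
      have "cmod (ct x k s) \<le> cmod (ecoef x k) * pochhammer A k * 1"
        using norm_pochhammer_le[OF a, of k] by (simp add: ct_def norm_mult mult_left_mono)
      also have "\<dots> \<le> cmod (ecoef x k) * pochhammer A k * 2 powr (real (N + eps x) + A)"
        using A by (intro mult_left_mono ge_one_powr_ge_zero mult_nonneg_nonneg pochhammer_ge_0) auto
      finally show "cmod (ct x k s) \<le> cmod (ecoef x k) * pochhammer A k * 2 powr (real (N + eps x) + A)" .
    qed
    also have "cmod x * (cmod (rho x s) + S) \<le> cmod x * C"
      using rho SC by (intro mult_left_mono) auto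
    finally show ?thesis using 2 by (simp add: mult.commute mult_left_mono add_left_mono)
  next
    case 3
    let ?a = "s - of_nat (eps x)" and ?u = "1 / real m"
    have u: "0 < ?u" "?u \<le> 1/2" using 3 by (simp_all add: field_simps)
    have "cmod (kern x N s m) \<le> cmod (x ^ (m - 1) * of_nat m powr (- ?a)) * (?u ^ (N + eps x) * S)"
      unfolding kern_eq[OF 3(2) x] norm_mult[of "x ^ (m - 1) * of_nat m powr (- ?a)"] S_def
      by (intro mult_left_mono kernel_expansion[OF x u a 3(1)]) simp
    also have "cmod (x ^ (m - 1) * of_nat m powr (- ?a)) = cmod x ^ m / cmod x * real m powr (- Re s + real (eps x))"
      using 3 x by (cases m) (simp_all add: norm_mult norm_power cmod_nat_powr del: of_nat_Suc)
    also have "?u ^ (N + eps x) = real m powr (- real (N + eps x))"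
      unfolding powr_minus using powr_realpow[of "real m" "N + eps x"] 3
      by (simp add: power_one_over inverse_eq_divide del: of_nat_add)
    also have "cmod x ^ m / cmod x * real m powr (- Re s + real (eps x)) * (real m powr (- real (N + eps x)) * S) =
       S / cmod x * (cmod x ^ m * (real m powr (- Re s + real (eps x)) * real m powr (- real (N + eps x))))"
      by simp
    also have "real m powr (- Re s + real (eps x)) * real m powr (- real (N + eps x)) = real m powr (- Re s - real N)"
      by (simp flip: powr_add)
    also have "S / cmod x * (cmod x ^ m * real m powr (- Re s - real N)) \<le> C * (cmod x ^ m * real m powr (- Re s - real N))"
      using SC by (intro mult_right_mono) auto
    finally show ?thesis by simp
  qed
qed

lemma kern_Suc:
  "kern x N s m = kern x (Suc N) s m +
     ct x N s * (x ^ (m - 1) * of_nat (m - 1) powr (of_nat (eps x) - s - of_nat N) -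
        x ^ m * of_nat m powr (of_nat (eps x) - s - of_nat N))"
  by (simp add: kern_def)

lemma field_differentiable_nat_powr:
  assumes "f field_differentiable at z"
  shows "(\<lambda>z. (of_nat m :: complex) powr f z) field_differentiable at z"
proof (cases "m = 0")
  case False
  then have "(\<lambda>z. (of_nat m :: complex) powr f z) = (\<lambda>z. exp (f z * Ln (of_nat m)))"
    by (simp add: powr_def)
  moreover have "(exp \<circ> (\<lambda>z. f z * Ln (of_nat m))) field_differentiable at z"
    using assms by (intro field_differentiable_compose field_differentiable_mult field_differentiable_within_exp) auto
  ultimately show ?thesis by (simp add: o_def)
qed simp

lemma field_differentiable_pochhammer:
  assumes "f field_differentiable at z"
  shows "(\<lambda>z. pochhammer (f z) n :: complex) field_differentiable at z"
  using assms by (induction n) (auto simp: pochhammer_Suc intro!: derivative_intros)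

lemma field_differentiable_ct: "ct x k field_differentiable at z"
  unfolding ct_def[abs_def]
  by (intro field_differentiable_mult field_differentiable_pochhammer derivative_intros)

lemma field_differentiable_rho: "rho x field_differentiable at z"
  unfolding rho_def[abs_def] by (cases "x = 1") (auto intro!: derivative_intros)

lemma field_differentiable_kern: "(\<lambda>z. kern x N z m) field_differentiable at z"
  unfolding kern_def
  by (intro field_differentiable_diff field_differentiable_mult field_differentiable_sum
      field_differentiable_ct field_differentiable_rho field_differentiable_nat_powr derivative_intros)

section \<open>Multiple series\<close>

definition admissible :: "nat \<Rightarrow> (nat \<Rightarrow> complex) \<Rightarrow> bool" where
  "admissible r z \<longleftrightarrow> (\<forall>i\<in>{1..r}. z i \<noteq> 0 \<and> cmod (\<Prod>l=1..i. z l) \<le> 1)"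

lemma decr_tuplesD:
  assumes "n \<in> decr_tuples r" "i \<in> {1..r}"
  shows "n i \<ge> 1" "\<And>j. j \<in> {1..r} \<Longrightarrow> i < j \<Longrightarrow> n j < n i"
  using assms by (auto simp: decr_tuples_def PiE_iff Ball_def Suc_le_eq)

text \<open>Multiplicative summation by parts: since the n_i decrease and the partial products have
  modulus at most 1, lowering the exponent from n_k to n_(k+1) can only increase the bound.
  Individual z_i may exceed 1 in modulus.\<close>

lemma prod_power_le:
  assumes n: "n \<in> decr_tuples r" and z: "admissible r z"
  shows "(\<Prod>i=1..r. cmod (z i) ^ n i) \<le> 1"
proof -
  define G where "G k = cmod (\<Prod>l=1..k. z l)" for k
  have G1: "G k \<le> 1" if "k \<in> {1..r}" for k using z that by (simp add: G_def admissible_def)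
  have *: "k + 1 \<le> r \<Longrightarrow> (\<Prod>i=1..k+1. cmod (z i) ^ n i) \<le> G (k + 1) ^ n (k + 1)" for k
  proof (induction k)
    case 0
    then show ?case by (simp add: G_def norm_power)
  next
    case (Suc k)
    have "(\<Prod>i=1..Suc k+1. cmod (z i) ^ n i) = (\<Prod>i=1..k+1. cmod (z i) ^ n i) * cmod (z (k + 2)) ^ n (k + 2)"
      by simp
    also have "\<dots> \<le> G (k + 1) ^ n (k + 1) * cmod (z (k + 2)) ^ n (k + 2)"
      using Suc by (intro mult_right_mono) simp_all
    also have "G (k + 1) ^ n (k + 1) \<le> G (k + 1) ^ n (k + 2)"
      using decr_tuplesD(2)[OF n, of "k + 1" "k + 2"] Suc.prems G1[of "k + 1"]
      by (intro power_decreasing) (simp_all add: G_def)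
    also have "G (k + 1) ^ n (k + 2) * cmod (z (k + 2)) ^ n (k + 2) = G (Suc k + 1) ^ n (Suc k + 1)"
      by (simp add: G_def norm_mult power_mult_distrib)
    finally show ?case by (simp add: mult_right_mono)
  qed
  show ?thesis
  proof (cases r)
    case (Suc k)
    have "(\<Prod>i=1..r. cmod (z i) ^ n i) \<le> G r ^ n r" using *[of k] Suc by simp
    also have "\<dots> \<le> 1" using G1[of r] Suc by (intro power_le_one) (simp_all add: G_def)
    finally show ?thesis .
  qed simp
qed

text \<open>The same summation by parts for exponents: n_k may be replaced by the smaller n_(k+1)
  because the accumulated exponent is nonpositive.\<close>

lemma prod_powr_le_one:
  assumes n: "n \<in> decr_tuples r" and \<tau>: "\<And>i. i \<in> {1..r} \<Longrightarrow> (\<Sum>l=1..i. \<tau> l) \<ge> (0::real)"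
  shows "(\<Prod>i=1..r. real (n i) powr (- \<tau> i)) \<le> 1"
proof -
  define S where "S k = (\<Sum>l=1..k. \<tau> l)" for k
  have *: "k + 1 \<le> r \<Longrightarrow> (\<Prod>i=1..k+1. real (n i) powr (- \<tau> i)) \<le> real (n (k + 1)) powr (- S (k + 1))" for k
  proof (induction k)
    case (Suc k)
    have n2: "real (n (k + 2)) > 0" using decr_tuplesD(1)[OF n, of "k + 2"] Suc.prems by simp
    have "(\<Prod>i=1..Suc k+1. real (n i) powr (- \<tau> i)) = (\<Prod>i=1..k+1. real (n i) powr (- \<tau> i)) * real (n (k + 2)) powr (- \<tau> (k + 2))"
      by simp
    also have "\<dots> \<le> real (n (k + 1)) powr (- S (k + 1)) * real (n (k + 2)) powr (- \<tau> (k + 2))"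
      using Suc by (intro mult_right_mono) simp_all
    also have "real (n (k + 1)) powr (- S (k + 1)) \<le> real (n (k + 2)) powr (- S (k + 1))"
      using decr_tuplesD(2)[OF n, of "k + 1" "k + 2"] Suc.prems \<tau>[of "k + 1"] n2
      by (intro powr_mono2') (simp_all add: S_def)
    also have "real (n (k + 2)) powr (- S (k + 1)) * real (n (k + 2)) powr (- \<tau> (k + 2)) = real (n (Suc k + 1)) powr (- S (Suc k + 1))"
      by (simp add: S_def powr_add[symmetric])
    finally show ?case by (simp add: mult_right_mono)
  qed (simp add: S_def)
  show ?thesis
  proof (cases r)
    case (Suc k)
    have "(\<Prod>i=1..r. real (n i) powr (- \<tau> i)) \<le> real (n r) powr (- S r)" using *[of k] Suc by simp
    also have "\<dots> \<le> real (n r) powr 0"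
      using decr_tuplesD(1)[OF n, of r] \<tau>[of r] Suc by (intro powr_mono) (simp_all add: S_def)
    also have "\<dots> \<le> 1" by simp
    finally show ?thesis .
  qed simp
qed

lemma summable_on_dominated:
  fixes f :: "'a \<Rightarrow> 'b::banach"
  assumes "M summable_on A" "\<And>a. a \<in> A \<Longrightarrow> norm (f a) \<le> M a"
  shows "f summable_on A"
proof -
  have "(\<lambda>a. norm (f a)) summable_on A"
    using assms by (rule Infinite_Sum.abs_summable_on_comparison_test')
  then show ?thesis by (rule Infinite_Sum.abs_summable_summable)
qed

text \<open>Over all tuples of positive integers the sum factors into convergent one-variable
  series; decreasing tuples are a subset.\<close>

lemma summable_on_decr_tuples:
  assumes "\<delta> > (0::real)"
  shows "(\<lambda>n. \<Prod>i=1..r. real (n i) powr (- (1 + \<delta>))) summable_on decr_tuples r"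
proof -
  have "summable (\<lambda>n. real n powr (- (1 + \<delta>)))"
    using assms by (subst summable_real_powr_iff) simp
  then have "(\<lambda>n. real n powr (- (1 + \<delta>))) summable_on UNIV"
    by (intro norm_summable_imp_summable_on) simp
  then have "(\<lambda>n. norm (real n powr (- (1 + \<delta>)))) summable_on {0<..}"
    using summable_on_subset_banach[of _ UNIV "{0<..}"] by simp
  then have "Infinite_Set_Sum.abs_summable_on (\<lambda>n. real n powr (- (1 + \<delta>))) {0<..}"
    by (rule abs_summable_equivalent[THEN iffD1])
  then have "Infinite_Set_Sum.abs_summable_on (\<lambda>n. \<Prod>i\<in>{1..r}. real (n i) powr (- (1 + \<delta>))) ({1..r} \<rightarrow>\<^sub>E {0<..})"
    by (intro abs_summable_on_prod_PiE) simp_all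
  then have "(\<lambda>n. norm (\<Prod>i\<in>{1..r}. real (n i) powr (- (1 + \<delta>)))) summable_on ({1..r} \<rightarrow>\<^sub>E {0<..})"
    by (rule abs_summable_equivalent[THEN iffD2])
  then have "(\<lambda>n. \<Prod>i\<in>{1..r}. real (n i) powr (- (1 + \<delta>))) summable_on ({1..r} \<rightarrow>\<^sub>E {0<..})"
    by (rule abs_summable_summable)
  then show ?thesis
    by (rule summable_on_subset_banach) (auto simp: decr_tuples_def)
qed

definition wterm :: "nat set \<Rightarrow> (nat \<Rightarrow> complex) \<Rightarrow> (nat \<Rightarrow> complex) \<Rightarrow> (nat \<Rightarrow> nat) \<Rightarrow> complex" where
  "wterm I z s n = (\<Prod>i\<in>I. z i ^ n i * of_nat (n i) powr (- s i))"

definition Lser :: "nat \<Rightarrow> (nat \<Rightarrow> complex) \<Rightarrow> (nat \<Rightarrow> complex) \<Rightarrow> complex" where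
  "Lser r z s = (\<Sum>\<^sub>\<infinity>n\<in>decr_tuples r. wterm {1..r} z s n)"

text \<open>Only the factor belonging to n_1 is replaced by the kernel, which is smaller by
  n_1^(-N). Order 0 returns \<open>rho\<close> times the full series.\<close>

definition rem :: "nat \<Rightarrow> (nat \<Rightarrow> complex) \<Rightarrow> nat \<Rightarrow> (nat \<Rightarrow> complex) \<Rightarrow> complex" where
  "rem r z N s = (\<Sum>\<^sub>\<infinity>n\<in>decr_tuples r. kern (z 1) N (s 1) (n 1) * wterm {2..r} z s n)"

text \<open>A gain of n_1^(-N) acts like adding N to s_1, hence to every partial sum. This is the
  convergence domain after that shift.\<close>

definition shifted_dom :: "nat \<Rightarrow> nat \<Rightarrow> (nat \<Rightarrow> complex) set" where
  "shifted_dom r N = {s \<in> topspace (Cpow r). \<forall>i\<in>{1..r}. Re (psum s i) + real N > real i}"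

lemma shifted_dom_mono: "N \<le> M \<Longrightarrow> shifted_dom r N \<subseteq> shifted_dom r M"
  by (force simp: shifted_dom_def)

lemma openin_shifted_dom: "openin (Cpow r) (shifted_dom r N)"
proof -
  have "open {z. Re z + real N > real i}" for i
    by (intro open_Collect_less continuous_intros)
  then show ?thesis
    unfolding shifted_dom_def using openin_psum_in[of "{1..r}" r "\<lambda>i. {z. Re z + real N > real i}"] by simp
qed

lemma shifted_dom_exhausts:
  assumes "s \<in> topspace (Cpow r)"
  obtains N where "s \<in> shifted_dom r N"
proof -
  have "\<exists>N. \<forall>i\<in>{1..r}. \<bar>Re (psum s i)\<bar> + real i < real N"
  proof -
    obtain N where "(\<Sum>i\<in>{1..r}. \<bar>Re (psum s i)\<bar> + real i) < real N" using reals_Archimedean2 by blast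
    moreover have "\<bar>Re (psum s i)\<bar> + real i \<le> (\<Sum>i\<in>{1..r}. \<bar>Re (psum s i)\<bar> + real i)" if "i \<in> {1..r}" for i
      using that by (intro member_le_sum) auto
    ultimately show ?thesis by (meson order_le_less_trans)
  qed
  then obtain N where "\<forall>i\<in>{1..r}. \<bar>Re (psum s i)\<bar> + real i < real N" by blast
  then have "s \<in> shifted_dom r N" using assms unfolding shifted_dom_def by fastforce
  then show ?thesis by (rule that)
qed

text \<open>The margin is proportional to i, so that every one of the first i variables can be given
  the exponent 1 + delta.\<close>

lemma shifted_dom_uniform:
  assumes p: "p \<in> shifted_dom r N"
  obtains e \<delta> where "e > 0" "\<delta> > 0"
    "\<And>s i. s \<in> pdisc r p e \<Longrightarrow> i \<in> {1..r} \<Longrightarrow> Re (psum s i) + real N \<ge> real i * (1 + \<delta>)"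
proof -
  define \<mu> where "\<mu> = Min (insert 1 ((\<lambda>i. Re (psum p i) + real N - real i) ` {1..r}))"
  have \<mu>: "\<mu> > 0" unfolding \<mu>_def using p by (subst Min_gr_iff) (auto simp: shifted_dom_def)
  define e where "e = \<mu> / (2 * (1 + real r))"
  have e: "e > 0" using \<mu> by (simp add: e_def)
  have "Re (psum s i) + real N \<ge> real i * (1 + e)" if s: "s \<in> pdisc r p e" and i: "i \<in> {1..r}" for s i
  proof -
    have "cmod (psum s i - psum p i) \<le> (\<Sum>l=1..i. cmod (s l - p l))"
      unfolding psum_def sum_subtractf[symmetric] by (rule norm_sum)
    also have "\<dots> \<le> (\<Sum>l=1..i. e)"
      using s i by (intro sum_mono) (auto simp: pdisc_def less_imp_le)
    also have "\<dots> = real i * e" by simp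
    finally have "\<bar>Re (psum s i - psum p i)\<bar> \<le> real i * e" using abs_Re_le_cmod order_trans by blast
    moreover have "\<mu> \<le> Re (psum p i) + real N - real i"
      unfolding \<mu>_def using i by (intro Min_le) auto
    moreover have "2 * (real i * e) \<le> 2 * ((1 + real r) * e)"
      using i e by (intro mult_left_mono mult_right_mono) auto
    moreover have "2 * ((1 + real r) * e) = \<mu>"
    proof -
      have "0 < 2 * (1 + real r)" by (simp add: add_pos_nonneg)
      then have "2 * (1 + real r) \<noteq> 0" by (rule less_imp_neq[symmetric])
      then have "2 * (1 + real r) * e = \<mu>"
        unfolding e_def times_divide_eq_right by (rule nonzero_mult_div_cancel_left)
      then show ?thesis by (simp only: mult.assoc)
    qed
    ultimately show ?thesis by (simp add: algebra_simps)
  qed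
  then show ?thesis using that[OF e e] by blast
qed

lemma cmod_wterm:
  assumes "n \<in> decr_tuples r" "I \<subseteq> {1..r}"
  shows "cmod (wterm I z s n) = (\<Prod>i\<in>I. cmod (z i) ^ n i) * (\<Prod>i\<in>I. real (n i) powr (- Re (s i)))"
proof -
  have "cmod (wterm I z s n) = (\<Prod>i\<in>I. cmod (z i ^ n i * of_nat (n i) powr (- s i)))"
    by (simp add: wterm_def prod_norm)
  also have "\<dots> = (\<Prod>i\<in>I. cmod (z i) ^ n i * real (n i) powr (- Re (s i)))"
    using assms decr_tuplesD(1)[OF assms(1)]
    by (intro prod.cong) (auto simp: norm_mult norm_power cmod_nat_powr subset_iff)
  finally show ?thesis by (simp add: prod.distrib)
qed

lemma rem_term_bound:
  assumes r: "r \<ge> 1" and z: "admissible r z" and p: "p \<in> shifted_dom r N"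
  obtains e M where "e > 0" "M summable_on decr_tuples r"
    "\<And>n s. n \<in> decr_tuples r \<Longrightarrow> s \<in> pdisc r p e \<Longrightarrow>
       cmod (kern (z 1) N (s 1) (n 1) * wterm {2..r} z s n) \<le> M n"
proof -
  obtain e \<delta> where e: "e > 0" and \<delta>: "\<delta> > 0"
    and ps: "\<And>s i. s \<in> pdisc r p e \<Longrightarrow> i \<in> {1..r} \<Longrightarrow> Re (psum s i) + real N \<ge> real i * (1 + \<delta>)"
    using shifted_dom_uniform[OF p] by blast
  have z1: "z 1 \<noteq> 0" using z r by (simp add: admissible_def)
  have "cmod (p 1) + e \<ge> 0" using e by simp
  then obtain C where C: "C \<ge> 0" "\<And>s m. cmod s \<le> cmod (p 1) + e \<Longrightarrow> m \<ge> 1 \<Longrightarrow>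
      cmod (kern (z 1) N s m) \<le> C * cmod (z 1) ^ m * real m powr (- Re s - real N)"
    using kern_bound[OF z1] by blast
  define M where "M n = C * (\<Prod>i=1..r. real (n i) powr (- (1 + \<delta>)))" for n
  have "cmod (kern (z 1) N (s 1) (n 1) * wterm {2..r} z s n) \<le> M n"
    if n: "n \<in> decr_tuples r" and s: "s \<in> pdisc r p e" for n s
  proof -
    have s1: "cmod (s 1) \<le> cmod (p 1) + e"
    proof -
      have "cmod (s 1 - p 1) < e" using s r by (simp add: pdisc_def)
      then show ?thesis using norm_triangle_ineq2[of "s 1" "p 1"] by linarith
    qed
    have n1: "n 1 \<ge> 1" using decr_tuplesD(1)[OF n, of 1] r by simp
    \<comment> \<open>The effective exponents, with the gain N credited to the first variable.
      Splitting off 1 + delta from each leaves nonnegative partial sums, so that part of the product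
      is at most 1, and the rest is the summable majorant.\<close>
    define \<sigma> where "\<sigma> i = (if i = 1 then Re (s 1) + real N else Re (s i))" for i
    have ins: "{1..r} = insert 1 {2..r}" using r by auto
    have "cmod (kern (z 1) N (s 1) (n 1) * wterm {2..r} z s n) \<le>
        (C * cmod (z 1) ^ n 1 * real (n 1) powr (- Re (s 1) - real N)) *
        ((\<Prod>i\<in>{2..r}. cmod (z i) ^ n i) * (\<Prod>i\<in>{2..r}. real (n i) powr (- Re (s i))))"
      unfolding norm_mult cmod_wterm[OF n, of "{2..r}", simplified]
      by (intro mult_right_mono C(2)[OF s1 n1]) (auto intro!: mult_nonneg_nonneg prod_nonneg)
    also have "\<dots> = C * (\<Prod>i\<in>{1..r}. cmod (z i) ^ n i) * (\<Prod>i\<in>{1..r}. real (n i) powr (- \<sigma> i))"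
    proof -
      have "(\<Prod>i\<in>{2..r}. real (n i) powr (- \<sigma> i)) = (\<Prod>i\<in>{2..r}. real (n i) powr (- Re (s i)))"
        by (rule prod.cong) (auto simp: \<sigma>_def)
      then show ?thesis unfolding ins by (simp add: \<sigma>_def)
    qed
    also have "\<dots> \<le> C * 1 * (\<Prod>i\<in>{1..r}. real (n i) powr (- \<sigma> i))"
      using C(1) by (intro mult_right_mono mult_left_mono prod_power_le[OF n z] prod_nonneg) auto
    also have "(\<Prod>i\<in>{1..r}. real (n i) powr (- \<sigma> i)) =
        (\<Prod>i\<in>{1..r}. real (n i) powr (- (\<sigma> i - (1 + \<delta>)))) * (\<Prod>i\<in>{1..r}. real (n i) powr (- (1 + \<delta>)))"
      unfolding prod.distrib[symmetric] by (intro prod.cong) (simp_all flip: powr_add)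
    also have "\<dots> \<le> 1 * (\<Prod>i\<in>{1..r}. real (n i) powr (- (1 + \<delta>)))"
    proof (intro mult_right_mono prod_powr_le_one[OF n] prod_nonneg)
      fix i assume i: "i \<in> {1..r}"
      have ins': "{1..i} = insert 1 {2..i}" using i by auto
      have "(\<Sum>l=1..i. \<sigma> l) = Re (s 1) + real N + (\<Sum>l=2..i. Re (s l))"
        unfolding ins' by (simp add: \<sigma>_def)
      also have "\<dots> = Re (psum s i) + real N"
        unfolding psum_def ins' by simp
      finally show "0 \<le> (\<Sum>l=1..i. \<sigma> l - (1 + \<delta>))"
        using ps[OF s i] by (simp add: sum_subtractf)
    qed auto
    finally show ?thesis using C(1) by (simp add: M_def mult_left_mono)
  qed
  moreover have "M summable_on decr_tuples r"
    unfolding M_def using summable_on_decr_tuples[OF \<delta>] by (rule summable_on_cmult_right)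
  ultimately show ?thesis using that[OF e] by blast
qed

lemma rem_summable:
  assumes "r \<ge> 1" "admissible r z" "s \<in> shifted_dom r N"
  shows "(\<lambda>n. kern (z 1) N (s 1) (n 1) * wterm {2..r} z s n) summable_on decr_tuples r"
proof -
  obtain e M where e: "e > 0" "M summable_on decr_tuples r"
    "\<And>n t. n \<in> decr_tuples r \<Longrightarrow> t \<in> pdisc r s e \<Longrightarrow>
       cmod (kern (z 1) N (t 1) (n 1) * wterm {2..r} z t n) \<le> M n"
    using rem_term_bound[OF assms] by blast
  have "s \<in> pdisc r s e" using assms(3) e(1) by (intro centre_in_pdisc) (simp_all add: shifted_dom_def)
  then show ?thesis
    by (intro summable_on_dominated[OF e(2)] e(3))
qed

lemma holo_on_rem:
  assumes r: "r \<ge> 1" and z: "admissible r z"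
  shows "holo_on r (rem r z N) (shifted_dom r N)"
  unfolding rem_def[abs_def]
proof (rule holo_on_infsum[OF openin_shifted_dom])
  fix n :: "nat \<Rightarrow> nat"
  have "holo_on r (\<lambda>s. kern (z 1) N (s 1) (n 1)) (shifted_dom r N)"
    using r by (intro holo_on_compose_entire[OF holo_on_coord[OF openin_shifted_dom]] field_differentiable_kern) simp
  moreover have "holo_on r (\<lambda>s. wterm {2..r} z s n) (shifted_dom r N)"
    unfolding wterm_def
  proof (intro holo_on_prod holo_on_mult holo_on_const openin_shifted_dom)
    fix i assume "i \<in> {2..r}"
    then show "holo_on r (\<lambda>s. of_nat (n i) powr (- s i)) (shifted_dom r N)"
      by (intro holo_on_compose_entire[OF holo_on_coord[OF openin_shifted_dom], where h = "\<lambda>w. of_nat (n i) powr (- w)"]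
          field_differentiable_nat_powr derivative_intros) auto
  qed
  ultimately show "holo_on r (\<lambda>s. kern (z 1) N (s 1) (n 1) * wterm {2..r} z s n) (shifted_dom r N)"
    by (rule holo_on_mult)
next
  fix p assume "p \<in> shifted_dom r N"
  from rem_term_bound[OF r z this] obtain e M where "e > 0" "M summable_on decr_tuples r"
    "\<And>n s. n \<in> decr_tuples r \<Longrightarrow> s \<in> pdisc r p e \<Longrightarrow>
       cmod (kern (z 1) N (s 1) (n 1) * wterm {2..r} z s n) \<le> M n" by blast
  then show "\<exists>e>0. \<exists>M. M summable_on decr_tuples r \<and> (\<forall>n\<in>decr_tuples r. \<forall>s\<in>pdisc r p e.
      cmod (kern (z 1) N (s 1) (n 1) * wterm {2..r} z s n) \<le> M n)"
    by (intro exI[of _ e] conjI exI[of _ M] ballI) simp_all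
qed

lemma rem_0:
  assumes "r \<ge> 1"
  shows "rem r z 0 s = rho (z 1) (s 1) * Lser r z s"
proof -
  have "{1..r} = insert 1 {2..r}" using assms by auto
  then have "kern (z 1) 0 (s 1) (n 1) * wterm {2..r} z s n = rho (z 1) (s 1) * wterm {1..r} z s n" for n
    by (simp add: wterm_def kern_def)
  then show ?thesis
    unfolding rem_def Lser_def by (simp only: infsum_cmult_right')
qed

text \<open>For the empty tuple the value 0 is the right lower limit for n_1, and it makes the
  boundary term of the telescoping sum vanish.\<close>

definition tuple_top :: "nat \<Rightarrow> (nat \<Rightarrow> nat) \<Rightarrow> nat" where
  "tuple_top q n = (if q = 0 then 0 else n 1)"

definition tuple_cons :: "nat \<Rightarrow> nat \<Rightarrow> (nat \<Rightarrow> nat) \<Rightarrow> nat \<Rightarrow> nat" where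
  "tuple_cons q m n = (\<lambda>i\<in>{1..Suc q}. if i = 1 then m else n (i - 1))"

lemma bij_betw_tuple_cons:
  "bij_betw (\<lambda>(n, m). tuple_cons q m n) (SIGMA n:decr_tuples q. {tuple_top q n<..}) (decr_tuples (Suc q))"
proof (rule bij_betw_byWitness[where f' = "\<lambda>n. (\<lambda>i\<in>{1..q}. n (Suc i), n 1)"])
  show "\<forall>a\<in>SIGMA n:decr_tuples q. {tuple_top q n<..}.
      (\<lambda>n. (\<lambda>i\<in>{1..q}. n (Suc i), n 1)) (case a of (n, m) \<Rightarrow> tuple_cons q m n) = a"
    by (auto simp: tuple_cons_def decr_tuples_def fun_eq_iff PiE_iff extensional_def)
  show "\<forall>a\<in>decr_tuples (Suc q). (case (\<lambda>i\<in>{1..q}. a (Suc i), a 1) of (n, m) \<Rightarrow> tuple_cons q m n) = a"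
    by (auto simp: tuple_cons_def decr_tuples_def fun_eq_iff PiE_iff extensional_def)
  show "(\<lambda>(n, m). tuple_cons q m n) ` (SIGMA n:decr_tuples q. {tuple_top q n<..}) \<subseteq> decr_tuples (Suc q)"
  proof safe
    fix n m assume n: "n \<in> decr_tuples q" and m: "tuple_top q n < m"
    have "n i < m" if "i \<in> {1..q}" for i
    proof (cases "i = 1")
      case False
      then have "n i < n 1" using decr_tuplesD(2)[OF n, of 1 i] that by auto
      then show ?thesis using m that by (auto simp: tuple_top_def)
    qed (use m that in \<open>auto simp: tuple_top_def\<close>)
    then show "tuple_cons q m n \<in> decr_tuples (Suc q)"
      using n m decr_tuplesD[OF n]
      by (auto simp: tuple_cons_def decr_tuples_def PiE_iff extensional_def Suc_le_eq)
  qed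
  show "(\<lambda>n. (\<lambda>i\<in>{1..q}. n (Suc i), n 1)) ` decr_tuples (Suc q) \<subseteq> (SIGMA n:decr_tuples q. {tuple_top q n<..})"
    by (auto simp: tuple_top_def decr_tuples_def PiE_iff extensional_def)
qed

lemma infsum_decr_tuples_Suc:
  fixes F :: "(nat \<Rightarrow> nat) \<Rightarrow> complex"
  assumes "F summable_on decr_tuples (Suc q)"
  shows "infsum F (decr_tuples (Suc q)) =
    (\<Sum>\<^sub>\<infinity>n\<in>decr_tuples q. \<Sum>\<^sub>\<infinity>m\<in>{tuple_top q n<..}. F (tuple_cons q m n))"
proof -
  let ?g = "\<lambda>(n, m). tuple_cons q m n"
  have "(\<lambda>x. F (?g x)) summable_on (SIGMA n:decr_tuples q. {tuple_top q n<..})"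
    using summable_on_reindex_bij_betw[OF bij_betw_tuple_cons, of F q] assms by simp
  from infsum_Sigma_banach[OF this]
  have "(\<Sum>\<^sub>\<infinity>n\<in>decr_tuples q. \<Sum>\<^sub>\<infinity>m\<in>{tuple_top q n<..}. F (tuple_cons q m n)) =
      infsum (\<lambda>x. F (?g x)) (SIGMA n:decr_tuples q. {tuple_top q n<..})"
    by simp
  also have "\<dots> = infsum F (decr_tuples (Suc q))"
    using infsum_reindex_bij_betw[OF bij_betw_tuple_cons, of F q] by simp
  finally show ?thesis ..
qed

text \<open>Raising the order by one changes the kernel by a difference of consecutive values, so
  only the boundary term at M remains; the terms at infinity tend to 0 since the exponent w has
  negative real part.\<close>

lemma infsum_telescope:
  assumes x: "cmod x \<le> 1" "x \<noteq> 0" and s: "Re s + real N > 1"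
  shows "(\<Sum>\<^sub>\<infinity>m\<in>{M<..}. kern x N s m - kern x (Suc N) s m) =
    ct x N s * (x ^ M * of_nat M powr (of_nat (eps x) - s - of_nat N))"
proof -
  have sk: "kern x K s summable_on {M<..}" if K: "Re s + real K > 1" for K
  proof -
    obtain C where C: "C \<ge> 0" "\<And>t m. cmod t \<le> cmod s \<Longrightarrow> m \<ge> 1 \<Longrightarrow>
        cmod (kern x K t m) \<le> C * cmod x ^ m * real m powr (- Re t - real K)"
      using kern_bound[OF x(2), of "cmod s"] by auto
    have "summable (\<lambda>m. real m powr (- Re s - real K))"
      using K by (subst summable_real_powr_iff) simp
    then have "summable (\<lambda>m. C * real m powr (- Re s - real K))" by (rule summable_mult)
    then have "(\<lambda>m. C * real m powr (- Re s - real K)) summable_on UNIV"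
      using C(1) by (intro norm_summable_imp_summable_on) simp
    then have "(\<lambda>m. C * real m powr (- Re s - real K)) summable_on {M<..}"
      by (rule summable_on_subset_banach) simp
    moreover have "cmod (kern x K s m) \<le> C * real m powr (- Re s - real K)" if "m \<in> {M<..}" for m
    proof -
      have "cmod (kern x K s m) \<le> C * cmod x ^ m * real m powr (- Re s - real K)"
        using C(2)[of s m] that by auto
      also have "\<dots> \<le> C * 1 * real m powr (- Re s - real K)"
        using C(1) x(1) by (intro mult_right_mono mult_left_mono power_le_one) auto
      finally show ?thesis by simp
    qed
    ultimately show ?thesis by (rule summable_on_dominated)
  qed
  define w where "w = of_nat (eps x) - s - of_nat N"
  define h where "h j = ct x N s * (x ^ (M + j) * of_nat (M + j) powr w)" for j
  have "(\<lambda>m. kern x N s m - kern x (Suc N) s m) summable_on {M<..}"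
  proof -
    have "(\<lambda>m. kern x N s m + (- 1) * kern x (Suc N) s m) summable_on {M<..}"
      using s by (intro summable_on_add summable_on_cmult_right sk) auto
    then show ?thesis by simp
  qed
  moreover have "bij_betw (\<lambda>j. M + Suc j) UNIV {M<..}"
    by (rule bij_betw_byWitness[where f' = "\<lambda>m. m - Suc M"]) auto
  note bij = this
  ultimately have "(\<lambda>j. kern x N s (M + Suc j) - kern x (Suc N) s (M + Suc j)) summable_on UNIV"
    using summable_on_reindex_bij_betw[OF bij, of "\<lambda>m. kern x N s m - kern x (Suc N) s m"] by simp
  then have hs: "(\<lambda>j. kern x N s (M + Suc j) - kern x (Suc N) s (M + Suc j)) sums
      (\<Sum>\<^sub>\<infinity>j. kern x N s (M + Suc j) - kern x (Suc N) s (M + Suc j))"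
    by (intro has_sum_imp_sums has_sum_infsum)
  have "kern x N s (M + Suc j) - kern x (Suc N) s (M + Suc j) = h j - h (Suc j)" for j
    unfolding kern_Suc[of x N] by (simp add: h_def w_def right_diff_distrib)
  moreover have "h \<longlonglongrightarrow> 0"
  proof -
    have w: "Re w < 0" using s by (auto simp: w_def eps_def split: if_splits)
    have "(\<lambda>n. real n powr Re w) \<longlonglongrightarrow> 0"
      by (rule tendsto_neg_powr[OF w filterlim_real_sequentially])
    then have "(\<lambda>j. cmod (ct x N s) * real (j + M) powr Re w) \<longlonglongrightarrow> cmod (ct x N s) * 0"
      by (intro tendsto_mult tendsto_const LIMSEQ_ignore_initial_segment)
    then have lim: "(\<lambda>j. cmod (ct x N s) * real (j + M) powr Re w) \<longlonglongrightarrow> 0" by simp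
    show ?thesis
    proof (rule Lim_null_comparison[OF _ lim])
      show "\<forall>\<^sub>F j in sequentially. norm (h j) \<le> cmod (ct x N s) * real (j + M) powr Re w"
        using eventually_ge_at_top[of 1]
      proof eventually_elim
        case (elim j)
        have "norm (h j) = cmod (ct x N s) * (cmod x ^ (M + j) * real (M + j) powr Re w)"
          using elim by (simp add: h_def norm_mult norm_power cmod_nat_powr del: of_nat_add)
        also have "\<dots> \<le> cmod (ct x N s) * (1 * real (M + j) powr Re w)"
          using x(1) by (intro mult_left_mono mult_right_mono power_le_one) auto
        finally show ?case by (simp add: add.commute)
      qed
    qed
  qed
  ultimately have "(\<lambda>j. kern x N s (M + Suc j) - kern x (Suc N) s (M + Suc j)) sums h 0"
    using telescope_sums'[of h 0] by simp
  then have "(\<Sum>\<^sub>\<infinity>j. kern x N s (M + Suc j) - kern x (Suc N) s (M + Suc j)) = h 0"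
    using hs sums_unique2 by blast
  also have "(\<Sum>\<^sub>\<infinity>j. kern x N s (M + Suc j) - kern x (Suc N) s (M + Suc j)) =
      (\<Sum>\<^sub>\<infinity>m\<in>{M<..}. kern x N s m - kern x (Suc N) s m)"
    using infsum_reindex_bij_betw[OF bij, of "\<lambda>m. kern x N s m - kern x (Suc N) s m"] by simp
  finally show ?thesis by (simp add: h_def w_def)
qed

section \<open>The meromorphic continuation\<close>

text \<open>After the summation over \<open>n\<^sub>1\<close>, the inner series has the characters \<open>z\<^sub>1 z\<^sub>2, z\<^sub>3, \<dots>\<close> and the
  arguments \<open>s\<^sub>1 + s\<^sub>2 + k - eps z\<^sub>1, s\<^sub>3, \<dots>\<close>.\<close>

definition mz :: "(nat \<Rightarrow> complex) \<Rightarrow> nat \<Rightarrow> complex" where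
  "mz z i = (if i = 1 then z 1 * z 2 else z (i + 1))"

definition ms :: "nat \<Rightarrow> (nat \<Rightarrow> complex) \<Rightarrow> nat \<Rightarrow> (nat \<Rightarrow> complex) \<Rightarrow> nat \<Rightarrow> complex" where
  "ms q z k = aff (Suc q) q (\<lambda>i. if i = 1 then 1 else i - 1)
     (\<lambda>j. if j = 1 then of_nat k - of_nat (eps (z 1)) else 0)"

lemma ms_1:
  assumes "q \<ge> 1"
  shows "ms q z k s 1 = s 1 + s 2 + of_nat k - of_nat (eps (z 1))"
proof -
  have "{i\<in>{1..Suc q}. (if i = 1 then 1 else i - 1) = (1::nat)} = {1, 2}" using assms by auto
  then show ?thesis using assms by (simp add: ms_def aff_def)
qed

lemma ms_gt_1:
  assumes "2 \<le> j" "j \<le> q"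
  shows "ms q z k s j = s (j + 1)"
proof -
  have "{i\<in>{1..Suc q}. (if i = 1 then 1 else i - 1) = j} = {j + 1}" using assms by auto
  then show ?thesis using assms by (simp add: ms_def aff_def)
qed

text \<open>The decisive property of the substitution: partial sums move by an integer and their
  index drops by one. Polar hyperplanes therefore come from hyperplanes of the same kind, and
  generic points stay generic.\<close>

lemma psum_ms:
  assumes "1 \<le> j" "j \<le> q"
  shows "psum (ms q z k s) j = psum s (j + 1) + of_nat k - of_nat (eps (z 1))"
  using assms
proof (induction j rule: dec_induct)
  case base
  then show ?case using ms_1[of q z k s] by (simp add: psum_def numeral_2_eq_2)
next
  case (step j)
  then show ?case using ms_gt_1[of "Suc j" q z k s] by (simp add: psum_def)
qed

lemma ms_topspace: "ms q z k s \<in> topspace (Cpow q)"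
  unfolding ms_def by (rule aff_topspace)

lemma prod_mz: "i \<ge> 1 \<Longrightarrow> (\<Prod>l=1..i. mz z l) = (\<Prod>l=1..i+1. z l)"
proof (induction i rule: dec_induct)
  case base
  then show ?case by (simp add: mz_def numeral_2_eq_2)
next
  case (step i)
  then show ?case by (simp add: mz_def)
qed

lemma admissible_mz: "admissible (Suc q) z \<Longrightarrow> admissible q (mz z)"
  unfolding admissible_def
proof (intro ballI conjI)
  fix i assume z: "\<forall>i\<in>{1..Suc q}. z i \<noteq> 0 \<and> cmod (\<Prod>l=1..i. z l) \<le> 1" and i: "i \<in> {1..q}"
  show "mz z i \<noteq> 0" using z i by (auto simp: mz_def)
  have "i + 1 \<in> {1..Suc q}" using i by simp
  then have "cmod (\<Prod>l=1..i+1. z l) \<le> 1" using z by blast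
  then show "cmod (\<Prod>l=1..i. mz z l) \<le> 1" using i by (subst prod_mz) simp_all
qed

lemma ms_gen: "s \<in> gen (Suc q) \<Longrightarrow> ms q z k s \<in> gen q"
  unfolding gen_iff using psum_ms[of _ q z k s] by (auto simp: ms_topspace)

text \<open>The bound for index i + 1 exceeds the one for index i by 1, which absorbs the loss of at
  most 1 through \<open>eps\<close>.\<close>

lemma ms_shifted_dom:
  assumes "s \<in> shifted_dom (Suc q) k"
  shows "ms q z k s \<in> shifted_dom q 0"
  unfolding shifted_dom_def
proof (intro CollectI conjI ms_topspace ballI)
  fix i assume i: "i \<in> {1..q}"
  then have "i + 1 \<in> {1..Suc q}" by simp
  then have "Re (psum s (i + 1)) + real k > real (i + 1)" using assms unfolding shifted_dom_def by blast
  then show "real i < Re (psum (ms q z k s) i) + real 0"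
    using i by (subst psum_ms) (auto simp: eps_def)
qed

lemma decr_tuples_0: "decr_tuples 0 = {\<lambda>_. undefined}"
  by (auto simp: decr_tuples_def PiE_def extensional_def)

lemma wterm_tuple_cons:
  "wterm {2..Suc q} z s (tuple_cons q m n) = (\<Prod>i=1..q. z (Suc i) ^ n i * of_nat (n i) powr (- s (Suc i)))"
  unfolding wterm_def
  by (rule prod.reindex_bij_witness[of _ Suc "\<lambda>i. i - 1"]) (auto simp: tuple_cons_def)

text \<open>Summing over n_1 first, the telescoped boundary term at n_1 = n_2 multiplies the factor
  of n_2, merging characters and exponents into those of the shorter series.\<close>

lemma rem_diff:
  assumes z: "admissible (Suc q) z" and s: "s \<in> shifted_dom (Suc q) N"
  shows "rem (Suc q) z N s - rem (Suc q) z (Suc N) s =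
    (if q = 0 then 0 else ct (z 1) N (s 1) * Lser q (mz z) (ms q z N s))"
proof -
  let ?D = "decr_tuples (Suc q)"
  define w where "w = of_nat (eps (z 1)) - s 1 - of_nat N"
  define W where "W n = (\<Prod>i=1..q. z (Suc i) ^ n i * of_nat (n i) powr (- s (Suc i)))" for n :: "nat \<Rightarrow> nat"
  define f where "f K n = kern (z 1) K (s 1) (n 1) * wterm {2..Suc q} z s n" for K n
  have sN: "s \<in> shifted_dom (Suc q) (Suc N)" using s shifted_dom_mono[of N "Suc N"] by auto
  have fN: "f N summable_on ?D" "f (Suc N) summable_on ?D"
    unfolding f_def by (rule rem_summable[OF _ z s], simp, rule rem_summable[OF _ z sN], simp)
  then have neg: "(\<lambda>n. - f (Suc N) n) summable_on ?D" by (simp only: summable_on_uminus)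
  have z1: "z 1 \<noteq> 0" "cmod (z 1) \<le> 1"
  proof -
    have "1 \<in> {1..Suc q}" by simp
    then have "z 1 \<noteq> 0 \<and> cmod (\<Prod>l=1..1. z l) \<le> 1" using z unfolding admissible_def by blast
    then show "z 1 \<noteq> 0" "cmod (z 1) \<le> 1" by simp_all
  qed
  have "1 \<in> {1..Suc q}" by simp
  then have "Re (psum s 1) + real N > real 1" using s unfolding shifted_dom_def by blast
  then have s1: "Re (s 1) + real N > 1" by (simp add: psum_def)
  have sum: "(\<lambda>n. f N n + - f (Suc N) n) summable_on ?D"
    by (intro summable_on_add fN neg)
  have "rem (Suc q) z N s - rem (Suc q) z (Suc N) s = infsum (f N) ?D + - infsum (f (Suc N)) ?D"
    by (simp only: rem_def f_def[abs_def] diff_conv_add_uminus)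
  also have "\<dots> = (\<Sum>\<^sub>\<infinity>n\<in>?D. f N n + - f (Suc N) n)"
    using infsum_add[OF fN(1) neg] by (simp only: infsum_uminus)
  also have "\<dots> = (\<Sum>\<^sub>\<infinity>n\<in>decr_tuples q. \<Sum>\<^sub>\<infinity>m\<in>{tuple_top q n<..}. f N (tuple_cons q m n) + - f (Suc N) (tuple_cons q m n))"
    by (rule infsum_decr_tuples_Suc[OF sum])
  also have "\<dots> = (\<Sum>\<^sub>\<infinity>n\<in>decr_tuples q. ct (z 1) N (s 1) * (z 1 ^ tuple_top q n * of_nat (tuple_top q n) powr w) * W n)"
  proof (rule infsum_cong)
    fix n
    have "f N (tuple_cons q m n) + - f (Suc N) (tuple_cons q m n) = (kern (z 1) N (s 1) m - kern (z 1) (Suc N) (s 1) m) * W n" for m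
      unfolding f_def wterm_tuple_cons W_def by (simp add: tuple_cons_def algebra_simps)
    then show "(\<Sum>\<^sub>\<infinity>m\<in>{tuple_top q n<..}. f N (tuple_cons q m n) + - f (Suc N) (tuple_cons q m n)) =
        ct (z 1) N (s 1) * (z 1 ^ tuple_top q n * of_nat (tuple_top q n) powr w) * W n"
      by (simp only: infsum_cmult_left' infsum_telescope[OF z1(2,1) s1] w_def)
  qed
  also have "\<dots> = (if q = 0 then 0 else ct (z 1) N (s 1) * Lser q (mz z) (ms q z N s))"
  proof (cases "q = 0")
    \<comment> \<open>No inner variable exists: the boundary value is taken at 0, where every power
      is 0.\<close>
    case True
    then show ?thesis by (simp add: tuple_top_def)
  next
    case False
    have ins: "{1..q} = insert 1 {2..q}" using False by auto
    have "ct (z 1) N (s 1) * (z 1 ^ tuple_top q n * of_nat (tuple_top q n) powr w) * W n =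
        ct (z 1) N (s 1) * wterm {1..q} (mz z) (ms q z N s) n" if n: "n \<in> decr_tuples q" for n
    proof -
      have n1: "n 1 \<ge> 1" using decr_tuplesD(1)[OF n, of 1] False by simp
      have "W n = (z 2 ^ n 1 * of_nat (n 1) powr (- s 2)) * (\<Prod>i=2..q. z (Suc i) ^ n i * of_nat (n i) powr (- s (Suc i)))"
        unfolding W_def ins by (simp add: numeral_2_eq_2)
      also have "(\<Prod>i=2..q. z (Suc i) ^ n i * of_nat (n i) powr (- s (Suc i))) = wterm {2..q} (mz z) (ms q z N s) n"
        unfolding wterm_def by (rule prod.cong) (auto simp: mz_def ms_gt_1)
      finally have W: "W n = (z 2 ^ n 1 * of_nat (n 1) powr (- s 2)) * wterm {2..q} (mz z) (ms q z N s) n" .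
      have ms1: "ms q z N s 1 = - w + s 2" using ms_1[of q z N s] False by (simp add: w_def)
      have "of_nat (n 1) powr w * of_nat (n 1) powr (- s 2) = of_nat (n 1) powr (- ms q z N s 1)"
        unfolding ms1 by (simp flip: powr_add)
      moreover have "wterm {1..q} (mz z) (ms q z N s) n =
          (z 1 ^ n 1 * z 2 ^ n 1) * of_nat (n 1) powr (- ms q z N s 1) * wterm {2..q} (mz z) (ms q z N s) n"
        unfolding ins by (simp add: wterm_def mz_def power_mult_distrib)
      ultimately show ?thesis
        using False unfolding W tuple_top_def by (simp add: mult_ac)
    qed
    then have "(\<Sum>\<^sub>\<infinity>n\<in>decr_tuples q. ct (z 1) N (s 1) * (z 1 ^ tuple_top q n * of_nat (tuple_top q n) powr w) * W n) =
        (\<Sum>\<^sub>\<infinity>n\<in>decr_tuples q. ct (z 1) N (s 1) * wterm {1..q} (mz z) (ms q z N s) n)"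
      by (rule infsum_cong)
    also have "\<dots> = ct (z 1) N (s 1) * Lser q (mz z) (ms q z N s)"
      unfolding Lser_def by (rule infsum_cmult_right')
    finally show ?thesis using False by simp
  qed
  finally show ?thesis .
qed

text \<open>Summing over \<open>n\<^sub>1\<close> first by the Euler--Maclaurin formula expresses \<open>Z (Suc q)\<close> by shifted
  values of \<open>Z q\<close> and a remainder converging on a domain that grows with the order.\<close>

primrec Z :: "nat \<Rightarrow> (nat \<Rightarrow> complex) \<Rightarrow> (nat \<Rightarrow> complex) \<Rightarrow> complex" where
  "Z 0 z s = 1"
| "Z (Suc q) z s = (let N = (LEAST N. s \<in> shifted_dom (Suc q) N) in
     ((\<Sum>k<N. if q = 0 then 0 else ct (z 1) k (s 1) * Z q (mz z) (ms q z k s)) + rem (Suc q) z N s) / rho (z 1) (s 1))"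

text \<open>The numerator of \<open>Z\<close> with the order left free. In \<open>Z\<close> the
  order varies with the point, which would obstruct any statement on a neighbourhood.\<close>

definition G :: "nat \<Rightarrow> (nat \<Rightarrow> complex) \<Rightarrow> nat \<Rightarrow> (nat \<Rightarrow> complex) \<Rightarrow> complex" where
  "G q z N s = (\<Sum>k<N. if q = 0 then 0 else ct (z 1) k (s 1) * Z q (mz z) (ms q z k s)) + rem (Suc q) z N s"

lemma rho_nonzero: "Im s \<noteq> 0 \<or> Re s > 1 \<Longrightarrow> rho x s \<noteq> 0"
  by (auto simp: rho_def)

lemma Z_eq_Lser:
  assumes "s \<in> shifted_dom r 0"
  shows "Z r z s = Lser r z s"
proof (cases r)
  case 0
  then show ?thesis by (simp add: Lser_def decr_tuples_0 wterm_def)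
next
  case (Suc q)
  have "(LEAST N. s \<in> shifted_dom (Suc q) N) = 0" using assms Suc by (intro Least_equality) auto
  moreover have "rho (z 1) (s 1) \<noteq> 0"
  proof -
    have "1 \<in> {1..r}" using Suc by simp
    then have "Re (psum s 1) + real 0 > real 1" using assms unfolding shifted_dom_def by blast
    then show ?thesis by (intro rho_nonzero) (simp add: psum_def)
  qed
  ultimately show ?thesis using Suc by (simp add: rem_0)
qed

text \<open>The new summand is evaluated where the shorter series converges, so there
  \<open>Z\<close> is that series, and \<open>rem_diff\<close> says that the remainder loses exactly
  this term.\<close>

lemma G_Suc:
  assumes "admissible (Suc q) z" "s \<in> shifted_dom (Suc q) N"
  shows "G q z (Suc N) s = G q z N s"
  using rem_diff[OF assms] Z_eq_Lser[OF ms_shifted_dom[OF assms(2)], of "mz z" z]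
  by (cases "q = 0") (simp_all add: G_def algebra_simps)

lemma G_mono:
  assumes "admissible (Suc q) z" "s \<in> shifted_dom (Suc q) N" "N \<le> M"
  shows "G q z M s = G q z N s"
  using assms(3)
proof (induction M rule: dec_induct)
  case (step M)
  have "s \<in> shifted_dom (Suc q) M" using assms(2) shifted_dom_mono[OF step(1)] by blast
  then show ?case using G_Suc[OF assms(1)] step by simp
qed simp

text \<open>Any sufficiently large order may be used, hence a common one near a given point. This
  replaces the defining equation from here on.\<close>

lemma Z_Suc:
  assumes "admissible (Suc q) z" "s \<in> shifted_dom (Suc q) N"
  shows "Z (Suc q) z s = G q z N s / rho (z 1) (s 1)"
proof -
  define L where "L = (LEAST N. s \<in> shifted_dom (Suc q) N)"
  have "s \<in> shifted_dom (Suc q) L" unfolding L_def using assms(2) by (rule LeastI)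
  moreover have "L \<le> N" unfolding L_def using assms(2) by (rule Least_le)
  ultimately have "G q z N s = G q z L s" by (rule G_mono[OF assms(1)])
  then show ?thesis by (simp add: L_def G_def Let_def)
qed

declare Z.simps(2) [simp del]

section \<open>Holomorphy and meromorphy of \<open>Z\<close>\<close>

lemma holo_on_ct: "openin (Cpow r) U \<Longrightarrow> r \<ge> 1 \<Longrightarrow> holo_on r (\<lambda>s. ct x k (s 1)) U"
  by (intro holo_on_compose_entire[OF holo_on_coord] field_differentiable_ct) simp_all

lemma holo_on_rho: "openin (Cpow r) U \<Longrightarrow> r \<ge> 1 \<Longrightarrow> holo_on r (\<lambda>s. rho x (s 1)) U"
  by (intro holo_on_compose_entire[OF holo_on_coord] field_differentiable_rho) simp_all

lemma gen_coord_1: "s \<in> gen r \<Longrightarrow> r \<ge> 1 \<Longrightarrow> Im (s 1) \<noteq> 0"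
  unfolding gen_iff by (elim conjE, drule bspec[of _ _ 1]) (simp_all add: psum_def)

lemma holo_on_Z: "admissible r z \<Longrightarrow> holo_on r (Z r z) (gen r)"
proof (induction r arbitrary: z)
  case 0
  then show ?case by (simp add: holo_on_const openin_HGen)
next
  case (Suc q)
  show ?case
  proof (rule holo_on_locally[OF openin_HGen])
    fix p assume p: "p \<in> gen (Suc q)"
    then obtain N where N: "p \<in> shifted_dom (Suc q) N" using shifted_dom_exhausts HGen_subset by blast
    have "openin (Cpow (Suc q)) (gen (Suc q) \<inter> shifted_dom (Suc q) N)"
      by (intro openin_Int openin_HGen openin_shifted_dom)
    then obtain e where e: "e > 0" "pdisc (Suc q) p e \<subseteq> gen (Suc q) \<inter> shifted_dom (Suc q) N"
      using p N unfolding openin_Cpow by blast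
    let ?P = "pdisc (Suc q) p e"
    have "holo_on (Suc q) (\<lambda>s. Z q (mz z) (ms q z k s)) ?P" for k
      unfolding ms_def
    proof (rule holo_on_aff[OF Suc.IH[OF admissible_mz[OF Suc.prems]] openin_pdisc])
      fix s assume "s \<in> ?P"
      then have "s \<in> gen (Suc q)" using e(2) by blast
      from ms_gen[OF this, of z k] show "aff (Suc q) q (\<lambda>i. if i = 1 then 1 else i - 1)
          (\<lambda>j. if j = 1 then of_nat k - of_nat (eps (z 1)) else 0) s \<in> gen q"
        by (simp add: ms_def)
    qed
    then have "holo_on (Suc q) (\<lambda>s. if q = 0 then 0 else ct (z 1) k (s 1) * Z q (mz z) (ms q z k s)) ?P" for k
      using holo_on_mult[OF holo_on_ct[OF openin_pdisc]]
      by (cases "q = 0") (simp_all add: holo_on_const openin_pdisc)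
    moreover have "?P \<subseteq> shifted_dom (Suc q) N" using e(2) by blast
    then have "holo_on (Suc q) (rem (Suc q) z N) ?P"
      by (intro holo_on_subset[OF holo_on_rem openin_pdisc]) (simp_all add: Suc.prems)
    ultimately have G: "holo_on (Suc q) (G q z N) ?P"
      unfolding G_def[abs_def] by (intro holo_on_add holo_on_sum openin_pdisc)
    have "holo_on (Suc q) (\<lambda>s. G q z N s / rho (z 1) (s 1)) ?P"
    proof (rule holo_on_divide[OF G holo_on_rho[OF openin_pdisc]])
      fix s assume "s \<in> ?P"
      then have "Im (s 1) \<noteq> 0" using e(2) gen_coord_1[of s "Suc q"] by auto
      then show "rho (z 1) (s 1) \<noteq> 0" by (rule rho_nonzero[OF disjI1])
    qed simp
    then have "holo_on (Suc q) (Z (Suc q) z) ?P"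
    proof (rule holo_on_cong)
      fix s assume "s \<in> ?P"
      then have "s \<in> shifted_dom (Suc q) N" using e(2) by blast
      then show "G q z N s / rho (z 1) (s 1) = Z (Suc q) z s" using Z_Suc[OF Suc.prems] by simp
    qed
    then show "\<exists>e>0. holo_on (Suc q) (Z (Suc q) z) (pdisc (Suc q) p e)" using e(1) by blast
  qed
qed

lemma regular_gen_ms:
  assumes "regular_gen q F (ms q z k p) v"
  shows "regular_gen (Suc q) (\<lambda>s. F (ms q z k s)) p v"
  using assms unfolding ms_def by (rule regular_gen_aff) (rule ms_gen[unfolded ms_def])

lemma mero_gen_ms:
  assumes "mero_gen q F (ms q z k p)"
  shows "mero_gen (Suc q) (\<lambda>s. F (ms q z k s)) p"
  using assms unfolding ms_def by (rule mero_gen_aff) (rule ms_gen[unfolded ms_def])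

lemma mero_gen_Z: "admissible r z \<Longrightarrow> p \<in> topspace (Cpow r) \<Longrightarrow> mero_gen r (Z r z) p"
proof (induction r arbitrary: z p)
  case 0
  then show ?case by (simp add: mero_gen_regular[OF regular_gen_const])
next
  case (Suc q)
  obtain N where N: "p \<in> shifted_dom (Suc q) N" using shifted_dom_exhausts[OF Suc.prems(2)] by blast
  then obtain e where e: "e > 0" "pdisc (Suc q) p e \<subseteq> shifted_dom (Suc q) N"
    using openin_shifted_dom[of "Suc q" N] unfolding openin_Cpow by blast
  have "mero_gen (Suc q) (\<lambda>s. if q = 0 then 0 else ct (z 1) k (s 1) * Z q (mz z) (ms q z k s)) p" for k
  proof (cases "q = 0")
    case True
    then show ?thesis using mero_gen_regular[OF regular_gen_const[OF Suc.prems(2)], of 0] by simp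
  next
    case False
    have "mero_gen (Suc q) (\<lambda>s. Z q (mz z) (ms q z k s)) p"
      by (rule mero_gen_ms[OF Suc.IH[OF admissible_mz[OF Suc.prems(1)] ms_topspace]])
    moreover have "mero_gen (Suc q) (\<lambda>s. ct (z 1) k (s 1)) p"
      using regular_gen_holo[OF holo_on_ct[of "Suc q" "topspace (Cpow (Suc q))" "z 1" k] Suc.prems(2)]
      by (intro mero_gen_regular) simp
    ultimately show ?thesis using False mero_gen_mult by simp
  qed
  moreover have "mero_gen (Suc q) (rem (Suc q) z N) p"
    using mero_gen_regular[OF regular_gen_holo[OF holo_on_rem[OF _ Suc.prems(1)] N]] by simp
  ultimately have "mero_gen (Suc q) (G q z N) p"
    unfolding G_def[abs_def] by (intro mero_gen_add mero_gen_sum[OF Suc.prems(2)])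
  moreover have "mero_gen (Suc q) (\<lambda>s. inverse (rho (z 1) (s 1))) p"
  proof (rule mero_gen_inverse_holo)
    show "holo_on (Suc q) (\<lambda>s. rho (z 1) (s 1)) (topspace (Cpow (Suc q)))"
      by (rule holo_on_rho) simp_all
    show "rho (z 1) (s 1) \<noteq> 0" if "s \<in> gen (Suc q)" for s
      using gen_coord_1[OF that] by (intro rho_nonzero) simp
  qed (rule Suc.prems(2))
  ultimately have "mero_gen (Suc q) (\<lambda>s. G q z N s * inverse (rho (z 1) (s 1))) p"
    by (rule mero_gen_mult)
  then show ?case
  proof (rule mero_gen_cong[OF _ e(1)])
    fix s assume "s \<in> pdisc (Suc q) p e"
    then have "s \<in> shifted_dom (Suc q) N" using e(2) by blast
    then show "Z (Suc q) z s = G q z N s * inverse (rho (z 1) (s 1))"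
      using Z_Suc[OF Suc.prems(1)] by (simp add: divide_inverse)
  qed
qed

lemma mero_Z: "admissible r z \<Longrightarrow> mero r (Z r z)"
  by (intro mero_of_mero_gen mero_gen_Z)

section \<open>Residues of the continuation\<close>

definition tail :: "nat \<Rightarrow> nat \<Rightarrow> (nat \<Rightarrow> complex) \<Rightarrow> nat \<Rightarrow> complex" where
  "tail r i s = (\<lambda>k\<in>{1..r - i}. s (i + k))"

text \<open>The value at \<open>0\<close> is irrelevant; \<open>1\<close> makes \<open>zt z 1 = mz z\<close> hold when \<open>z 1 = 1\<close>.\<close>

definition zt :: "(nat \<Rightarrow> complex) \<Rightarrow> nat \<Rightarrow> nat \<Rightarrow> complex" where
  "zt z i k = (if k = 0 then 1 else z (i + k))"

text \<open>For the j-th index with trivial partial product this is j. It accumulates the shifts by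
  \<open>eps\<close>, which bounds the levels n that can be polar.\<close>

definition cnt :: "(nat \<Rightarrow> complex) \<Rightarrow> nat \<Rightarrow> nat" where
  "cnt z i = card {k\<in>{1..i}. (\<Prod>l=1..k. z l) = 1}"

text \<open>Row \<open>0\<close> of the matrix product of the statement, in the recursive form in which the
  residues produce it.\<close>

primrec C_row :: "nat \<Rightarrow> nat \<Rightarrow> (nat \<Rightarrow> complex) \<Rightarrow> (nat \<Rightarrow> complex) \<Rightarrow> nat \<Rightarrow> complex" where
  "C_row 0 r z s d = (if d = 0 then 1 else 0)"
| "C_row (Suc j) r z s d =
     (\<Sum>k\<le>d. ct (z 1) k (s 1) / rho (z 1) (s 1) * C_row j (r - 1) (mz z) (ms (r - 1) z k s) (d - k))"

lemma cnt_mz: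
  assumes "i \<ge> 1"
  shows "cnt z i = eps (z 1) + cnt (mz z) (i - 1)"
proof -
  have "{k\<in>{1..i}. (\<Prod>l=1..k. z l) = 1} =
      (if z 1 = 1 then {1} else {}) \<union> Suc ` {k\<in>{1..i-1}. (\<Prod>l=1..k. mz z l) = 1}" (is "?A = ?B")
  proof (rule set_eqI)
    fix k
    show "k \<in> ?A \<longleftrightarrow> k \<in> ?B"
    proof (cases "k \<le> 1")
      case True
      then have "k = 0 \<or> k = 1" by linarith
      then show ?thesis using assms by auto
    next
      case False
      then obtain l where l: "k = Suc l" "l \<ge> 1" by (cases k) auto
      have "k \<in> ?A \<longleftrightarrow> l \<le> i - 1 \<and> (\<Prod>j=1..l. mz z j) = 1"
        using l prod_mz[OF l(2), of z] by auto
      then show ?thesis using l by auto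
    qed
  qed
  moreover have "(if z 1 = 1 then {1} else {}) \<inter> Suc ` {k\<in>{1..i-1}. (\<Prod>l=1..k. mz z l) = 1} = {}"
    by auto
  ultimately show ?thesis
    by (simp add: cnt_def card_Un_disjoint card_image eps_def)
qed

lemma ecoef_1_0: "ecoef 1 0 = 1"
  using ecoef_recursion[of 1 1] by (simp add: eps_def)

lemma ct_at_1: "ct 1 k 1 = (if k = 0 then 1 else 0)"
  by (cases k) (simp_all add: ct_def eps_def ecoef_1_0 pochhammer_rec)

text \<open>At s = 1 both \<open>rho\<close> and all coefficients with k > 0 vanish. What remains is
  the difference of the zeroth powers of m and m - 1, nonzero only for m = 1 because 0 powr 0 =
  0.\<close>

lemma kern_at_1:
  assumes "N \<ge> 1" "m \<ge> 1"
  shows "kern 1 N 1 m = (if m = 1 then 1 else 0)"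
proof -
  have "(\<Sum>k<N. ct 1 k 1 * (of_nat (m - 1) powr (- of_nat k) - of_nat m powr (- of_nat k))) =
      (\<Sum>k\<in>{0}. ct 1 k 1 * (of_nat (m - 1) powr (- of_nat k) - of_nat m powr (- of_nat k) :: complex))"
    using assms by (intro sum.mono_neutral_right) (auto simp: ct_at_1)
  then show ?thesis
    using assms by (auto simp: kern_def rho_def eps_def ct_at_1)
qed

text \<open>Only tuples with n_1 = 1 contribute, and these have length 1. For q = 0 this is the
  residue 1 of the zeta function.\<close>

lemma rem_at_1:
  assumes z: "admissible (Suc q) z" "z 1 = 1" and p: "p \<in> shifted_dom (Suc q) N" "p 1 = 1" and N: "N \<ge> 1"
  shows "rem (Suc q) z N p = (if q = 0 then 1 else 0)"
proof (cases "q = 0")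
  case False
  have "rem (Suc q) z N p = (\<Sum>\<^sub>\<infinity>n\<in>decr_tuples (Suc q). 0)"
    unfolding rem_def z p
  proof (rule infsum_cong)
    fix n assume n: "n \<in> decr_tuples (Suc q)"
    have "n 2 \<ge> 1" "n 2 < n 1"
      using decr_tuplesD(1)[OF n, of 2] decr_tuplesD(2)[OF n, of 1 2] False by simp_all
    then show "kern 1 N 1 (n 1) * wterm {2..Suc q} z p n = 0"
      using kern_at_1[OF N, of "n 1"] by simp
  qed
  then show ?thesis using False by simp
next
  case True
  have sum: "(\<lambda>n. kern (z 1) N (p 1) (n 1) * wterm {2..Suc q} z p n) summable_on decr_tuples (Suc q)"
    by (rule rem_summable[OF _ z(1) p(1)]) simp
  have "rem (Suc q) z N p = (\<Sum>\<^sub>\<infinity>n\<in>decr_tuples q. \<Sum>\<^sub>\<infinity>m\<in>{tuple_top q n<..}.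
      kern (z 1) N (p 1) (tuple_cons q m n 1) * wterm {2..Suc q} z p (tuple_cons q m n))"
    unfolding rem_def by (rule infsum_decr_tuples_Suc[OF sum])
  also have "\<dots> = (\<Sum>\<^sub>\<infinity>m\<in>{0<..}. kern 1 N 1 m)"
    using True by (simp add: decr_tuples_0 tuple_top_def tuple_cons_def wterm_def z(2)[simplified] p(2)[simplified])
  also have "\<dots> = (\<Sum>\<^sub>\<infinity>m\<in>{1::nat}. 1 :: complex)"
    using kern_at_1[OF N] by (intro infsum_cong_neutral) (auto simp: Suc_le_eq)
  finally show ?thesis using True by simp
qed

lemma regular_gen_inverse:
  assumes h: "holo_on r h (topspace (Cpow r))" and p: "p \<in> topspace (Cpow r)" "h p \<noteq> 0"
  shows "regular_gen r (\<lambda>s. inverse (h s)) p (inverse (h p))"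
proof -
  have "cmod (h p) > 0" using p by simp
  from holo_on_continuousD[OF h p(1) this] obtain d where d: "d > 0"
    "\<forall>s\<in>pdisc r p d. cmod (h s - h p) < cmod (h p)" by blast
  have "h s \<noteq> 0" if "s \<in> pdisc r p d" for s
    using d(2) that by (force simp: norm_minus_commute)
  then have "holo_on r (\<lambda>s. 1 / h s) (pdisc r p d)"
    by (intro holo_on_divide holo_on_const openin_pdisc holo_on_subset[OF h openin_pdisc pdisc_subset])
  then show ?thesis
    by (intro regular_genI[OF d(1), where g = "\<lambda>s. 1 / h s"]) (simp_all add: inverse_eq_divide)
qed

lemma regular_gen_entire:
  assumes "r \<ge> 1" "p \<in> topspace (Cpow r)" "\<And>w. h field_differentiable at w"
  shows "regular_gen r (\<lambda>s. h (s 1)) p (h (p 1))"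
  using regular_gen_holo[OF holo_on_compose_entire[OF holo_on_coord[of r "topspace (Cpow r)" 1] assms(3)] assms(2)] assms(1)
  by simp

lemma regular_gen_psum_minus:
  assumes "i \<le> r" "p \<in> topspace (Cpow r)"
  shows "regular_gen r (\<lambda>s. psum s i - c) p (psum p i - c)"
  using regular_gen_holo[OF holo_on_diff[OF holo_on_psum[of r "topspace (Cpow r)" i] holo_on_const] assms(2)] assms(1)
  by simp

lemma ms_HGen:
  assumes p: "p \<in> HGen (Suc q) (Suc j)"
  shows "ms q z k p \<in> HGen q j"
  unfolding HGen_def
proof (intro CollectI conjI ms_topspace ballI)
  fix i assume i: "i \<in> {1..q} - {j}"
  then have "Suc i \<in> {1..Suc q} - {Suc j}" by auto
  then have "Im (psum p (Suc i)) \<noteq> 0" using p unfolding HGen_def by blast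
  then show "Im (psum (ms q z k p) i) \<noteq> 0" using i by (subst psum_ms) auto
qed

lemma ms_HGen_1: "p \<in> HGen (Suc q) 1 \<Longrightarrow> ms q z k p \<in> gen q"
  using ms_HGen[of p q 0] by simp

lemma regular_gen_Z: "admissible r z \<Longrightarrow> p \<in> gen r \<Longrightarrow> regular_gen r (Z r z) p (Z r z p)"
  by (rule regular_gen_holo[OF holo_on_Z])

lemma regular_gen_G:
  assumes z: "admissible (Suc q) z" and p: "p \<in> HGen (Suc q) 1" "p \<in> shifted_dom (Suc q) N"
  shows "regular_gen (Suc q) (G q z N) p (G q z N p)"
  unfolding G_def[abs_def]
proof (intro regular_gen_add regular_gen_sum)
  show pt: "p \<in> topspace (Cpow (Suc q))" using p HGen_subset by blast
  show "regular_gen (Suc q) (rem (Suc q) z N) p (rem (Suc q) z N p)"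
    using regular_gen_holo[OF holo_on_rem[OF _ z] p(2)] by simp
  fix k
  have "regular_gen (Suc q) (\<lambda>s. ct (z 1) k (s 1) * Z q (mz z) (ms q z k s)) p (ct (z 1) k (p 1) * Z q (mz z) (ms q z k p))"
    by (intro regular_gen_mult regular_gen_entire[OF _ pt] field_differentiable_ct
        regular_gen_ms regular_gen_Z admissible_mz z ms_HGen_1 p) simp
  then show "regular_gen (Suc q) (\<lambda>s. if q = 0 then 0 else ct (z 1) k (s 1) * Z q (mz z) (ms q z k s)) p
     (if q = 0 then 0 else ct (z 1) k (p 1) * Z q (mz z) (ms q z k p))"
    using regular_gen_const[OF pt, of 0] by (cases "q = 0") simp_all
qed

text \<open>Only k = 0 survives, and there the merged first coordinate is 1 + s_2 - 1 = s_2, so the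
  inner arguments are the tail itself.\<close>

lemma G_at_1:
  assumes z: "admissible (Suc q) z" "z 1 = 1" and p: "p \<in> shifted_dom (Suc q) N" "p 1 = 1" and N: "N \<ge> 1"
  shows "G q z N p = Z q (zt z 1) (tail (Suc q) 1 p)"
proof (cases "q = 0")
  case True
  then show ?thesis using rem_at_1[OF assms] by (simp add: G_def)
next
  case False
  have "mz z = zt z 1" using z(2) by (auto simp: mz_def zt_def fun_eq_iff numeral_2_eq_2)
  moreover have "ms q z 0 p = tail (Suc q) 1 p"
  proof
    fix j
    consider "j = 1" | "j \<ge> 2" "j \<le> q" | "j = 0 \<or> j > q" using False by linarith
    then show "ms q z 0 p j = tail (Suc q) 1 p j"
    proof cases
      case 1
      then show ?thesis using ms_1[of q z 0 p] False z p by (simp add: tail_def eps_def numeral_2_eq_2)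
    next
      case 2
      then show ?thesis using ms_gt_1[of j q z 0 p] by (simp add: tail_def)
    next
      case 3
      then show ?thesis by (auto simp: ms_def aff_def tail_def)
    qed
  qed
  moreover have "(\<Sum>k<N. ct 1 k 1 * Z q (mz z) (ms q z k p)) = (\<Sum>k\<in>{0}. ct 1 k 1 * Z q (mz z) (ms q z k p))"
    using N by (intro sum.mono_neutral_right) (auto simp: ct_at_1)
  ultimately show ?thesis
    using False rem_at_1[OF assms] z p by (simp add: G_def ct_at_1)
qed

lemma zt_mz: "j \<ge> 1 \<Longrightarrow> zt (mz z) j = zt z (Suc j)"
  by (auto simp: zt_def mz_def fun_eq_iff)

lemma tail_ms: "1 \<le> j \<Longrightarrow> j \<le> q \<Longrightarrow> tail q j (ms q z k p) = tail (Suc q) (Suc j) p"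
  unfolding tail_def by (rule ext) (auto simp: restrict_def ms_gt_1)

lemma shifted_dom_large:
  assumes "p \<in> topspace (Cpow r)"
  obtains N e where "N \<ge> K" "p \<in> shifted_dom r N" "e > 0" "pdisc r p e \<subseteq> shifted_dom r N"
proof -
  obtain N where N: "p \<in> shifted_dom r N" using shifted_dom_exhausts[OF assms] by blast
  then have M: "p \<in> shifted_dom r (max N K)" using shifted_dom_mono[of N "max N K"] by auto
  then obtain e where e: "e > 0" "pdisc r p e \<subseteq> shifted_dom r (max N K)"
    using openin_shifted_dom unfolding openin_Cpow by blast
  show ?thesis by (rule that[OF _ M e]) simp
qed

text \<open>Induction on i, removing the first variable. Levels n > \<open>cnt z i\<close>, where
  the value is 0, must be included: the inner levels n + k - \<open>eps (z 1)\<close> grow with k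
  and eventually pass the bound.\<close>

lemma residue_Z:
  assumes "admissible r z" "1 \<le> i" "i \<le> r" "(\<Prod>l=1..i. z l) = 1" "p \<in> HGen r i" "psum p i = of_int n"
  shows "regular_gen r (\<lambda>s. (psum s i - of_int n) * Z r z s) p
    (if n \<le> int (cnt z i) then C_row (i - 1) r z p (nat (int (cnt z i) - n)) * Z (r - i) (zt z i) (tail r i p) else 0)"
  using assms(2,1,3-)
proof (induction i arbitrary: r z p n rule: dec_induct)
  case base
  obtain q where q: "r = Suc q" using base by (cases r) auto
  have z1: "z 1 = 1" using base by simp
  have pt: "p \<in> topspace (Cpow (Suc q))" using base HGen_subset q by blast
  have p1: "p 1 = of_int n" using base by (simp add: psum_def)
  obtain N e where N: "N \<ge> 1" "p \<in> shifted_dom (Suc q) N" "e > 0" "pdisc (Suc q) p e \<subseteq> shifted_dom (Suc q) N"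
    using shifted_dom_large[OF pt] by blast
  have adm: "admissible (Suc q) z" using base q by simp
  have G: "regular_gen (Suc q) (G q z N) p (G q z N p)"
    using base q by (intro regular_gen_G adm N) simp_all
  have cnt: "cnt z 1 = 1" using cnt_mz[of 1 z] z1 by (simp add: eps_def cnt_def)
  have Z: "Z (Suc q) z s = G q z N s / (s 1 - 1)" if "s \<in> pdisc (Suc q) p e" for s
    using Z_Suc[OF adm, of s N] that N(4) z1 by (auto simp: rho_def)
  have s1: "s 1 \<noteq> 1" if "s \<in> gen (Suc q)" for s
    using gen_coord_1[OF that] by auto
  show ?case
  proof (cases "n = 1")
    case True
    have "G q z N p = Z q (zt z 1) (tail (Suc q) 1 p)"
      using True p1 by (intro G_at_1 adm z1 N) simp
    moreover have "regular_gen (Suc q) (\<lambda>s. (psum s 1 - of_int n) * Z (Suc q) z s) p (G q z N p)"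
      by (rule regular_gen_cong[OF G N(3)]) (use True s1 Z in \<open>simp add: psum_def\<close>)
    ultimately show ?thesis using True cnt q by simp
  next
    case False
    \<comment> \<open>Away from s_1 = 1 the denominator is invertible, and the factor s_1 - n makes
      the value 0, in accordance with row 0 of the identity matrix.\<close>
    have "holo_on (Suc q) (\<lambda>s. s 1 - 1) (topspace (Cpow (Suc q)))"
      by (intro holo_on_diff holo_on_coord holo_on_const) simp_all
    moreover have "p 1 - 1 \<noteq> 0" using False p1 by (metis eq_iff_diff_eq_0 of_int_1 of_int_eq_iff)
    ultimately have "regular_gen (Suc q) (\<lambda>s. inverse (s 1 - 1)) p (inverse (p 1 - 1))"
      by (intro regular_gen_inverse pt)
    then have "regular_gen (Suc q) (\<lambda>s. (psum s 1 - of_int n) * G q z N s * inverse (s 1 - 1)) p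
        ((psum p 1 - of_int n) * G q z N p * inverse (p 1 - 1))"
      by (intro regular_gen_mult regular_gen_psum_minus pt G) simp_all
    then have "regular_gen (Suc q) (\<lambda>s. (psum s 1 - of_int n) * Z (Suc q) z s) p
        ((psum p 1 - of_int n) * G q z N p * inverse (p 1 - 1))"
      by (rule regular_gen_cong[OF _ N(3)]) (simp add: Z divide_inverse)
    moreover have "psum p 1 - of_int n = 0" using base by simp
    ultimately show ?thesis using False cnt q by auto
  qed
next
  case (step j)
  obtain q where q: "r = Suc q" "j \<le> q" using step by (cases r) auto
  have adm: "admissible (Suc q) z" using step q by simp
  have p: "p \<in> HGen (Suc q) (Suc j)" "psum p (Suc j) = of_int n" using step q by simp_all
  have pt: "p \<in> topspace (Cpow (Suc q))" using p HGen_subset by blast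
  define J where "J = cnt z (Suc j)"
  define J' where "J' = cnt (mz z) j"
  have J: "J = eps (z 1) + J'" using cnt_mz[of "Suc j" z] by (simp add: J_def J'_def)
  \<comment> \<open>The order must exceed J - n so that the finite sum contains every k with a
    nonzero inner residue.\<close>
  obtain N e where N: "N \<ge> nat (int J - n) + 1" "p \<in> shifted_dom (Suc q) N" "e > 0" "pdisc (Suc q) p e \<subseteq> shifted_dom (Suc q) N"
    using shifted_dom_large[OF pt] by blast
  have p1: "rho (z 1) (p 1) \<noteq> 0"
  proof (rule rho_nonzero[OF disjI1])
    have "1 \<in> {1..Suc q} - {Suc j}" using step by simp
    then have "Im (psum p 1) \<noteq> 0" using p unfolding HGen_def by blast
    then show "Im (p 1) \<noteq> 0" by (simp add: psum_def)
  qed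
  \<comment> \<open>The level of the inner hyperplane met by the k-th summand.\<close>
  define nk where "nk k = n + int k - int (eps (z 1))" for k
  define T where "T = Z (q - j) (zt z (Suc j)) (tail (Suc q) (Suc j) p)"
  define v where "v k = (if nk k \<le> int J' then C_row (j - 1) q (mz z) (ms q z k p) (nat (int J' - nk k)) * T else 0)" for k
  have nk: "(of_int (nk k) :: complex) = of_int n + of_nat k - of_nat (eps (z 1))" for k
    by (simp add: nk_def)
  have reg: "regular_gen (Suc q) (\<lambda>s. (psum s (Suc j) - of_int n) * Z q (mz z) (ms q z k s)) p (v k)" for k
  proof -
    have veq: "v k = (if nk k \<le> int (cnt (mz z) j) then C_row (j - 1) q (mz z) (ms q z k p) (nat (int (cnt (mz z) j) - nk k)) *
           Z (q - j) (zt (mz z) j) (tail q j (ms q z k p)) else 0)"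
      by (simp only: v_def J'_def T_def zt_mz[OF step(1)] tail_ms[OF step(1) q(2)])
    have "regular_gen q (\<lambda>s. (psum s j - of_int (nk k)) * Z q (mz z) s) (ms q z k p) (v k)"
      unfolding veq
    proof (rule step.IH)
      show "admissible q (mz z)" by (rule admissible_mz[OF adm])
      show "j \<le> q" by (rule q)
      show "(\<Prod>l=1..j. mz z l) = 1" using step prod_mz[of j z] by simp
      show "ms q z k p \<in> HGen q j" by (rule ms_HGen[OF p(1)])
      show "psum (ms q z k p) j = of_int (nk k)"
        using step q p(2) by (simp add: psum_ms nk)
    qed
    then have "regular_gen (Suc q) (\<lambda>s. (psum (ms q z k s) j - of_int (nk k)) * Z q (mz z) (ms q z k s)) p (v k)"
      by (rule regular_gen_ms)
    then show ?thesis
      by (rule regular_gen_cong[of _ _ _ _ 1]) (use step q in \<open>simp_all add: psum_ms nk\<close>)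
  qed
  have "regular_gen (Suc q) (\<lambda>s. ((\<Sum>k<N. ct (z 1) k (s 1) * ((psum s (Suc j) - of_int n) * Z q (mz z) (ms q z k s))) +
      (psum s (Suc j) - of_int n) * rem (Suc q) z N s) * inverse (rho (z 1) (s 1))) p
      (((\<Sum>k<N. ct (z 1) k (p 1) * v k) + (psum p (Suc j) - of_int n) * rem (Suc q) z N p) * inverse (rho (z 1) (p 1)))"
  proof (intro regular_gen_mult regular_gen_add regular_gen_sum pt reg)
    show "regular_gen (Suc q) (\<lambda>s. ct (z 1) k (s 1)) p (ct (z 1) k (p 1))" for k
      by (intro regular_gen_entire[OF _ pt] field_differentiable_ct) simp
    show "regular_gen (Suc q) (\<lambda>s. psum s (Suc j) - of_int n) p (psum p (Suc j) - of_int n)"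
      using q by (intro regular_gen_psum_minus pt) simp
    show "regular_gen (Suc q) (rem (Suc q) z N) p (rem (Suc q) z N p)"
      using regular_gen_holo[OF holo_on_rem[OF _ adm] N(2)] by simp
    show "regular_gen (Suc q) (\<lambda>s. inverse (rho (z 1) (s 1))) p (inverse (rho (z 1) (p 1)))"
      by (intro regular_gen_inverse pt p1 holo_on_rho) simp_all
  qed
  then have main: "regular_gen (Suc q) (\<lambda>s. (psum s (Suc j) - of_int n) * Z (Suc q) z s) p
      (((\<Sum>k<N. ct (z 1) k (p 1) * v k) + (psum p (Suc j) - of_int n) * rem (Suc q) z N p) * inverse (rho (z 1) (p 1)))"
  proof (rule regular_gen_cong[OF _ N(3)])
    fix s assume "s \<in> pdisc (Suc q) p e"
    then have "s \<in> shifted_dom (Suc q) N" using N(4) by blast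
    moreover have "q \<noteq> 0" using q step by simp
    ultimately show "(psum s (Suc j) - of_int n) * Z (Suc q) z s =
       ((\<Sum>k<N. ct (z 1) k (s 1) * ((psum s (Suc j) - of_int n) * Z q (mz z) (ms q z k s))) +
      (psum s (Suc j) - of_int n) * rem (Suc q) z N s) * inverse (rho (z 1) (s 1))"
      by (simp add: Z_Suc[OF adm] G_def divide_inverse distrib_left sum_distrib_left mult_ac)
  qed
  have "((\<Sum>k<N. ct (z 1) k (p 1) * v k) + (psum p (Suc j) - of_int n) * rem (Suc q) z N p) * inverse (rho (z 1) (p 1)) =
     (if n \<le> int J then C_row j (Suc q) z p (nat (int J - n)) * T else 0)"
  \<comment> \<open>The remainder is regular and is multiplied by a factor vanishing at p, so only
    the inner residues remain. They are zero from k = J - n + 1 on, and the rest is the recursion of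
    \<open>C_row\<close>.\<close>
  proof (cases "n \<le> int J")
    case True
    define d where "d = nat (int J - n)"
    obtain j' where j': "j = Suc j'" using step by (cases j) auto
    have v: "v k = (if k \<le> d then C_row j' q (mz z) (ms q z k p) (d - k) * T else 0)" for k
    proof -
      have "nk k \<le> int J' \<longleftrightarrow> k \<le> d" using True by (auto simp: nk_def d_def J)
      moreover have "nat (int J' - nk k) = d - k" using True by (auto simp: nk_def d_def J)
      ultimately show ?thesis by (simp add: v_def j')
    qed
    have "(\<Sum>k<N. ct (z 1) k (p 1) * v k) = (\<Sum>k\<le>d. ct (z 1) k (p 1) * v k)"
      using N(1) by (intro sum.mono_neutral_right) (auto simp: v d_def)
    also have "\<dots> * inverse (rho (z 1) (p 1)) = C_row j (Suc q) z p d * T"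
      unfolding j' C_row.simps sum_distrib_right by (rule sum.cong) (simp_all add: v divide_inverse mult_ac)
    finally show ?thesis using True p(2) by (simp add: d_def)
  next
    case False
    then have "v k = 0" for k by (simp add: v_def nk_def J)
    then show ?thesis using False p(2) by simp
  qed
  from main[unfolded this] show ?case
    unfolding q(1) diff_Suc_Suc diff_Suc_1 J_def T_def .
qed

text \<open>The only denominators are \<open>rho\<close> factors at earlier partial sums shifted by
  integers, which are nonreal at p.\<close>

lemma regular_gen_C_row:
  assumes "j < r" "p \<in> topspace (Cpow r)" "\<And>k. k \<in> {1..j} \<Longrightarrow> Im (psum p k) \<noteq> 0"
  shows "regular_gen r (\<lambda>s. C_row j r z s d) p (C_row j r z p d)"
  using assms
proof (induction j arbitrary: r z p d)
  case 0
  then show ?case by (simp add: regular_gen_const)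
next
  case (Suc j)
  obtain q where q: "r = Suc q" using Suc by (cases r) auto
  have p1: "Im (p 1) \<noteq> 0" using Suc.prems(3)[of 1] by (simp add: psum_def)
  have "regular_gen r (\<lambda>s. \<Sum>k\<le>d. ct (z 1) k (s 1) * inverse (rho (z 1) (s 1)) * C_row j q (mz z) (ms q z k s) (d - k)) p
      (\<Sum>k\<le>d. ct (z 1) k (p 1) * inverse (rho (z 1) (p 1)) * C_row j q (mz z) (ms q z k p) (d - k))"
  proof (intro regular_gen_sum regular_gen_mult Suc.prems(2))
    fix k
    show "regular_gen r (\<lambda>s. ct (z 1) k (s 1)) p (ct (z 1) k (p 1))"
      using q by (intro regular_gen_entire field_differentiable_ct Suc.prems) simp
    show "regular_gen r (\<lambda>s. inverse (rho (z 1) (s 1))) p (inverse (rho (z 1) (p 1)))"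
      using q by (intro regular_gen_inverse Suc.prems rho_nonzero[OF disjI1[OF p1]] holo_on_rho) simp_all
    show "regular_gen r (\<lambda>s. C_row j q (mz z) (ms q z k s) (d - k)) p (C_row j q (mz z) (ms q z k p) (d - k))"
      unfolding q
    proof (rule regular_gen_ms, rule Suc.IH)
      show "j < q" using Suc.prems q by simp
      show "Im (psum (ms q z k p) l) \<noteq> 0" if "l \<in> {1..j}" for l
        using Suc.prems(3)[of "Suc l"] that Suc.prems(1) q by (simp add: psum_ms)
    qed (rule ms_topspace)
  qed
  then show ?case using q by (simp add: divide_inverse)
qed

lemma tail_topspace: "tail r i s \<in> topspace (Cpow (r - i))"
  by (auto simp: tail_def topspace_Cpow)

lemma psum_tail: "k \<le> r - i \<Longrightarrow> psum (tail r i s) k = psum s (i + k) - psum s i"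
  by (induction k) (simp_all add: psum_def tail_def)

text \<open>Subtracting the real number \<open>psum p i\<close> does not change the imaginary parts
  of the later partial sums.\<close>

lemma tail_HGen:
  assumes "p \<in> HGen r i" "Im (psum p i) = 0" "i \<ge> 1"
  shows "tail r i p \<in> gen (r - i)"
  unfolding gen_iff
proof (intro conjI tail_topspace ballI)
  fix k assume k: "k \<in> {1..r - i}"
  then have "i + k \<in> {1..r} - {i}" by auto
  then have "Im (psum p (i + k)) \<noteq> 0" using assms unfolding HGen_def by blast
  then show "Im (psum (tail r i p) k) \<noteq> 0" using k assms by (simp add: psum_tail)
qed

text \<open>Truncated subtraction sends the coordinates up to i to index 0, where \<open>aff\<close>
  drops them.\<close>

lemma tail_eq_aff: "tail r i = aff r (r - i) (\<lambda>k. k - i) (\<lambda>_. 0)"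
proof (rule ext, rule ext)
  fix s j
  have "{l\<in>{1..r}. l - i = j} = {i + j}" if "j \<in> {1..r - i}" using that by auto
  then show "tail r i s j = aff r (r - i) (\<lambda>k. k - i) (\<lambda>_. 0) s j"
    by (simp add: tail_def aff_def restrict_def)
qed

text \<open>The tail of a generic point can fail to be generic, since imaginary parts of two partial
  sums may coincide, so \<open>regular_gen_aff\<close> does not apply. Holomorphy of
  \<open>Z\<close> near the given tail is used directly.\<close>

lemma regular_gen_tail:
  assumes z: "admissible (r - i) z" and p: "tail r i p \<in> gen (r - i)"
  shows "regular_gen r (\<lambda>s. Z (r - i) z (tail r i s)) p (Z (r - i) z (tail r i p))"
proof -
  obtain e where e: "e > 0" "pdisc (r - i) (tail r i p) e \<subseteq> gen (r - i)"
    using openin_HGen[of "r - i" 0] p unfolding openin_Cpow by blast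
  have "holo_on r (\<lambda>s. Z (r - i) z (tail r i s)) (pdisc r p (e / (1 + real r)))"
    unfolding tail_eq_aff
  proof (rule holo_on_aff[OF holo_on_Z[OF z] openin_pdisc])
    fix s assume "s \<in> pdisc r p (e / (1 + real r))"
    from aff_pdisc[OF this e(1), of "r - i" "\<lambda>k. k - i" "\<lambda>_. 0"] e(2)
    show "aff r (r - i) (\<lambda>k. k - i) (\<lambda>_. 0) s \<in> gen (r - i)" unfolding tail_eq_aff by blast
  qed
  then show ?thesis by (rule regular_genI[rotated]) (use e(1) in simp_all)
qed

section \<open>The matrices\<close>

lemma ut_mult_assoc: "ut_mult (ut_mult A B) C = ut_mult A (ut_mult B C)"
proof (rule ext, rule ext)
  fix a b
  have "ut_mult (ut_mult A B) C a b = (\<Sum>k\<in>{a..b}. \<Sum>l\<in>{l\<in>{a..b}. l \<le> k}. A a l * B l k * C k b)"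
    unfolding ut_mult_def sum_distrib_right by (intro sum.cong) auto
  also have "\<dots> = (\<Sum>l\<in>{a..b}. \<Sum>k\<in>{k\<in>{a..b}. l \<le> k}. A a l * B l k * C k b)"
    using sum.swap_restrict[of "{a..b}" "{a..b}" "\<lambda>k l. A a l * B l k * C k b" "\<lambda>k l. l \<le> k"] by simp
  also have "\<dots> = ut_mult A (ut_mult B C) a b"
    unfolding ut_mult_def sum_distrib_left by (intro sum.cong) (auto simp: mult.assoc)
  finally show "ut_mult (ut_mult A B) C a b = ut_mult A (ut_mult B C) a b" .
qed

lemma ut_id_mult:
  assumes "\<And>a b. b < a \<Longrightarrow> A a b = 0"
  shows "ut_mult ut_id A = A"
proof (rule ext, rule ext)
  fix a b
  show "ut_mult ut_id A a b = A a b"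
  proof (cases "a \<le> b")
    case True
    have "ut_mult ut_id A a b = (\<Sum>k\<in>{a..b}. if a = k then A k b else 0)"
      unfolding ut_mult_def ut_id_def by (intro sum.cong) auto
    then show ?thesis using True by (simp add: sum.delta)
  qed (simp add: ut_mult_def assms)
qed

lemma ut_prod_Nil: "ut_prod M u u = ut_id"
  by (simp add: ut_prod_def)

lemma ut_prod_Cons: "u < v \<Longrightarrow> ut_prod M u v = ut_mult (M u) (ut_prod M (Suc u) v)"
  by (simp add: ut_prod_def upt_conv_Cons)

lemma ut_prod_below_diagonal: "b < a \<Longrightarrow> ut_prod M u v a b = 0"
  by (cases "[u..<v]") (auto simp: ut_prod_def ut_id_def ut_mult_def)

lemma ut_prod_append:
  assumes "u \<le> v" "v \<le> w"
  shows "ut_prod M u w = ut_mult (ut_prod M u v) (ut_prod M v w)"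
  using assms(1)
proof (induction rule: inc_induct)
  case base
  then show ?case by (simp add: ut_prod_Nil ut_id_mult ut_prod_below_diagonal)
next
  case (step u)
  then show ?case using assms(2) by (simp add: ut_prod_Cons ut_mult_assoc)
qed

lemma ut_mult_ut_id_right:
  assumes "\<And>a b. b < a \<Longrightarrow> A a b = 0"
  shows "ut_mult A ut_id = A"
proof (rule ext, rule ext)
  fix a b
  show "ut_mult A ut_id a b = A a b"
  proof (cases "a \<le> b")
    case True
    have "ut_mult A ut_id a b = (\<Sum>k\<in>{a..b}. if k = b then A a k else 0)"
      unfolding ut_mult_def ut_id_def by (intro sum.cong) auto
    then show ?thesis using True by (simp add: sum.delta)
  qed (simp add: ut_mult_def assms)
qed

lemma ut_prod_cong:
  assumes "\<And>i. u \<le> i \<Longrightarrow> i < v \<Longrightarrow> M i = M' i"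
  shows "ut_prod M u v = ut_prod M' u v"
proof -
  have "map M [u..<v] = map M' [u..<v]" using assms by simp
  then show ?thesis by (simp only: ut_prod_def)
qed

text \<open>Translating the parameters of all factors by k amounts to moving k rows down and k
  columns right, and this passes to products.\<close>

lemma ut_prod_shift:
  assumes "u \<le> v" "\<And>i a c. u \<le> i \<Longrightarrow> i < v \<Longrightarrow> M' i a c = M (Suc i) (a + k) (c + k)"
  shows "ut_prod M' u v a c = ut_prod M (Suc u) (Suc v) (a + k) (c + k)"
  using assms
proof (induction arbitrary: a c rule: inc_induct)
  case base
  then show ?case by (simp add: ut_prod_Nil ut_id_def)
next
  case (step u)
  have "ut_prod M' u v a c = (\<Sum>l=a..c. M (Suc u) (a + k) (l + k) * ut_prod M (Suc (Suc u)) (Suc v) (l + k) (c + k))"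
    using step by (simp add: ut_prod_Cons ut_mult_def)
  also have "\<dots> = (\<Sum>l=a+k..c+k. M (Suc u) (a + k) l * ut_prod M (Suc (Suc u)) (Suc v) l (c + k))"
    by (rule sum.shift_bounds_cl_nat_ivl[symmetric])
  finally show ?case using step by (simp add: ut_prod_Cons ut_mult_def)
qed

text \<open>A common form of B_1 and g(1) B_2. The row enters only through b + a, so a shift of the
  argument is a shift along the diagonal, which \<open>ut_prod_shift\<close> exploits.\<close>

definition coef_mat :: "complex \<Rightarrow> complex \<Rightarrow> cmat" where
  "coef_mat x b a c = (if c < a then 0 else ct x (c - a) (b + of_nat a) / rho x (b + of_nat a))"

lemma cnt_0: "cnt z 0 = 0"
proof -
  have "{k\<in>{1..0}. (\<Prod>l=1..k. z l) = 1} = {}" by auto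
  then show ?thesis unfolding cnt_def by (simp only: card.empty)
qed

text \<open>The summation index k of \<open>C_row\<close> is the column reached in the first factor.
  The remaining recursion, with its arguments shifted by k, is the product of the remaining factors
  started at row k.\<close>

lemma C_row_eq_ut_prod:
  assumes "j < r"
  shows "C_row j r z s d = ut_prod (\<lambda>i. coef_mat (\<Prod>l=1..i. z l) (psum s i - of_nat (cnt z (i - 1)))) 1 (Suc j) 0 d"
  using assms
proof (induction j arbitrary: r z s d)
  case 0
  then show ?case by (simp add: ut_prod_Nil ut_id_def)
next
  case (Suc j)
  obtain q where q: "r = Suc q" "j < q" using Suc by (cases r) auto
  define M where "M = (\<lambda>i. coef_mat (\<Prod>l=1..i. z l) (psum s i - of_nat (cnt z (i - 1))))"
  have "ut_prod M (Suc 1) (Suc (Suc j)) k d = C_row j q (mz z) (ms q z k s) (d - k)" if k: "k \<le> d" for k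
  proof -
    define M' where "M' = (\<lambda>i. coef_mat (\<Prod>l=1..i. mz z l) (psum (ms q z k s) i - of_nat (cnt (mz z) (i - 1))))"
    have "M' i a c = M (Suc i) (a + k) (c + k)" if i: "1 \<le> i" "i < Suc j" for i a c
    proof -
      have "psum (ms q z k s) i - of_nat (cnt (mz z) (i - 1)) = psum s (Suc i) - of_nat (cnt z (Suc i - 1)) + of_nat k"
        using i q cnt_mz[OF i(1), of z] by (simp add: psum_ms)
      then have e: "psum (ms q z k s) i - of_nat (cnt (mz z) (i - 1)) + of_nat a =
          psum s (Suc i) - of_nat (cnt z (Suc i - 1)) + of_nat (a + k)"
        by simp
      show ?thesis
        unfolding M'_def M_def coef_mat_def e prod_mz[OF i(1)] by simp
    qed
    then have "ut_prod M' 1 (Suc j) 0 (d - k) = ut_prod M (Suc 1) (Suc (Suc j)) (0 + k) (d - k + k)"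
      by (intro ut_prod_shift) simp_all
    then show ?thesis using k Suc.IH[OF q(2), of "mz z" "ms q z k s" "d - k"] by (simp add: M'_def)
  qed
  moreover have "M 1 0 k = ct (z 1) k (s 1) / rho (z 1) (s 1)" for k
    by (simp add: M_def coef_mat_def psum_def cnt_0)
  ultimately have "ut_prod M 1 (Suc (Suc j)) 0 d = C_row (Suc j) r z s d"
    by (simp add: ut_prod_Cons ut_mult_def q atLeast0AtMost)
  then show ?case by (simp add: M_def)
qed

lemma pochhammer_conv_prod: "pochhammer a n = (\<Prod>l<n. a + of_nat l)"
  by (simp add: pochhammer_prod atLeast0LessThan)

text \<open>Nonreal t makes t + a nonzero, so the first pochhammer factor cancels against
  \<open>rho\<close>; hence the products in B_1 start at l = 1.\<close>

lemma coef_mat_B1: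
  assumes "Im t \<noteq> 0"
  shows "coef_mat 1 (t + 1) = B1_mat t"
proof (rule ext, rule ext)
  fix a b
  have t: "t + of_nat a \<noteq> 0"
  proof
    assume "t + of_nat a = 0"
    then have "Im (t + of_nat a) = 0" by simp
    then show False using assms by simp
  qed
  consider "b < a" | "b = a" | n where "b = a + Suc n" using less_iff_Suc_add[of a b] by force
  then show "coef_mat 1 (t + 1) a b = B1_mat t a b"
  proof cases
    case 3
    have "pochhammer (t + of_nat a) (Suc n) = (t + of_nat a) * (\<Prod>l=1..<Suc n. t + of_nat a + of_nat l)"
      unfolding pochhammer_prod by (subst prod.atLeast_Suc_lessThan) simp_all
    then show ?thesis
      using 3 t by (simp add: coef_mat_def B1_mat_def ct_def rho_def eps_def ecoef_def add_ac del: prod.op_ivl_Suc)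
  qed (simp_all add: coef_mat_def B1_mat_def ct_def rho_def eps_def ecoef_1_0 add_ac)
qed

lemma coef_mat_B2:
  assumes "g 1 \<noteq> 1"
  shows "coef_mat (g 1) t = mat_scale (g 1) (B2_mat g t)"
  by (rule ext, rule ext)
    (simp add: coef_mat_def mat_scale_def B2_mat_def ct_def rho_def eps_def ecoef_def assms pochhammer_conv_prod)

text \<open>The uniform product over i = 1, ..., idx j - 1 is cut at the indices with trivial
  partial product. Each of these contributes a B_1 factor, the others B_2 factors, and
  \<open>cnt\<close> supplies the subtracted integers.\<close>

lemma C_mat_eq_C_row:
  assumes z: "\<And>i. i \<in> {1..r} \<Longrightarrow> z i = f i 1"
    and mono: "strict_mono_on {1..m} idx"
    and img: "idx ` {1..m} = {i \<in> {1..r}. partial_prod f i 1 = 1}"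
    and j: "j \<in> {1..m}" and im: "\<And>k. 1 \<le> k \<Longrightarrow> k < idx j \<Longrightarrow> Im (psum s k) \<noteq> 0"
  shows "C_mat f idx j s 0 d = C_row (idx j - 1) r z s d" "cnt z (idx j) = j"
proof -
  let ?g = "partial_prod f"
  have idx_r: "1 \<le> idx k" "idx k \<le> r" "?g (idx k) 1 = 1" if "k \<in> {1..m}" for k
    using img that by auto
  have less: "idx k < idx l \<longleftrightarrow> k < l" if "k \<in> {1..m}" "l \<in> {1..m}" for k l
    using strict_mono_on_less[OF mono that] .
  have g: "?g i 1 = (\<Prod>l=1..i. z l)" if "i \<le> r" for i
    unfolding partial_prod_def using z that by (intro prod.cong) auto
  have cnt: "cnt z l = card {k\<in>{1..m}. idx k \<le> l}" if "l \<le> r" for l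
  proof -
    have "{k\<in>{1..l}. (\<Prod>i=1..k. z i) = 1} = {i \<in> {1..r}. ?g i 1 = 1} \<inter> {..l}"
      using that g by auto
    also have "\<dots> = idx ` {k\<in>{1..m}. idx k \<le> l}"
      unfolding img[symmetric] by auto
    finally show ?thesis
      unfolding cnt_def
      by (simp only:, intro card_image inj_on_subset[OF strict_mono_on_imp_inj_on[OF mono]]) auto
  qed
  have cnt_at: "cnt z (idx k - 1) = k - 1" if k: "k \<in> {1..m}" for k
  proof -
    have "{l\<in>{1..m}. idx l \<le> idx k - 1} = {1..k - 1}"
    proof (rule set_eqI)
      fix l
      have "l \<in> {1..m} \<Longrightarrow> idx l \<le> idx k - 1 \<longleftrightarrow> l < k"
        using less[of l k] k idx_r(1)[OF k] by auto
      then show "l \<in> {l\<in>{1..m}. idx l \<le> idx k - 1} \<longleftrightarrow> l \<in> {1..k - 1}" using k by auto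
    qed
    then show ?thesis using idx_r[OF k] by (subst cnt) simp_all
  qed
  \<comment> \<open>k = 0 stands for the block before \<open>idx 1\<close>; \<open>idx 0\<close>
    carries no information, hence the disjunction.\<close>
  have cnt_between: "cnt z (i - 1) = k" "?g i 1 \<noteq> 1"
    if k: "k + 1 \<in> {1..m}" "k = 0 \<or> idx k < i" "1 \<le> i" "i < idx (k + 1)" for i k
  proof -
    have between: "idx l < i \<longleftrightarrow> l \<le> k" "idx l \<noteq> i" if l: "l \<in> {1..m}" for l
    proof -
      consider "l \<le> k" "k \<ge> 1" | "l \<ge> k + 1" using l by force
      then have "if l \<le> k then idx l < i else i < idx l"
      proof cases
        case 1
        then have "k \<in> {1..m}" using k by auto
        then have "idx l \<le> idx k" using less[of k l] l 1 by auto
        then show ?thesis using 1 k by auto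
      next
        case 2
        then have "idx (k + 1) \<le> idx l" using less[of l "k + 1"] l k by force
        then show ?thesis using 2 k by auto
      qed
      then show "idx l < i \<longleftrightarrow> l \<le> k" "idx l \<noteq> i" by (auto split: if_splits)
    qed
    have ir: "i \<le> r" using k idx_r(2)[of "k + 1"] by auto
    have "{l\<in>{1..m}. idx l \<le> i - 1} = {1..k}"
    proof (rule set_eqI)
      fix l
      have "l \<in> {1..m} \<Longrightarrow> idx l \<le> i - 1 \<longleftrightarrow> l \<le> k" using between(1)[of l] k by auto
      then show "l \<in> {l\<in>{1..m}. idx l \<le> i - 1} \<longleftrightarrow> l \<in> {1..k}" using k by auto
    qed
    then show "cnt z (i - 1) = k" using ir by (subst cnt) simp_all
    show "?g i 1 \<noteq> 1"
    proof
      assume "?g i 1 = 1"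
      then have "i \<in> idx ` {1..m}" unfolding img using ir k by simp
      then show False using between(2) by blast
    qed
  qed
  define M where "M = (\<lambda>i. coef_mat (\<Prod>l=1..i. z l) (psum s i - of_nat (cnt z (i - 1))))"
  define B where "B = (\<lambda>k. ut_mult (B1_mat (psum s (idx k) - of_nat k))
      (ut_prod (\<lambda>i. mat_scale (?g i 1) (B2_mat (?g i) (psum s i - of_nat k))) (idx k + 1) (idx (k + 1))))"
  have M_between: "M i = mat_scale (?g i 1) (B2_mat (?g i) (psum s i - of_nat k))"
    if "k + 1 \<in> {1..m}" "k = 0 \<or> idx k < i" "1 \<le> i" "i < idx (k + 1)" for i k
  proof -
    have "i \<le> r" using that(4) idx_r(2)[OF that(1)] by simp
    then show ?thesis
      unfolding M_def coef_mat_B2[of "?g i", OF cnt_between(2)[OF that], symmetric] cnt_between(1)[OF that]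
      by (simp only: g)
  qed
  have blk: "B k = ut_prod M (idx k) (idx (k + 1))" if k: "1 \<le> k" "k < j" for k
  proof -
    have k1: "k \<in> {1..m}" "k + 1 \<in> {1..m}" using k j by auto
    have lt: "idx k < idx (k + 1)" "idx k < idx j" using less[of k "k + 1"] less[of k j] k1 k j by auto
    \<comment> \<open>Just before \<open>idx k\<close> only k - 1 trivial products have been
      counted; the missing unit is the offset of \<open>coef_mat_B1\<close>.\<close>
    have e: "psum s (idx k) - of_nat (k - 1) = (psum s (idx k) - of_nat k) + 1"
      using k by (simp add: of_nat_diff)
    have "Im (psum s (idx k) - of_nat k) \<noteq> 0" using im[OF idx_r(1)[OF k1(1)] lt(2)] by simp
    then have "coef_mat 1 (psum s (idx k) - of_nat k + 1) = B1_mat (psum s (idx k) - of_nat k)" by (rule coef_mat_B1)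
    moreover have "(\<Prod>l=1..idx k. z l) = 1" using g[OF idx_r(2)[OF k1(1)]] idx_r(3)[OF k1(1)] by simp
    ultimately have "M (idx k) = B1_mat (psum s (idx k) - of_nat k)"
      by (simp only: M_def cnt_at[OF k1(1)] e)
    moreover have "ut_prod (\<lambda>i. mat_scale (?g i 1) (B2_mat (?g i) (psum s i - of_nat k))) (idx k + 1) (idx (k + 1)) =
        ut_prod M (idx k + 1) (idx (k + 1))"
      by (rule ut_prod_cong) (rule M_between[OF k1(2), symmetric], auto)
    ultimately show ?thesis using lt(1) by (simp add: B_def ut_prod_Cons)
  qed
  have blocks: "1 \<le> l \<Longrightarrow> l \<le> j \<Longrightarrow> ut_prod B 1 l = ut_prod M (idx 1) (idx l)" for l
  proof (induction l rule: dec_induct)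
    case base
    then show ?case by (simp add: ut_prod_Nil)
  next
    case (step l)
    have l: "1 \<in> {1..m}" "l \<in> {1..m}" "Suc l \<in> {1..m}" using step j by auto
    have "ut_prod B 1 (Suc l) = ut_mult (ut_prod B 1 l) (ut_mult (B l) ut_id)"
      using step by (subst ut_prod_append[of 1 l "Suc l"]) (simp_all add: ut_prod_Cons ut_prod_Nil)
    also have "ut_mult (B l) ut_id = B l"
      by (rule ut_mult_ut_id_right) (simp add: B_def ut_mult_def)
    also have "ut_mult (ut_prod B 1 l) (B l) = ut_mult (ut_prod M (idx 1) (idx l)) (ut_prod M (idx l) (idx (Suc l)))"
      using step blk[of l] by simp
    also have "\<dots> = ut_prod M (idx 1) (idx (Suc l))"
      using less[of l 1] less[of "Suc l" l] l step(1) by (intro ut_prod_append[symmetric]) auto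
    finally show ?case .
  qed
  have one: "0 + 1 \<in> {1..m}" "1 \<in> {1..m}" using j by auto
  have "ut_prod (\<lambda>i. mat_scale (?g i 1) (B2_mat (?g i) (psum s i))) 1 (idx 1) = ut_prod M 1 (idx 1)"
  proof (rule ut_prod_cong)
    fix i assume "1 \<le> i" "i < idx 1"
    then show "mat_scale (?g i 1) (B2_mat (?g i) (psum s i)) = M i"
      using M_between[OF one(1), of i] by simp
  qed
  then have "C_mat f idx j s = ut_mult (ut_prod M 1 (idx 1)) (ut_prod B 1 j)"
    by (simp add: C_mat_def B_def Let_def)
  also have "\<dots> = ut_mult (ut_prod M 1 (idx 1)) (ut_prod M (idx 1) (idx j))"
    using blocks[of j] j by simp
  also have "\<dots> = ut_prod M 1 (idx j)"
    using idx_r(1)[OF one(2)] less[of j 1] j one(2) by (intro ut_prod_append[symmetric]) auto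
  finally have "C_mat f idx j s 0 d = ut_prod M 1 (Suc (idx j - 1)) 0 d"
    using idx_r(1)[OF j] by simp
  then show "C_mat f idx j s 0 d = C_row (idx j - 1) r z s d"
    using idx_r[OF j] by (subst C_row_eq_ut_prod) (simp_all add: M_def)
  have "{l\<in>{1..m}. idx l \<le> idx j} = {1..j}"
    using less[OF j] j by (auto simp flip: not_less)
  then show "cnt z (idx j) = j" using idx_r[OF j] by (subst cnt) simp_all
qed

section \<open>The continued series does not vanish identically\<close>

lemma decr_tuples_ge:
  assumes n: "n \<in> decr_tuples r"
  shows "k < r \<Longrightarrow> n (r - k) \<ge> k + 1"
proof (induction k)
  case 0
  then show ?case using decr_tuplesD(1)[OF n, of r] by simp
next
  case (Suc k)
  have "n (r - k) < n (r - Suc k)" using Suc.prems by (intro decr_tuplesD(2)[OF n]) auto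
  then show ?case using Suc by simp
qed

text \<open>With all arguments equal to 2 + N and N large, the tuple (r, ..., 2, 1) with the
  smallest product of entries dominates: every other product is larger by at least 1, being an
  integer.\<close>

lemma Lser_nonzero:
  assumes z: "admissible r z"
  obtains s where "s \<in> shifted_dom r 0" "Lser r z s \<noteq> 0"
proof -
  define n0 where "n0 = (\<lambda>i\<in>{1..r}. r + 1 - i)"
  define P where "P n = (\<Prod>i=1..r. n i)" for n :: "nat \<Rightarrow> nat"
  define s where "s N = (\<lambda>i\<in>{1..r}. complex_of_real (2 + real N))" for N
  let ?D = "decr_tuples r"
  have n0: "n0 \<in> ?D" by (auto simp: n0_def decr_tuples_def)
  have P0: "P n \<ge> P n0 + 1" if n: "n \<in> ?D - {n0}" for n
  proof -
    have ge: "n i \<ge> n0 i" if i: "i \<in> {1..r}" for i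
      using decr_tuples_ge[of n r "r - i"] n i by (simp add: n0_def)
    obtain i where i: "i \<in> {1..r}" "n i \<noteq> n0 i"
    proof -
      have "n \<in> extensional {1..r}" "n0 \<in> extensional {1..r}"
        using n n0 by (auto simp: decr_tuples_def PiE_def)
      then show ?thesis using that extensionalityI[of n "{1..r}" n0] n by blast
    qed
    then have lt: "n0 i < n i" using ge[of i] by simp
    have pos: "0 < (\<Prod>l\<in>{1..r} - {i}. n0 l)"
      by (intro prod_pos) (auto simp: n0_def)
    have "P n0 = n0 i * (\<Prod>l\<in>{1..r} - {i}. n0 l)"
      unfolding P_def by (rule prod.remove) (use i in auto)
    also have "\<dots> < n i * (\<Prod>l\<in>{1..r} - {i}. n0 l)" using lt pos by simp
    also have "\<dots> \<le> n i * (\<Prod>l\<in>{1..r} - {i}. n l)"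
      using ge by (intro mult_left_mono prod_mono) auto
    also have "\<dots> = P n" unfolding P_def by (rule prod.remove[symmetric]) (use i in auto)
    finally show ?thesis by simp
  qed
  have Pn0: "P n0 > 0" unfolding P_def by (intro prod_pos) (auto simp: n0_def)
  have sdom: "s N \<in> shifted_dom r 0" for N
  proof -
    have "Re (psum (s N) i) = real i * (2 + real N)" if "i \<le> r" for i
    proof -
      have "psum (s N) i = (\<Sum>l=1..i. complex_of_real (2 + real N))"
        unfolding psum_def using that by (intro sum.cong) (auto simp: s_def)
      then show ?thesis by simp
    qed
    moreover have "s N \<in> topspace (Cpow r)" by (auto simp: s_def topspace_Cpow)
    ultimately show ?thesis unfolding shifted_dom_def
      using mult_strict_left_mono[of 1 "2 + real N"] by auto
  qed
  have wt: "cmod (wterm {1..r} z (s N) n) = (\<Prod>i\<in>{1..r}. cmod (z i) ^ n i) * (1 / real (P n) ^ (2 + N))"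
    if n: "n \<in> ?D" for n N
  proof -
    have "(\<Prod>i\<in>{1..r}. real (n i) powr (- Re (s N i))) = (\<Prod>i\<in>{1..r}. 1 / real (n i) ^ (2 + N))"
    proof (rule prod.cong)
      fix i assume i: "i \<in> {1..r}"
      have "real (n i) > 0" using decr_tuplesD(1)[OF n i] by simp
      then have "real (n i) powr (real (2 + N)) = real (n i) ^ (2 + N)" by (rule powr_realpow)
      moreover have "Re (s N i) = real (2 + N)" using i by (simp add: s_def)
      ultimately show "real (n i) powr (- Re (s N i)) = 1 / real (n i) ^ (2 + N)"
        by (simp only: powr_minus_divide)
    qed simp
    also have "\<dots> = 1 / real (P n) ^ (2 + N)"
      unfolding P_def by (simp only: prod_dividef prod_power_distrib of_nat_prod prod.neutral_const)
    finally show ?thesis using cmod_wterm[OF n, of "{1..r}" z "s N"] by simp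
  qed
  define M where "M n = 1 / real (P n) ^ 2" for n
  have M: "M summable_on ?D"
  proof -
    have "(\<lambda>n. \<Prod>i=1..r. real (n i) powr (- (1 + 1))) summable_on ?D"
      by (rule summable_on_decr_tuples) simp
    moreover have "(\<Prod>i=1..r. real (n i) powr (- (1 + 1))) = M n" if n: "n \<in> ?D" for n
    proof -
      have "(\<Prod>i\<in>{1..r}. real (n i) powr (- (1 + 1))) = (\<Prod>i\<in>{1..r}. 1 / real (n i) ^ 2)"
      proof (rule prod.cong)
        fix i assume i: "i \<in> {1..r}"
        have "real (n i) > 0" using decr_tuplesD(1)[OF n i] by simp
        then have "real (n i) powr (real 2) = real (n i) ^ 2" by (rule powr_realpow)
        then show "real (n i) powr (- (1 + 1)) = 1 / real (n i) ^ 2"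
          by (simp add: powr_minus_divide)
      qed simp
      also have "\<dots> = M n"
        unfolding M_def P_def by (simp only: prod_dividef prod_power_distrib of_nat_prod prod.neutral_const)
      finally show ?thesis .
    qed
    ultimately show ?thesis using summable_on_cong by (metis (no_types, lifting))
  qed
  define c where "c = (\<Prod>i\<in>{1..r}. cmod (z i) ^ n0 i)"
  have c: "c > 0" unfolding c_def using z by (intro prod_pos) (auto simp: admissible_def)
  define A where "A = infsum M (?D - {n0})"
  have MD: "M summable_on (?D - {n0})" using M by (rule summable_on_subset_banach) auto
  have bound: "cmod (wterm {1..r} z (s N) n) \<le> M n * (1 / real (P n0 + 1) ^ N)" if n: "n \<in> ?D - {n0}" for n N
  proof -
    have "cmod (wterm {1..r} z (s N) n) \<le> 1 * (1 / real (P n) ^ (2 + N))"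
    proof -
      have nD: "n \<in> ?D" using n by blast
      show ?thesis unfolding wt[OF nD] by (intro mult_right_mono prod_power_le[OF nD z]) simp
    qed
    also have "\<dots> = M n * (1 / real (P n) ^ N)" by (simp only: M_def power_add) simp
    also have "\<dots> \<le> M n * (1 / real (P n0 + 1) ^ N)"
    proof (intro mult_left_mono divide_left_mono power_mono)
      show "real (P n0 + 1) \<le> real (P n)" using P0[OF n] by simp
      then have "0 < real (P n)" by simp
      then show "0 < real (P n) ^ N * real (P n0 + 1) ^ N" by simp
    qed (simp_all add: M_def)
    finally show ?thesis .
  qed
  have "\<exists>N. Lser r z (s N) \<noteq> 0"
  proof (rule ccontr)
    assume "\<nexists>N. Lser r z (s N) \<noteq> 0"
    then have L0: "Lser r z (s N) = 0" for N by simp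
    \<comment> \<open>The ratio of the decay rates. Vanishing for all N would bound a fixed positive
      number by a constant times x^N.\<close>
    define x where "x = real (P n0) / real (P n0 + 1)"
    have x: "0 < x" "x < 1" using Pn0 by (simp_all add: x_def)
    have le: "c / real (P n0) ^ 2 \<le> A * x ^ N" for N
    proof -
      let ?w = "wterm {1..r} z (s N)"
      have sw: "?w summable_on (?D - {n0})"
        by (rule summable_on_dominated[OF summable_on_cmult_left[OF MD] bound])
      have "infsum ?w ({n0} \<union> (?D - {n0})) = infsum ?w {n0} + infsum ?w (?D - {n0})"
        by (rule infsum_Un_disjoint) (use sw in auto)
      moreover have "{n0} \<union> (?D - {n0}) = ?D" using n0 by blast
      ultimately have "?w n0 = - infsum ?w (?D - {n0})"
        using L0[of N] by (simp add: Lser_def add_eq_0_iff)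
      then have "cmod (?w n0) = cmod (infsum ?w (?D - {n0}))" by simp
      also have "\<dots> \<le> infsum (\<lambda>n. M n * (1 / real (P n0 + 1) ^ N)) (?D - {n0})"
        by (rule norm_infsum_le[OF has_sum_infsum[OF sw] has_sum_infsum[OF summable_on_cmult_left[OF MD]] bound])
      also have "\<dots> = A * (1 / real (P n0 + 1) ^ N)"
        unfolding A_def by (rule infsum_cmult_left')
      finally have "c * (1 / real (P n0) ^ (2 + N)) \<le> A * (1 / real (P n0 + 1) ^ N)"
        unfolding wt[OF n0] c_def .
      then have "c * (1 / real (P n0) ^ (2 + N)) * real (P n0) ^ N \<le> A * (1 / real (P n0 + 1) ^ N) * real (P n0) ^ N"
        by (rule mult_right_mono) simp
      moreover have "c * (1 / real (P n0) ^ (2 + N)) * real (P n0) ^ N = c / real (P n0) ^ 2"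
        using Pn0 by (simp add: power_add power2_eq_square)
      moreover have "A * (1 / real (P n0 + 1) ^ N) * real (P n0) ^ N = A * x ^ N"
        by (simp add: x_def power_divide)
      ultimately show ?thesis by simp
    qed
    have "(\<lambda>N. A * x ^ N) \<longlonglongrightarrow> A * 0"
      using x by (intro tendsto_mult tendsto_const LIMSEQ_realpow_zero) simp_all
    then have "c / real (P n0) ^ 2 \<le> A * 0"
      by (rule LIMSEQ_le_const) (use le in blast)
    moreover have "c / real (P n0) ^ 2 > 0" using c Pn0 by simp
    ultimately show False by simp
  qed
  then obtain N where "Lser r z (s N) \<noteq> 0" by blast
  with sdom show ?thesis by (rule that)
qed

text \<open>By the identity theorem a locally vanishing \<open>Z\<close> would vanish on a dense
  open set, and by continuity of \<open>rem\<close> at order 0 the convergent series would vanish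
  identically.\<close>

lemma Z_not_locally_zero:
  assumes z: "admissible r z" and W: "openin (Cpow r) W" "W \<noteq> {}"
  shows "\<exists>s\<in>W. Z r z s \<noteq> 0"
proof (rule ccontr)
  assume "\<not> (\<exists>s\<in>W. Z r z s \<noteq> 0)"
  then have Z0: "Z r z s = 0" if "s \<in> W" for s using that by blast
  obtain s where s: "s \<in> shifted_dom r 0" "Lser r z s \<noteq> 0" by (rule Lser_nonzero[OF z])
  show False
  proof (cases r)
    case 0
    then show ?thesis using W(2) Z0 by auto
  next
    case (Suc q)
    have m0: "mero r (\<lambda>_. 0)"
      by (intro mero_of_mero_gen mero_gen_regular[OF regular_gen_const])
    obtain U where U: "dense_open_in (Cpow r) U" "\<And>s. s \<in> U \<Longrightarrow> Z r z s = 0"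
      using mero_eq_on_dense[OF mero_Z[OF z] m0 W Z0] by blast
    have rem: "rem r z 0 t = rho (z 1) (t 1) * Lser r z t" for t
      using Suc by (intro rem_0) simp
    have "rem r z 0 s = 0"
    proof (rule holo_on_zero_by_density[where V = "shifted_dom r 0" and F = "rem r z 0" and p = s])
      show "holo_on r (rem r z 0) (shifted_dom r 0)" using Suc z by (intro holo_on_rem) simp_all
      fix p e assume p: "p \<in> shifted_dom r 0" and e: "(e::real) > 0"
      obtain d where d: "d > 0" "pdisc r p d \<subseteq> shifted_dom r 0"
        using openin_shifted_dom p unfolding openin_Cpow by blast
      have "p \<in> topspace (Cpow r)" using p by (simp add: shifted_dom_def)
      then have "pdisc r p (min e d) \<inter> U \<noteq> {}"
        using U(1) e d(1) unfolding dense_open_in_Cpow_topspace by simp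
      then obtain t where t: "t \<in> pdisc r p e" "t \<in> pdisc r p d" "t \<in> U" by (auto simp: pdisc_min)
      have "Lser r z t = 0" using U(2)[OF t(3)] Z_eq_Lser[of t r z] d(2) t(2) by auto
      then show "\<exists>s\<in>pdisc r p e. rem r z 0 s = 0" using t(1) rem by auto
    qed (rule s)
    moreover have "rho (z 1) (s 1) \<noteq> 0"
    proof -
      have "1 \<in> {1..r}" using Suc by simp
      then have "Re (psum s 1) + real 0 > real 1" using s(1) unfolding shifted_dom_def by blast
      then show ?thesis by (intro rho_nonzero) (simp add: psum_def)
    qed
    ultimately show False using rem s(2) by simp
  qed
qed

section \<open>The function \<open>L\<close>\<close>

definition characters :: "nat \<Rightarrow> (nat \<Rightarrow> int \<Rightarrow> complex) \<Rightarrow> (nat \<Rightarrow> complex) \<Rightarrow> bool" where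
  "characters r f z \<longleftrightarrow> admissible r z \<and>
     (\<forall>i\<in>{1..r}. (\<forall>a b. f i (a + b) = f i a * f i b) \<and> (\<forall>a. f i a \<noteq> 0) \<and> z i = f i 1)"

lemma character_power:
  fixes h :: "int \<Rightarrow> complex"
  assumes "\<And>a b. h (a + b) = h a * h b" "\<And>a. h a \<noteq> 0"
  shows "h (int n) = h 1 ^ n"
proof (induction n)
  case 0
  then show ?case using assms(1)[of 0 0] assms(2)[of 0] by simp
next
  case (Suc n)
  then show ?case using assms(1)[of 1 "int n"] by simp
qed

lemma L_series_eq_Lser:
  assumes "characters r f z"
  shows "L_series r f s = Lser r z s"
  unfolding L_series_def Lser_def
proof (rule infsum_cong)
  fix n
  have "f i (int (n i)) = z i ^ n i" if "i \<in> {1..r}" for i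
    using character_power[of "f i" "n i"] assms that by (simp add: characters_def)
  then show "(\<Prod>i=1..r. f i (int (n i))) * (\<Prod>i=1..r. of_nat (n i) powr - s i) = wterm {1..r} z s n"
    by (simp add: wterm_def prod.distrib)
qed

lemma conv_domain_eq: "conv_domain r = shifted_dom r 0"
  by (simp add: conv_domain_def shifted_dom_def)

text \<open>\<open>Z\<close> witnesses that a continuation exists, so the choice in \<open>L\<close>
  has the specified properties, and the identity theorem compares the two from the convergence
  domain outwards.\<close>

lemma L_eq_Z:
  assumes f: "characters r f z"
  obtains U where "mero r (L r f)" "dense_open_in (Cpow r) U" "\<And>s. s \<in> U \<Longrightarrow> L r f s = Z r z s"
proof -
  have adm: "admissible r z" using f by (simp add: characters_def)
  show ?thesis
  proof (cases "r = 0")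
    case True
    have "mero 0 (\<lambda>_. 1)"
      by (intro mero_of_mero_gen mero_gen_regular[OF regular_gen_const])
    then show ?thesis using True dense_gen[of 0] by (intro that[of "gen r"]) (simp_all add: L_def)
  next
    case False
    have ZL: "Z r z s = L_series r f s" if "s \<in> conv_domain r" for s
      using that Z_eq_Lser[of s r z] L_series_eq_Lser[OF f] by (simp add: conv_domain_eq)
    have "mero r (Z r z) \<and> (\<forall>s\<in>conv_domain r. Z r z s = L_series r f s)"
      using mero_Z[OF adm] ZL by blast
    from someI[where P = "\<lambda>F. mero r F \<and> (\<forall>s\<in>conv_domain r. F s = L_series r f s)", OF this]
    have "mero r (L r f) \<and> (\<forall>s\<in>conv_domain r. L r f s = L_series r f s)"
      using False by (simp add: L_def)
    then have L: "mero r (L r f)" "\<And>s. s \<in> conv_domain r \<Longrightarrow> L r f s = Z r z s"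
      using ZL by auto
    obtain s where s: "s \<in> shifted_dom r 0" by (rule Lser_nonzero[OF adm])
    have open_conv: "openin (Cpow r) (conv_domain r)" "conv_domain r \<noteq> {}"
      using openin_shifted_dom s by (auto simp: conv_domain_eq)
    obtain U where "dense_open_in (Cpow r) U" "\<And>s. s \<in> U \<Longrightarrow> L r f s = Z r z s"
      using mero_eq_on_dense[OF L(1) mero_Z[OF adm] open_conv L(2)] by blast
    then show ?thesis using L(1) by (intro that)
  qed
qed

lemma prod_zt:
  assumes "(\<Prod>l=1..i. z l) = 1"
  shows "(\<Prod>l=1..k. zt z i l) = (\<Prod>l=1..i+k. z l)"
  by (induction k) (simp_all add: assms[simplified] zt_def)

text \<open>As the product up to i is 1, the partial products of the tail are those of the full
  family, and the bound by 1 is inherited.\<close>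

lemma characters_tail:
  assumes f: "characters r f z" and i: "i \<le> r" "(\<Prod>l=1..i. z l) = 1"
  shows "characters (r - i) (\<lambda>k. f (i + k)) (zt z i)"
  unfolding characters_def admissible_def
proof (intro conjI ballI)
  fix k assume "k \<in> {1..r - i}"
  then have k: "i + k \<in> {1..r}" "k \<noteq> 0" by auto
  note fk = bspec[OF conjunct2[OF f[unfolded characters_def]] k(1)]
  have adm: "z (i + k) \<noteq> 0 \<and> cmod (\<Prod>l=1..i+k. z l) \<le> 1"
    using f k(1) unfolding characters_def admissible_def by blast
  show "zt z i k \<noteq> 0" using adm k(2) by (simp add: zt_def)
  show "cmod (\<Prod>l=1..k. zt z i l) \<le> 1" using adm by (simp only: prod_zt[OF i(2)])
  show "\<forall>a b. f (i + k) (a + b) = f (i + k) a * f (i + k) b" "\<forall>a. f (i + k) a \<noteq> 0" using fk by blast+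
  show "zt z i k = f (i + k) 1" using fk k(2) by (simp add: zt_def)
qed

text \<open>\<open>L_tail\<close> agrees with \<open>Z\<close> only off an exceptional set in fewer
  variables. Its complement pulls back to a dense set because the last r - i coordinates can be
  moved freely.\<close>

lemma dense_open_tail_preimage:
  assumes U: "dense_open_in (Cpow (r - i)) U" and i: "i \<le> r"
  shows "dense_open_in (Cpow r) {s \<in> topspace (Cpow r). tail r i s \<in> U}"
  unfolding dense_open_in_Cpow_topspace
proof (intro conjI ballI allI impI)
  note U' = U[unfolded dense_open_in_Cpow_topspace]
  show "openin (Cpow r) {s \<in> topspace (Cpow r). tail r i s \<in> U}"
    unfolding openin_Cpow[of r]
  proof (intro conjI ballI)
    fix p assume "p \<in> {s \<in> topspace (Cpow r). tail r i s \<in> U}"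
    then obtain e where e: "e > 0" "pdisc (r - i) (tail r i p) e \<subseteq> U"
      using U' unfolding openin_Cpow by blast
    have "tail r i s \<in> pdisc (r - i) (tail r i p) e" if "s \<in> pdisc r p (e / (1 + real r))" for s
      using aff_pdisc[OF that e(1)] unfolding tail_eq_aff .
    then have "pdisc r p (e / (1 + real r)) \<subseteq> {s \<in> topspace (Cpow r). tail r i s \<in> U}"
      using e(2) pdisc_subset by blast
    then show "\<exists>e>0. pdisc r p e \<subseteq> {s \<in> topspace (Cpow r). tail r i s \<in> U}"
      using e(1) by (intro exI[of _ "e / (1 + real r)"]) simp
  qed blast
  fix p e assume p: "p \<in> topspace (Cpow r)" and e: "(e::real) > 0"
  obtain q where q: "q \<in> pdisc (r - i) (tail r i p) e" "q \<in> U"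
    using U' tail_topspace e by blast
  define s where "s = (\<lambda>k\<in>{1..r}. if k \<le> i then p k else q (k - i))"
  have "q \<in> extensional {1..r - i}"
    using q(1) pdisc_subset by (auto simp: topspace_Cpow PiE_def)
  then have "tail r i s = q"
    using i by (auto simp: tail_def s_def fun_eq_iff extensional_def)
  moreover have "s \<in> pdisc r p e"
    unfolding pdisc_def
  proof (intro CollectI conjI ballI)
    show "s \<in> topspace (Cpow r)" by (auto simp: s_def topspace_Cpow)
    fix k assume k: "k \<in> {1..r}"
    show "cmod (s k - p k) < e"
    proof (cases "k \<le> i")
      case False
      then have ki: "k - i \<in> {1..r - i}" "i + (k - i) = k" using k by auto
      then have "tail r i p (k - i) = p k" by (simp only: tail_def restrict_apply if_True)
      moreover have "cmod (q (k - i) - tail r i p (k - i)) < e" using q(1) ki(1) by (simp add: pdisc_def)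
      ultimately show ?thesis using False k by (simp add: s_def)
    qed (use e k in \<open>simp add: s_def\<close>)
  qed
  ultimately show "pdisc r p e \<inter> {s \<in> topspace (Cpow r). tail r i s \<in> U} \<noteq> {}"
    using q(2) pdisc_subset by blast
qed

lemma dense_generic_hyperplane:
  assumes "i \<le> r"
  shows "dense_open_in (subtopology (Cpow r) (hyperplane r (\<lambda>s. psum s i) c))
     (HGen r i \<inter> hyperplane r (\<lambda>s. psum s i) c)"
proof -
  let ?H = "hyperplane r (\<lambda>s. psum s i) c"
  have H: "?H \<subseteq> topspace (Cpow r)" by (auto simp: hyperplane_def)
  show ?thesis
    unfolding dense_open_in_Cpow[OF H]
  proof (intro conjI ballI allI impI)
    fix p assume "p \<in> HGen r i \<inter> ?H"
    then obtain e where "e > 0" "pdisc r p e \<subseteq> HGen r i"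
      using openin_HGen[of r i] unfolding openin_Cpow by blast
    then show "\<exists>e>0. pdisc r p e \<inter> ?H \<subseteq> HGen r i \<inter> ?H" by blast
  next
    fix p e assume p: "p \<in> ?H" and e: "(e::real) > 0"
    then have "p \<in> topspace (Cpow r)" using H by blast
    then obtain s where "s \<in> pdisc r p e" "s \<in> HGen r i" "psum s i = psum p i"
      using HGen_dense[OF _ e assms] by blast
    then have "s \<in> pdisc r p e \<inter> (HGen r i \<inter> ?H)"
      using p HGen_subset[of r i] by (auto simp: hyperplane_def)
    then show "pdisc r p e \<inter> (HGen r i \<inter> ?H) \<noteq> {}" by blast
  qed simp
qed

text \<open>Regularity at any point p, generic or not, would force the residue to vanish at generic
  points of the hyperplane near p, whereas it is a shorter series that is nonzero somewhere on every
  open set.\<close>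

lemma L_polar_along:
  assumes f: "characters r f z" and r: "r \<ge> 1" and z1: "z 1 = 1"
  shows "polar_along r (L r f) (hyperplane r (\<lambda>s. s 1) 1)"
proof -
  obtain q where q: "r = Suc q" using r by (cases r) auto
  have adm: "admissible r z" using f by (simp add: characters_def)
  obtain U0 where U0: "mero r (L r f)" "dense_open_in (Cpow r) U0" "\<And>s. s \<in> U0 \<Longrightarrow> L r f s = Z r z s"
    by (rule L_eq_Z[OF f]) iprover
  have False if p: "p \<in> hyperplane r (\<lambda>s. s 1) 1" and v: "regular_value r (L r f) p v" for p v
  proof -
    have pt: "p \<in> topspace (Cpow r)" "p 1 = 1" using p by (simp_all add: hyperplane_def)
    obtain V g U where V: "p \<in> V" "holo_on r g V" "dense_open_in (subtopology (Cpow r) V) U"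
      "\<And>s. s \<in> U \<Longrightarrow> L r f s = g s"
      using v unfolding regular_value_def by blast
    obtain e where e: "e > 0" "pdisc r p e \<subseteq> V"
      using holo_onD(1)[OF V(2)] V(1) unfolding openin_Cpow by blast
    have zero: "Z (r - 1) (zt z 1) (tail r 1 t) = 0"
      if t: "t \<in> pdisc r p e" "t \<in> HGen r 1" "t 1 = 1" for t
    proof -
      have tt: "t \<in> topspace (Cpow r)" using t pdisc_subset by blast
      have cnt: "cnt z 1 = 1" using cnt_mz[of 1 z] z1 by (simp add: eps_def cnt_0)
      have "regular_gen r (\<lambda>s. (psum s 1 - of_int 1) * Z r z s) t (Z (r - 1) (zt z 1) (tail r 1 t))"
        using residue_Z[OF adm, of 1 t 1] r z1 t cnt by (simp add: psum_def)
      then obtain d h where h: "d > 0" "holo_on r h (pdisc r t d)"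
        "\<And>s. s \<in> pdisc r t d \<Longrightarrow> s \<in> gen r \<Longrightarrow> (psum s 1 - of_int 1) * Z r z s = h s"
        "Z (r - 1) (zt z 1) (tail r 1 t) = h t" by (rule regular_genE) iprover
      obtain d' where d': "d' > 0" "pdisc r t d' \<subseteq> pdisc r p e" using t(1) pdisc_in_pdisc by blast
      let ?P = "pdisc r t (min d d')"
      have PV: "?P \<subseteq> V" using d' e by (auto simp: pdisc_min)
      have tP: "t \<in> ?P" using h d' by (intro centre_in_pdisc[OF tt]) simp
      \<comment> \<open>If g extends \<open>L\<close> holomorphically, (s_1 - 1) g and the extension
        h from the residue formula agree on a dense set, hence at t, where the former is 0.\<close>
      define k where "k = (\<lambda>s. (psum s 1 - 1) * g s - h s)"
      have "k t = 0"
      proof (rule holo_on_zero_by_density[where V = ?P and F = k and p = t])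
        show "holo_on r k ?P"
          unfolding k_def using r
          by (intro holo_on_diff holo_on_mult holo_on_psum holo_on_const openin_pdisc
              holo_on_subset[OF V(2) openin_pdisc PV] holo_on_shrink[OF h(2)]) simp_all
        fix a c assume a: "a \<in> ?P" and c: "(c::real) > 0"
        obtain c' where c': "c' > 0" "pdisc r a c' \<subseteq> ?P" using a pdisc_in_pdisc by blast
        have "pdisc r a (min c c') \<inter> U \<inter> (U0 \<inter> gen r) \<noteq> {}"
        proof (rule pdisc_dense_Int[OF holo_onD(2)[OF V(2)] V(3) holo_onD(1)[OF V(2)]])
          have D: "dense_open_in (Cpow r) (U0 \<inter> gen r)" by (rule dense_open_in_Int[OF U0(2) dense_gen])
          then show "openin (Cpow r) (U0 \<inter> gen r)" by (simp add: dense_open_in_Cpow_topspace)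
          show "pdisc r b \<epsilon> \<inter> (U0 \<inter> gen r) \<noteq> {}" if "b \<in> pdisc r a (min c c')" "\<epsilon> > 0" for b \<epsilon>
            using D that pdisc_subset unfolding dense_open_in_Cpow_topspace by blast
        qed (use a PV c c' in auto)
        then obtain b where b: "b \<in> pdisc r a c" "b \<in> pdisc r a c'" "b \<in> U" "b \<in> U0" "b \<in> gen r"
          by (auto simp: pdisc_min)
        have "b \<in> pdisc r t d" using b(2) c'(2) by (auto simp: pdisc_min)
        then have "(psum b 1 - 1) * Z r z b = h b" using h(3)[of b] b(5) by simp
        moreover have "g b = Z r z b" using V(4)[OF b(3)] U0(3)[OF b(4)] by simp
        ultimately have "k b = 0" by (simp add: k_def)
        then show "\<exists>s\<in>pdisc r a c. k s = 0" using b(1) by blast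
      qed (rule tP)
      then show ?thesis using h(4) t(3) by (simp add: k_def psum_def)
    qed
    have adm': "admissible q (zt z 1)"
      using characters_tail[OF f, of 1] r z1 q by (simp add: characters_def)
    define W where "W = pdisc q (tail r 1 p) e \<inter> gen q"
    have W: "openin (Cpow q) W" unfolding W_def by (intro openin_Int openin_pdisc openin_HGen)
    have "W \<noteq> {}"
    proof -
      have "tail r 1 p \<in> topspace (Cpow q)" using tail_topspace[of r 1 p] q by simp
      then obtain w where "w \<in> pdisc q (tail r 1 p) e" "w \<in> gen q"
        using HGen_dense[OF _ e(1), of _ q 0] by blast
      then show ?thesis by (auto simp: W_def)
    qed
    from Z_not_locally_zero[OF adm' W this] obtain w where w: "w \<in> W" "Z q (zt z 1) w \<noteq> 0" by blast
    \<comment> \<open>The point of the hyperplane s_1 = 1 with tail w; it is close to p and generic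
      because w is close to the tail of p and generic.\<close>
    define t where "t = (\<lambda>k\<in>{1..r}. if k \<le> 1 then 1 else w (k - 1))"
    have wq: "w \<in> gen q" "w \<in> pdisc q (tail r 1 p) e" using w by (auto simp: W_def)
    have "w \<in> extensional {1..q}" using wq(2) pdisc_subset by (auto simp: topspace_Cpow PiE_def)
    then have tw: "tail r 1 t = w"
      using q by (auto simp: tail_def t_def fun_eq_iff extensional_def)
    have t1: "t 1 = 1" using r by (simp add: t_def)
    have tt: "t \<in> topspace (Cpow r)" by (auto simp: t_def topspace_Cpow)
    have "t \<in> pdisc r p e"
      unfolding pdisc_def
    proof (intro CollectI conjI ballI tt)
      fix k assume k: "k \<in> {1..r}"
      show "cmod (t k - p k) < e"
      proof (cases "k \<le> 1")
        case True
        then show ?thesis using k e(1) t1 pt(2) by (cases "k = 1") auto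
      next
        case False
        then have k1: "k - 1 \<in> {1..r - 1}" "1 + (k - 1) = k" using k by auto
        then have "tail r 1 p (k - 1) = p k" by (simp only: tail_def restrict_apply if_True)
        moreover have "cmod (w (k - 1) - tail r 1 p (k - 1)) < e" using wq(2) k1(1) q by (simp add: pdisc_def)
        ultimately show ?thesis using False k by (simp add: t_def)
      qed
    qed
    moreover have "t \<in> HGen r 1"
      unfolding HGen_def
    proof (intro CollectI conjI tt ballI)
      fix k assume k: "k \<in> {1..r} - {1}"
      then have "k - 1 \<in> {1..q}" using q by auto
      then have "Im (psum w (k - 1)) \<noteq> 0" using wq(1) unfolding gen_iff by blast
      moreover have "psum w (k - 1) = psum t k - 1"
      proof -
        have k1: "k - 1 \<le> r - 1" "1 + (k - 1) = k" using k by auto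
        have "psum t 1 = 1" using t1 by (simp add: psum_def)
        then show ?thesis using psum_tail[OF k1(1), of t] by (simp only: k1(2) tw)
      qed
      ultimately show "Im (psum t k) \<noteq> 0" by simp
    qed
    ultimately have "Z (r - 1) (zt z 1) (tail r 1 t) = 0" using t1 by (intro zero)
    then show False using w(2) tw q by simp
  qed
  then show ?thesis unfolding polar_along_def using U0(1) by blast
qed

text \<open>Both restrictions are witnessed by the same explicit R on the same dense open set of
  generic points of the hyperplane.\<close>

lemma L_residue:
  assumes f: "characters r f z"
    and mono: "strict_mono_on {1..m} idx"
    and img: "idx ` {1..m} = {i \<in> {1..r}. partial_prod f i 1 = 1}"
    and j: "j \<in> {1..m}" and n: "n \<le> int j"
  shows "\<exists>R. has_residue_along r (L r f) (\<lambda>s. psum s (idx j)) (of_int n) R \<and>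
     restricts_to r (hyperplane r (\<lambda>s. psum s (idx j)) (of_int n))
       (\<lambda>s. L_tail r f (idx j) s * C_mat f idx j s 0 (nat (int j - n))) R"
proof -
  define i where "i = idx j"
  define d where "d = nat (int j - n)"
  define H where "H = hyperplane r (\<lambda>s. psum s i) (of_int n)"
  have i: "1 \<le> i" "i \<le> r" "partial_prod f i 1 = 1" using img j by (auto simp: i_def)
  have adm: "admissible r z" using f by (simp add: characters_def)
  have zf: "z k = f k 1" if "k \<in> {1..r}" for k using f that by (simp add: characters_def)
  have zi: "(\<Prod>l=1..i. z l) = 1"
    using i zf unfolding partial_prod_def by (subst prod.cong[OF refl zf]) auto
  have C: "C_mat f idx j s 0 d = C_row (i - 1) r z s d" if "s \<in> HGen r i" for s
    unfolding i_def
  proof (rule C_mat_eq_C_row(1)[OF zf mono img j])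
    fix k assume "1 \<le> k" "k < idx j"
    then have "k \<in> {1..r} - {i}" using i by (auto simp: i_def)
    then show "Im (psum s k) \<noteq> 0" using that unfolding HGen_def by blast
  qed
  \<comment> \<open>The claim does not involve s, but \<open>C_mat_eq_C_row\<close> is stated at a
    point with nonreal partial sums, so any generic point is supplied.\<close>
  have cnt: "cnt z i = j"
  proof -
    obtain s where "s \<in> pdisc r (\<lambda>k\<in>{1..r}. 0) 1" "s \<in> gen r"
      by (rule HGen_dense[of "\<lambda>k\<in>{1..r}. 0" r 1 0]) (auto simp: topspace_Cpow)
    then have s: "Im (psum s k) \<noteq> 0" if "k \<in> {1..r}" for k using that unfolding gen_iff by blast
    show ?thesis unfolding i_def
      by (rule C_mat_eq_C_row(2)[OF zf mono img j, of s]) (use s i in \<open>auto simp: i_def\<close>)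
  qed
  have ft: "characters (r - i) (\<lambda>k. f (i + k)) (zt z i)" by (rule characters_tail[OF f i(2) zi])
  then have admt: "admissible (r - i) (zt z i)" by (simp add: characters_def)
  obtain U0 where U0: "mero r (L r f)" "dense_open_in (Cpow r) U0" "\<And>s. s \<in> U0 \<Longrightarrow> L r f s = Z r z s"
    by (rule L_eq_Z[OF f]) iprover
  obtain Ut where Ut: "dense_open_in (Cpow (r - i)) Ut"
    "\<And>s. s \<in> Ut \<Longrightarrow> L (r - i) (\<lambda>k. f (i + k)) s = Z (r - i) (zt z i) s"
    by (rule L_eq_Z[OF ft]) iprover
  define U1 where "U1 = {s \<in> topspace (Cpow r). tail r i s \<in> Ut}"
  have U1: "dense_open_in (Cpow r) U1" unfolding U1_def by (rule dense_open_tail_preimage[OF Ut(1) i(2)])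
  have LT: "L_tail r f i s = Z (r - i) (zt z i) (tail r i s)" if "s \<in> U1" for s
    using Ut(2)[of "tail r i s"] that by (simp add: L_tail_def tail_def U1_def)
  define R where "R p = Z (r - i) (zt z i) (tail r i p) * C_row (i - 1) r z p d" for p
  have dense: "dense_open_in (subtopology (Cpow r) H) (HGen r i \<inter> H)"
    unfolding H_def by (rule dense_generic_hyperplane[OF i(2)])
  have pH: "p \<in> topspace (Cpow r)" "psum p i = of_int n" "p \<in> HGen r i" if "p \<in> HGen r i \<inter> H" for p
    using that by (auto simp: H_def hyperplane_def)
  have "restricts_to r H (\<lambda>s. (psum s i - of_int n) * L r f s) R"
    unfolding restricts_to_def
  proof (intro exI[of _ "HGen r i \<inter> H"] conjI dense ballI)
    fix p assume "p \<in> HGen r i \<inter> H"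
    note p = pH[OF this]
    have "regular_gen r (\<lambda>s. (psum s i - of_int n) * Z r z s) p (R p)"
      using residue_Z[OF adm i(1,2) zi p(3,2)] n by (simp add: cnt R_def d_def mult.commute)
    then show "regular_value r (\<lambda>s. (psum s i - of_int n) * L r f s) p (R p)"
      by (rule regular_value_of_regular_gen[OF _ p(1) U0(2)]) (simp add: U0(3))
  qed
  moreover have "restricts_to r H (\<lambda>s. L_tail r f i s * C_mat f idx j s 0 d) R"
    unfolding restricts_to_def
  proof (intro exI[of _ "HGen r i \<inter> H"] conjI dense ballI)
    fix p assume "p \<in> HGen r i \<inter> H"
    note p = pH[OF this]
    have "tail r i p \<in> gen (r - i)" using p i by (intro tail_HGen) simp_all
    then have "regular_gen r (\<lambda>s. Z (r - i) (zt z i) (tail r i s)) p (Z (r - i) (zt z i) (tail r i p))"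
      by (rule regular_gen_tail[OF admt])
    moreover have "regular_gen r (\<lambda>s. C_row (i - 1) r z s d) p (C_row (i - 1) r z p d)"
    proof (rule regular_gen_C_row[OF _ p(1)])
      fix k assume "k \<in> {1..i - 1}"
      then have "k \<in> {1..r} - {i}" using i by auto
      then show "Im (psum p k) \<noteq> 0" using p(3) unfolding HGen_def by blast
    qed (use i in simp)
    ultimately have "regular_gen r (\<lambda>s. Z (r - i) (zt z i) (tail r i s) * C_row (i - 1) r z s d) p (R p)"
      unfolding R_def by (rule regular_gen_mult)
    then show "regular_value r (\<lambda>s. L_tail r f i s * C_mat f idx j s 0 d) p (R p)"
    proof (rule regular_value_of_regular_gen[OF _ p(1) U1])
      fix s assume "s \<in> U1" "s \<in> gen r"
      then show "L_tail r f i s * C_mat f idx j s 0 d = Z (r - i) (zt z i) (tail r i s) * C_row (i - 1) r z s d"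
        using LT C[of s] gen_subset_HGen[of r i] by auto
    qed
  qed
  ultimately show ?thesis
    unfolding has_residue_along_def H_def i_def d_def using U0(1) by blast
qed

lemma C_mat_first: "idx 1 = 1 \<Longrightarrow> C_mat f idx 1 s 0 0 = 1"
  by (simp add: C_mat_def Let_def ut_prod_Nil[simplified] ut_mult_def ut_id_def ut_prod_def)

theorem theorem6p2:
  fixes r m :: nat and f :: "nat \<Rightarrow> int \<Rightarrow> complex" and idx :: "nat \<Rightarrow> nat"
  assumes "r \<ge> 1"
    and "\<And>i. i \<in> {1..r} \<Longrightarrow> (\<forall>a b. f i (a + b) = f i a * f i b) \<and> (\<forall>a. f i a \<noteq> 0)"
    and "\<And>i. i \<in> {1..r} \<Longrightarrow> cmod (partial_prod f i 1) \<le> 1"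
    and "strict_mono_on {1..m} idx"
    and "idx ` {1..m} = {i \<in> {1..r}. partial_prod f i 1 = 1}"
  shows "(m \<ge> 1 \<and> idx 1 = 1 \<longrightarrow>
            polar_along r (L r f) (hyperplane r (\<lambda>s. s 1) 1) \<and>
            (\<exists>R. has_residue_along r (L r f) (\<lambda>s. s 1) 1 R \<and>
                 restricts_to r (hyperplane r (\<lambda>s. s 1) 1) (\<lambda>s. L_tail r f 1 s) R)) \<and>
         (\<forall>j\<in>{1..m}. \<forall>n::int. n \<le> int j \<longrightarrow>
            (\<exists>R. has_residue_along r (L r f) (\<lambda>s. psum s (idx j)) (of_int n) R \<and>
                 restricts_to r (hyperplane r (\<lambda>s. psum s (idx j)) (of_int n))
                   (\<lambda>s. L_tail r f (idx j) s * C_mat f idx j s 0 (nat (int j - n))) R))"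
proof (intro conjI impI ballI allI)
  define z where "z k = f k 1" for k
  have f: "characters r f z"
    unfolding characters_def admissible_def
    using assms(2,3) by (auto simp: z_def partial_prod_def)
  show res: "\<exists>R. has_residue_along r (L r f) (\<lambda>s. psum s (idx j)) (of_int n) R \<and>
      restricts_to r (hyperplane r (\<lambda>s. psum s (idx j)) (of_int n))
        (\<lambda>s. L_tail r f (idx j) s * C_mat f idx j s 0 (nat (int j - n))) R"
    if "j \<in> {1..m}" "n \<le> int j" for j n
    by (rule L_residue[OF f assms(4,5) that])
  assume m: "m \<ge> 1 \<and> idx 1 = 1"
  then have "1 \<in> idx ` {1..m}" by (intro image_eqI[of _ _ 1]) simp_all
  then have "partial_prod f 1 1 = 1" unfolding assms(5) by simp
  then have "z 1 = 1" by (simp add: z_def partial_prod_def)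
  then show "polar_along r (L r f) (hyperplane r (\<lambda>s. s 1) 1)"
    by (rule L_polar_along[OF f assms(1)])
  \<comment> \<open>The residue along s_1 = 1 is the case j = n = 1 of the general formula, where
    the matrix is an empty product.\<close>
  have "C_mat f idx 1 s 0 0 = 1" for s by (rule C_mat_first) (use m in simp)
  moreover have "psum s 1 = s 1" for s by (simp add: psum_def)
  ultimately show "\<exists>R. has_residue_along r (L r f) (\<lambda>s. s 1) 1 R \<and>
      restricts_to r (hyperplane r (\<lambda>s. s 1) 1) (\<lambda>s. L_tail r f 1 s) R"
    using res[of 1 1] m by simp
qed

end
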